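(* Let $\lambda$ be a Perron number of degree $d\ge 3$ and spectral ratio $\rho$, and set $\mathbb{K}:=\mathbb{Q}(\lambda)$. Let $B(\mathbb{K},\rho)$ denote either $\big(\frac{8d}{1-\rho}\big)^{d^2}\tau_{\min}(\mathcal{O}_\mathbb{K})^{d/2}$ or $\big(\frac{8d}{1-\rho}\big)^{d^2}\sqrt{D_\mathbb{K}}$ (the statement holds for each choice). Let $M=1+\frac{4}{1-\rho}$ and \[\kappa(\mathbb{K},\rho):=\max\{d_{PF}(\alpha) : \alpha\in[1,M]\cap\mathbb{K}\text{ is a Perron number}\}.\] Then \[ d_{PF}(\lambda)\le \max\{2^{d^2}B(\mathbb{K},\rho),\ \kappa(\mathbb{K},\rho)\}. \]
   Context: A real algebraic integer $\lambda \geq 1$ is Perron if it is strictly larger in absolute value than all its other Galois conjugates; its spectral ratio is $\max_i|\lambda_i|/\lambda$ over Galois conjugates $\lambda_i\ne\lambda$. A non-negative real square matrix $A$ is primitive if $A^k$ has all entries positive for some natural $k$. The Perron--Frobenius degree $d_{PF}(\lambda)$ is the least dimension of a non-negative integral primitive matrix with spectral radius $\lambda$. $\mathcal{O}_\mathbb{K}$ is the ring of integers and $D_\mathbb{K}$ the discriminant of $\mathbb{K}$ (square of $\det(\sigma_i(\omega_j))$ for a $\mathbb{Z}$-basis $\omega_j$ of $\mathcal{O}_\mathbb{K}$ and all embeddings $\sigma_i$). Minimal Hermite-like thickness: let $\sigma_1,\dots,\sigma_r$ be the real embeddings and $\sigma_{r+1},\bar\sigma_{r+1},\dots,\sigma_{r+s},\bar\sigma_{r+s}$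 the complex ones ($r+2s=d$); identify $\mathbb{K}_\mathbb{R}=\mathbb{K}\otimes_\mathbb{Q}\mathbb{R}$ with $\mathbb{R}^r\times\mathbb{C}^s\cong\mathbb{R}^d$ via $x\mapsto(\sigma_1(x),\dots,\sigma_{r+s}(x))$. Let $\mathfrak{B}$ be the set of $\alpha\in\mathbb{R}^r\times\mathbb{C}^s$ with $\alpha=\bar\alpha$ and all components positive. For $\alpha\in\mathfrak B$ put $q_\alpha(x,x)=\sum_{i\le r}\alpha_i|\sigma_i(x)|^2+2\sum_{j>r}\alpha_j|\sigma_j(x)|^2$ (with associated bilinear form), $\max(\mathcal{O}_\mathbb{K},q_\alpha)=\inf\{u:\forall x\in\mathbb{K}_\mathbb{R}\,\exists y\in\mathcal{O}_\mathbb{K},\ q_\alpha(x-y,x-y)\le u\}$, $\det(\mathcal{O}_\mathbb{K},q_\alpha)$ the Gram determinant of $q_\alpha$ on a $\mathbb{Z}$-basis of $\mathcal{O}_\mathbb{K}$, $\tau(\mathcal{O}_\mathbb{K},q_\alpha)=\max(\mathcal{O}_\mathbb{K},q_\alpha)/\det(\mathcal{O}_\mathbb{K},q_\alpha)^{1/d}$, and $\tau_{\min}(\mathcal{O}_\mathbb{K})=\inf_{\alpha\in\mathfrak B}\tau(\mathcal{O}_\mathbb{K},q_\alpha)$.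
   Formalization: The square root of the discriminant D_K is taken of its absolute value, since D_K is negative when the number of complex places is odd (e.g. D_K = -23 for the plastic number) and the stated bound would then not be a real number. *)

theory Defs
  imports "HOL-Computational_Algebra.Computational_Algebra" "Jordan_Normal_Form.Spectral_Radius"
begin

definition min_poly :: "complex \<Rightarrow> rat poly" where
  "min_poly x = (THE p. monic p \<and> irreducible p \<and> poly (map_poly of_rat p) x = 0)"

definition alg_degree :: "real \<Rightarrow> nat" where
  "alg_degree l = degree (min_poly (of_real l))"

definition conjugates :: "real \<Rightarrow> complex set" where
  "conjugates l = {z. poly (map_poly of_rat (min_poly (of_real l))) z = 0}"

definition perron :: "real \<Rightarrow> bool" where
  "perron l \<longleftrightarrow> algebraic_int l \<and> l \<ge> 1 \<and>
     (\<forall>z \<in> conjugates l. z \<noteq> of_real l \<longrightarrow> cmod z < l)"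

definition spectral_ratio :: "real \<Rightarrow> real" where
  "spectral_ratio l = Max ((\<lambda>z. cmod z / l) ` (conjugates l - {of_real l}))"

definition is_subfield :: "real set \<Rightarrow> bool" where
  "is_subfield F \<longleftrightarrow> 0 \<in> F \<and> 1 \<in> F \<and> (\<forall>x\<in>F. \<forall>y\<in>F. x + y \<in> F \<and> x * y \<in> F)
     \<and> (\<forall>x\<in>F. - x \<in> F \<and> inverse x \<in> F)"

definition QQ_adj :: "real \<Rightarrow> real set" where
  "QQ_adj l = \<Inter> {F. is_subfield F \<and> l \<in> F}"

definition ring_of_integers :: "real set \<Rightarrow> real set" where
  "ring_of_integers K = {x \<in> K. algebraic_int x}"

definition embeddings :: "real set \<Rightarrow> (real \<Rightarrow> complex) set" where
  "embeddings K = {\<sigma>. (\<forall>x\<in>K. \<forall>y\<in>K. \<sigma> (x + y) = \<sigma> x + \<sigma> y \<and> \<sigma> (x * y) = \<sigma> x * \<sigma> y)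
      \<and> \<sigma> 1 = 1 \<and> (\<forall>x. x \<notin> K \<longrightarrow> \<sigma> x = 0)}"

definition field_degree :: "real set \<Rightarrow> nat" where
  "field_degree K = card (embeddings K)"

definition integral_basis :: "real set \<Rightarrow> (nat \<Rightarrow> real) \<Rightarrow> bool" where
  "integral_basis K \<omega> \<longleftrightarrow> (\<forall>j < field_degree K. \<omega> j \<in> ring_of_integers K) \<and>
     (\<forall>x \<in> ring_of_integers K. \<exists>!c :: nat \<Rightarrow> int. (\<forall>j \<ge> field_degree K. c j = 0) \<and>
         x = (\<Sum>j < field_degree K. of_int (c j) * \<omega> j))"

definition discriminant :: "real set \<Rightarrow> real" where
  "discriminant K = Re (SOME D. \<exists>\<omega> e. integral_basis K \<omega> \<and>
      bij_betw e {..<field_degree K} (embeddings K) \<and>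
      D = (det (mat (field_degree K) (field_degree K) (\<lambda>(i, j). e i (\<omega> j)))) ^ 2)"

text \<open>K_R = R^r x C^s realised as the conjugation-symmetric vectors indexed by all embeddings.\<close>
definition KR :: "real set \<Rightarrow> ((real \<Rightarrow> complex) \<Rightarrow> complex) set" where
  "KR K = {z. (\<forall>\<sigma>\<in>embeddings K. z (\<lambda>x. cnj (\<sigma> x)) = cnj (z \<sigma>)) \<and>
             (\<forall>\<sigma>. \<sigma> \<notin> embeddings K \<longrightarrow> z \<sigma> = 0)}"

definition minkowski :: "real set \<Rightarrow> real \<Rightarrow> (real \<Rightarrow> complex) \<Rightarrow> complex" where
  "minkowski K y = (\<lambda>\<sigma>. if \<sigma> \<in> embeddings K then \<sigma> y else 0)"

definition weights :: "real set \<Rightarrow> ((real \<Rightarrow> complex) \<Rightarrow> real) set" where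
  "weights K = {\<alpha>. \<forall>\<sigma>\<in>embeddings K. \<alpha> \<sigma> > 0 \<and> \<alpha> (\<lambda>x. cnj (\<sigma> x)) = \<alpha> \<sigma>}"

text \<open>q_alpha; summing over all embeddings gives the factor 2 on complex places.\<close>
definition qform :: "real set \<Rightarrow> ((real \<Rightarrow> complex) \<Rightarrow> real) \<Rightarrow>
    ((real \<Rightarrow> complex) \<Rightarrow> complex) \<Rightarrow> ((real \<Rightarrow> complex) \<Rightarrow> complex) \<Rightarrow> real" where
  "qform K \<alpha> z w = (\<Sum>\<sigma>\<in>embeddings K. \<alpha> \<sigma> * Re (z \<sigma> * cnj (w \<sigma>)))"

definition cov_max :: "real set \<Rightarrow> ((real \<Rightarrow> complex) \<Rightarrow> real) \<Rightarrow> real" where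
  "cov_max K \<alpha> = Inf {u. \<forall>x \<in> KR K. \<exists>y \<in> ring_of_integers K.
      qform K \<alpha> (x - minkowski K y) (x - minkowski K y) \<le> u}"

definition gram_det :: "real set \<Rightarrow> ((real \<Rightarrow> complex) \<Rightarrow> real) \<Rightarrow> real" where
  "gram_det K \<alpha> = (let \<omega> = (SOME \<omega>. integral_basis K \<omega>) in
      det (mat (field_degree K) (field_degree K)
        (\<lambda>(i, j). qform K \<alpha> (minkowski K (\<omega> i)) (minkowski K (\<omega> j)))))"

definition thickness :: "real set \<Rightarrow> ((real \<Rightarrow> complex) \<Rightarrow> real) \<Rightarrow> real" where
  "thickness K \<alpha> = cov_max K \<alpha> / gram_det K \<alpha> powr (1 / real (field_degree K))"

definition tau_min :: "real set \<Rightarrow> real" where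
  "tau_min K = Inf (thickness K ` weights K)"

definition primitive_mat :: "int mat \<Rightarrow> bool" where
  "primitive_mat A \<longleftrightarrow> (\<exists>k \<ge> 1. \<forall>i < dim_row A. \<forall>j < dim_col A. (A ^\<^sub>m k) $$ (i, j) > 0)"

definition PF_degree :: "real \<Rightarrow> nat" where
  "PF_degree l = (LEAST n. \<exists>A. A \<in> carrier_mat n n \<and>
      (\<forall>i < n. \<forall>j < n. A $$ (i, j) \<ge> 0) \<and> primitive_mat A \<and>
      spectral_radius (map_mat of_int A) = l)"

definition kappa :: "real set \<Rightarrow> real \<Rightarrow> nat" where
  "kappa K \<rho> = Max {PF_degree a | a. a \<in> {1 .. 1 + 4 / (1 - \<rho>)} \<and> a \<in> K \<and> perron a}"

end

theory Submission
  imports Defs "HOL-Analysis.L2_Norm"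
begin

text \<open>If \<open>l \<le> 1 + 4 / (1 - \<rho>)\<close>, then \<open>l\<close> itself is one of the finitely many Perron numbers over
which \<open>\<kappa>\<close> takes the maximum. Otherwise let \<open>L\<close> be a lattice of full rank in \<open>K\<close> that is stable under
multiplication by \<open>l\<close>, and let \<open>R\<close> be its covering radius for a weighted norm on \<open>K\<^sub>R\<close>. In the cone
of vectors whose coordinate at the identity embedding dominates all the others, take the lattice
points \<open>S\<close> of height between \<open>H\<close> and \<open>2 H\<close>, where \<open>H\<close> is a multiple of \<open>R / (1 - \<rho>)\<close>. For \<open>x \<in> S\<close> the
segment from \<open>0\<close> to \<open>(l - 1) x\<close> lies so deep in the cone that rounding equidistant points on it to
lattice points splits \<open>(l - 1) x\<close> into summands from \<open>S\<close>. The multiplicities form a non-negative matrix with positive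
diagonal and eigenvalue \<open>l\<close>, so the Perron-Frobenius degree of \<open>l\<close> is at most the number of lattice points in a
ball of radius proportional to \<open>R / (1 - \<rho>)\<close>.

This number is estimated with a Korkin-Zolotarev reduced basis of \<open>O\<^sub>K\<close>, whose Gram-Schmidt lengths
\<open>g\<^sub>i\<close> multiply to the square root of the Gram determinant. For \<open>L = O\<^sub>K\<close> one has \<open>g\<^sub>i \<le> 3 R\<close>, and the
count is bounded in terms of the thickness. For the discriminant one takes unit weights and for \<open>L\<close> the dual of
\<open>O\<^sub>K\<close>: the Gram-Schmidt lengths of \<open>L\<close> are \<open>1 / g\<^sub>i\<close>, and as non-zero integers have
norm at least \<open>1\<close> they are bounded in terms of \<open>d\<close>, hence so is the covering radius of \<open>L\<close>.\<close>

section \<open>Matrices from finite sets of positive reals\<close>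

text \<open>The discriminant bound is what forces a second lattice. Counting in \<open>OK\<close>
  gives about \<open>(R / (1 - \<rho>)) ^ d\<close> divided by the square root of the Gram
  determinant. Measured against the thickness this is good, but with unit weights \<open>R\<close>
  is controlled only through the largest \<open>g i\<close>, which the degree alone does not bound.
  In the trace dual the lengths \<open>1 / g i\<close> are at most \<open>2 ^ d\<close>, so
  \<open>R\<close> depends on \<open>d\<close> only and the count becomes a multiple of the product
  of the \<open>g i\<close>, which is the square root of the absolute discriminant. The dual is
  closed under multiplication by \<open>OK\<close>, hence by \<open>l\<close>, and so it may replace
  \<open>OK\<close>.

  Lattices are treated as subgroups of the reals, and their geometry is carried by semidefinite
  forms and additive coordinate functions. The price is that only integer multiples of lattice
  elements are at hand, so rounding takes the place of real scaling.

  The constants are generous: the argument yields exponent \<open>d\<close> for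
  \<open>1 / (1 - \<rho>)\<close>, while the claimed bound has exponent \<open>d^2\<close>.\<close>

lemma card_le_of_coset:
  fixes F :: "real set"
  assumes h: "h > 0" and r: "\<And>y. y \<in> F \<Longrightarrow> \<bar>y\<bar> \<le> r"
    and diff: "\<And>y y'. y \<in> F \<Longrightarrow> y' \<in> F \<Longrightarrow> \<exists>k::int. y - y' = of_int k * h"
    and r0: "0 \<le> r"
  shows "finite F \<and> real (card F) \<le> 1 + 2 * r / h"
proof (cases "F = {}")
  case True
  then show ?thesis using h r0 by simp
next
  case False
  then obtain y0 where y0: "y0 \<in> F" by auto
  let ?I = "{\<lceil>(- r - y0) / h\<rceil> .. \<lfloor>(r - y0) / h\<rfloor>}"
  have sub: "F \<subseteq> (\<lambda>k. y0 + of_int k * h) ` ?I"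
  proof
    fix y assume y: "y \<in> F"
    obtain k :: int where k: "y - y0 = of_int k * h" using diff[OF y y0] by auto
    have "of_int k = (y - y0) / h" using k h by simp
    moreover have "(- r - y0) / h \<le> (y - y0) / h" "(y - y0) / h \<le> (r - y0) / h"
      using r[OF y] h by (auto intro!: divide_right_mono)
    ultimately have "k \<in> ?I" by (simp add: ceiling_le_iff le_floor_iff)
    moreover have "y = y0 + of_int k * h" using k by simp
    ultimately show "y \<in> (\<lambda>k. y0 + of_int k * h) ` ?I" by blast
  qed
  have fin: "finite F" using finite_subset[OF sub] by simp
  have "card F \<le> card ?I" using card_mono[OF _ sub] card_image_le[of ?I] by (meson finite_atLeastAtMost_int finite_imageI le_trans)
  also have "real (card ?I) \<le> 1 + 2 * r / h"
  proof -
    have a: "real_of_int \<lfloor>(r - y0) / h\<rfloor> \<le> (r - y0) / h" "(- r - y0) / h \<le> real_of_int \<lceil>(- r - y0) / h\<rceil>"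
      by (auto simp: le_of_int_ceiling)
    have b: "(r - y0) / h - (- r - y0) / h = 2 * r / h" by (simp add: diff_divide_distrib[symmetric])
    have "0 \<le> 2 * r / h" using h r0 by simp
    moreover have "real (card ?I) \<le> max 0 (of_int (\<lfloor>(r - y0) / h\<rfloor> - \<lceil>(- r - y0) / h\<rceil> + 1))" by simp
    moreover have "of_int (\<lfloor>(r - y0) / h\<rfloor> - \<lceil>(- r - y0) / h\<rceil> + 1) \<le> 1 + 2 * r / h"
      unfolding of_int_add of_int_diff of_int_1 using a b by linarith
    ultimately show ?thesis by linarith
  qed
  finally show ?thesis using fin by simp
qed

text \<open>Coordinates are fixed one after the other: given the earlier ones, the next lies in a
  coset of \<open>h i\<close> times the integers inside an interval of length \<open>2 * r\<close>.
  Integrality is only asked for in this triangular sense, because a Gram-Schmidt coordinate of a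
  lattice point is in general no integer multiple of a fixed step.\<close>

lemma card_le_prod_of_coordinates:
  fixes Y :: "nat \<Rightarrow> 'a \<Rightarrow> real" and h :: "nat \<Rightarrow> real"
  assumes h: "\<And>i. i < n \<Longrightarrow> h i > 0" and r0: "0 \<le> r"
    and r: "\<And>i a. i < n \<Longrightarrow> a \<in> A \<Longrightarrow> \<bar>Y i a\<bar> \<le> r"
    and step: "\<And>i a a'. i < n \<Longrightarrow> a \<in> A \<Longrightarrow> a' \<in> A \<Longrightarrow> (\<And>j. j < i \<Longrightarrow> Y j a = Y j a') \<Longrightarrow>
       \<exists>k::int. Y i a - Y i a' = of_int k * h i"
    and inj: "\<And>a a'. a \<in> A \<Longrightarrow> a' \<in> A \<Longrightarrow> (\<And>j. j < n \<Longrightarrow> Y j a = Y j a') \<Longrightarrow> a = a'"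
  shows "finite A \<and> real (card A) \<le> (\<Prod>i<n. 1 + 2 * r / h i)"
proof -
  \<comment> \<open>\<open>T k\<close> is the set of coordinate prefixes of length \<open>k\<close>;
    \<open>F t\<close> below is the fibre over the prefix \<open>t\<close>.\<close>
  define T where "T k = (\<lambda>a. map (\<lambda>j. Y j a) [0..<k]) ` A" for k
  have T: "finite (T k) \<and> real (card (T k)) \<le> (\<Prod>i<k. 1 + 2 * r / h i)" if "k \<le> n" for k
    using that
  proof (induction k)
    case 0
    have "T 0 \<subseteq> {[]}" by (auto simp: T_def)
    then show ?case using card_mono[of "{[]}" "T 0"] finite_subset[of "T 0" "{[]}"] by simp
  next
    case (Suc k)
    define F where "F t = {Y k a | a. a \<in> A \<and> map (\<lambda>j. Y j a) [0..<k] = t}" for t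
    have F: "finite (F t) \<and> real (card (F t)) \<le> 1 + 2 * r / h k" for t
    proof (rule card_le_of_coset)
      fix y y' assume "y \<in> F t" "y' \<in> F t"
      then obtain a a' where a: "a \<in> A" "a' \<in> A" "y = Y k a" "y' = Y k a'"
        "map (\<lambda>j. Y j a) [0..<k] = map (\<lambda>j. Y j a') [0..<k]" by (auto simp: F_def)
      then show "\<exists>m::int. y - y' = of_int m * h k"
        using step[of k a a'] Suc.prems by auto
    qed (use h r r0 Suc.prems in \<open>auto simp: F_def\<close>)
    have eq: "T (Suc k) \<subseteq> (\<Union>t\<in>T k. (\<lambda>y. t @ [y]) ` F t)"
      by (auto simp: T_def F_def)
    have fin: "finite (\<Union>t\<in>T k. (\<lambda>y. t @ [y]) ` F t)" using F Suc by auto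
    have nn: "0 \<le> 1 + 2 * r / h k" using h[of k] Suc.prems r0 by (simp add: add_nonneg_nonneg)
    have "card (T (Suc k)) \<le> card (\<Union>t\<in>T k. (\<lambda>y. t @ [y]) ` F t)" by (rule card_mono[OF fin eq])
    also have "\<dots> \<le> (\<Sum>t\<in>T k. card ((\<lambda>y. t @ [y]) ` F t))" using Suc by (intro card_UN_le) auto
    also have "\<dots> \<le> (\<Sum>t\<in>T k. card (F t))" using F by (intro sum_mono card_image_le) auto
    finally have "real (card (T (Suc k))) \<le> (\<Sum>t\<in>T k. real (card (F t)))"
      by (metis of_nat_le_iff of_nat_sum)
    also have "\<dots> \<le> (\<Sum>t\<in>T k. 1 + 2 * r / h k)" using F by (intro sum_mono) auto
    also have "\<dots> = real (card (T k)) * (1 + 2 * r / h k)" by simp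
    also have "\<dots> \<le> (\<Prod>i<k. 1 + 2 * r / h i) * (1 + 2 * r / h k)"
      using Suc nn by (intro mult_right_mono) auto
    finally show ?case using finite_subset[OF eq fin] by simp
  qed
  have inj_T: "inj_on (\<lambda>a. map (\<lambda>j. Y j a) [0..<n]) A"
    by (rule inj_onI, rule inj) auto
  have "finite A" using T[of n] inj_T by (auto simp: T_def dest: finite_imageD)
  moreover have "card (T n) = card A" unfolding T_def by (rule card_image[OF inj_T])
  ultimately show ?thesis using T[of n] by simp
qed

section \<open>Primitive non-negative integer matrices and their spectral radius\<close>

lemma pow_mat_pos_step:
  fixes A :: "int mat"
  assumes A: "A \<in> carrier_mat n n" and nonneg: "\<And>i j. i < n \<Longrightarrow> j < n \<Longrightarrow> A $$ (i, j) \<ge> 0"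
    and ij: "i < n" "j < n" "m < n" and pos: "(A ^\<^sub>m k) $$ (i, j) > 0" "A $$ (j, m) > 0"
    and nn: "\<And>i j. i < n \<Longrightarrow> j < n \<Longrightarrow> (A ^\<^sub>m k) $$ (i, j) \<ge> 0"
  shows "(A ^\<^sub>m (Suc k)) $$ (i, m) > 0"
proof -
  have Ak: "A ^\<^sub>m k \<in> carrier_mat n n" using A by simp
  have "(A ^\<^sub>m (Suc k)) $$ (i, m) = (\<Sum>p<n. (A ^\<^sub>m k) $$ (i, p) * A $$ (p, m))"
    using A Ak ij by (simp add: scalar_prod_def atLeast0LessThan)
  moreover have "\<dots> > 0"
    by (rule sum_pos2[of _ j]) (use ij pos nn nonneg in auto)
  ultimately show ?thesis by simp
qed

lemma primitive_mat_of_reachable: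
  fixes A :: "int mat"
  assumes A: "A \<in> carrier_mat n n" and nonneg: "\<And>i j. i < n \<Longrightarrow> j < n \<Longrightarrow> A $$ (i, j) \<ge> 0"
    and diag: "\<And>i. i < n \<Longrightarrow> A $$ (i, i) > 0"
    and reach: "\<And>i j. i < n \<Longrightarrow> j < n \<Longrightarrow> (i, j) \<in> {(i, j). i < n \<and> j < n \<and> A $$ (i, j) > 0}\<^sup>*"
  shows "primitive_mat A"
proof -
  let ?R = "{(i, j). i < n \<and> j < n \<and> A $$ (i, j) > 0}"
  have nn: "(A ^\<^sub>m k) $$ (i, j) \<ge> 0" if "i < n" "j < n" for i j k
    using that
  proof (induction k arbitrary: i j)
    case 0
    then show ?case using A by simp
  next
    case (Suc k)
    have Ak: "A ^\<^sub>m k \<in> carrier_mat n n" using A by simp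
    have "(A ^\<^sub>m (Suc k)) $$ (i, j) = (\<Sum>p<n. (A ^\<^sub>m k) $$ (i, p) * A $$ (p, j))"
      using A Ak Suc by (simp add: scalar_prod_def atLeast0LessThan)
    then show ?case using Suc nonneg by (auto intro!: sum_nonneg)
  qed
  have ex: "\<exists>k. (A ^\<^sub>m k) $$ (i, j) > 0" if "(i, j) \<in> ?R\<^sup>*" "i < n" "j < n" for i j
    using that
  proof (induction rule: rtrancl_induct)
    case base
    show ?case using base A by (intro exI[of _ 0]) simp
  next
    case (step y z)
    then obtain k where "(A ^\<^sub>m k) $$ (i, y) > 0" by auto
    then have "(A ^\<^sub>m (Suc k)) $$ (i, z) > 0"
      using step by (intro pow_mat_pos_step[OF A nonneg _ _ _ _ _ nn]) auto
    then show ?case by blast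
  qed
  have mono: "(A ^\<^sub>m (k + m)) $$ (i, j) > 0" if "(A ^\<^sub>m k) $$ (i, j) > 0" "i < n" "j < n" for i j k m
  proof (induction m)
    case (Suc m)
    then have "(A ^\<^sub>m (Suc (k + m))) $$ (i, j) > 0"
      using that diag by (intro pow_mat_pos_step[OF A nonneg _ _ _ _ _ nn]) auto
    then show ?case by simp
  qed (use that in simp)
  have "\<forall>i j. \<exists>k. i < n \<longrightarrow> j < n \<longrightarrow> (A ^\<^sub>m k) $$ (i, j) > 0" using ex reach by blast
  then obtain f where f: "\<And>i j. i < n \<Longrightarrow> j < n \<Longrightarrow> (A ^\<^sub>m (f i j)) $$ (i, j) > 0" by metis
  \<comment> \<open>A positive diagonal keeps a positive entry positive in all higher powers, so any
    common upper bound of the \<open>f i j\<close> serves all entries at once. The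
    \<open>Suc\<close> makes the exponent at least 1.\<close>
  define k where "k = Suc (\<Sum>i<n. \<Sum>j<n. f i j)"
  have "(A ^\<^sub>m k) $$ (i, j) > 0" if "i < n" "j < n" for i j
  proof -
    have "f i j \<le> (\<Sum>j<n. f i j)" using that by (intro member_le_sum) auto
    also have "\<dots> \<le> (\<Sum>i<n. \<Sum>j<n. f i j)" using that by (intro member_le_sum[of i "{..<n}" "\<lambda>i. \<Sum>j<n. f i j"]) auto
    finally have "k = f i j + (k - f i j)" unfolding k_def by simp
    then show ?thesis using mono[OF f[OF that] that] by metis
  qed
  then show ?thesis unfolding primitive_mat_def using A by (intro exI[of _ k]) (auto simp: k_def)
qed

text \<open>An arbitrary eigenvector \<open>u\<close> is compared with the positive one at the index
  \<open>i\<close> where \<open>cmod (u $ j) / v j\<close> takes its maximum \<open>t\<close>. There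
  the triangle inequality in row \<open>i\<close> gives
  \<open>cmod \<mu> * (t * v i) \<le> l * (t * v i)\<close>.\<close>

lemma spectral_radius_of_positive_eigenvector:
  fixes A :: "int mat" and v :: "nat \<Rightarrow> real"
  assumes A: "A \<in> carrier_mat n n" and n: "n > 0"
    and nonneg: "\<And>i j. i < n \<Longrightarrow> j < n \<Longrightarrow> A $$ (i, j) \<ge> 0"
    and v: "\<And>i. i < n \<Longrightarrow> v i > 0"
    and ev: "\<And>i. i < n \<Longrightarrow> l * v i = (\<Sum>j<n. of_int (A $$ (i, j)) * v j)"
  shows "spectral_radius (map_mat of_int A) = l"
proof -
  let ?A = "map_mat of_int A :: complex mat"
  have cA: "?A \<in> carrier_mat n n" using A by simp
  have l0: "l \<ge> 0"
  proof -
    have "(\<Sum>j<n. real_of_int (A $$ (0, j)) * v j) \<ge> 0"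
      using nonneg[OF n] v by (intro sum_nonneg mult_nonneg_nonneg) (auto intro: less_imp_le)
    then have "l * v 0 \<ge> 0" using ev[OF n] by simp
    then show ?thesis using v[OF n] by (simp add: zero_le_mult_iff)
  qed
  have mem: "complex_of_real l \<in> spectrum ?A"
  proof -
    define w where "w = vec n (\<lambda>i. complex_of_real (v i))"
    have "?A *\<^sub>v w = complex_of_real l \<cdot>\<^sub>v w"
    proof (rule eq_vecI)
      fix i assume "i < dim_vec (complex_of_real l \<cdot>\<^sub>v w)"
      then have i: "i < n" by (simp add: w_def)
      have "(?A *\<^sub>v w) $ i = (\<Sum>j<n. complex_of_real (of_int (A $$ (i, j)) * v j))"
        using i A by (simp add: w_def scalar_prod_def atLeast0LessThan)
      also have "\<dots> = complex_of_real (l * v i)" unfolding ev[OF i] by simp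
      finally show "(?A *\<^sub>v w) $ i = (complex_of_real l \<cdot>\<^sub>v w) $ i" using i by (simp add: w_def)
    qed (use A in \<open>simp add: w_def\<close>)
    moreover have "w \<noteq> 0\<^sub>v n"
    proof
      assume "w = 0\<^sub>v n"
      then have "w $ 0 = 0" using n by simp
      then show False using v[OF n] n by (simp add: w_def)
    qed
    ultimately have "eigenvector ?A w (complex_of_real l)"
      using A by (auto simp: eigenvector_def w_def)
    then show ?thesis unfolding spectrum_def eigenvalue_def by auto
  qed
  have le: "cmod \<mu> \<le> l" if "\<mu> \<in> spectrum ?A" for \<mu>
  proof -
    have "eigenvalue ?A \<mu>" using that by (simp add: spectrum_def)
    then obtain u where u: "eigenvector ?A u \<mu>" unfolding eigenvalue_def by blast
    then have du: "u \<in> carrier_vec n" "u \<noteq> 0\<^sub>v n" "?A *\<^sub>v u = \<mu> \<cdot>\<^sub>v u"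
      using A by (auto simp: eigenvector_def)
    let ?q = "\<lambda>j. cmod (u $ j) / v j"
    define t where "t = Max (?q ` {..<n})"
    have "t \<in> ?q ` {..<n}" unfolding t_def using n by (intro Max_in) auto
    then obtain i where i: "i < n" "t = ?q i" by auto
    have ub: "cmod (u $ j) \<le> t * v j" if "j < n" for j
    proof -
      have "?q j \<le> t" unfolding t_def using that by (intro Max_ge) auto
      then show ?thesis using v[OF that] by (simp add: field_simps)
    qed
    have "\<exists>j<n. u $ j \<noteq> 0" 
    proof (rule ccontr)
      assume "\<not> ?thesis"
      then have "u = 0\<^sub>v n" using du(1) by (intro eq_vecI) auto
      then show False using du by simp
    qed
    then obtain j where j: "j < n" "u $ j \<noteq> 0" by auto
    have "0 < cmod (u $ j)" using j by simp
    then have "0 < t * v j" using ub[OF j(1)] by linarith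
    then have t: "t > 0" using v[OF j(1)] by (simp add: zero_less_mult_iff)
    have "cmod \<mu> * (t * v i) = cmod (\<mu> * u $ i)" using i v[OF i(1)] by (simp add: norm_mult)
    also have "\<mu> * u $ i = (?A *\<^sub>v u) $ i" using du i by simp
    also have "\<dots> = (\<Sum>j<n. of_int (A $$ (i, j)) * u $ j)"
      using i A du(1) by (simp add: scalar_prod_def atLeast0LessThan)
    also have "cmod \<dots> \<le> (\<Sum>j<n. cmod (of_int (A $$ (i, j)) * u $ j))" by (rule norm_sum)
    also have "\<dots> \<le> (\<Sum>j<n. of_int (A $$ (i, j)) * (t * v j))"
      using nonneg i(1) ub by (intro sum_mono) (auto simp: norm_mult intro!: mult_left_mono)
    also have "\<dots> = t * (l * v i)" unfolding ev[OF i(1)] by (simp add: sum_distrib_left mult_ac)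
    finally have "cmod \<mu> * (t * v i) \<le> l * (t * v i)" by (simp add: mult_ac)
    then show ?thesis using t v[OF i(1)] by simp
  qed
  have fin: "finite (spectrum ?A)" using card_finite_spectrum[OF cA] by simp
  show ?thesis unfolding spectral_radius_def
    by (rule Max_eqI) (use fin le mem l0 in \<open>auto intro!: image_eqI[of _ _ "complex_of_real l"]\<close>)
qed

text \<open>A minimal non-empty subset closed under the occurring summands gives an irreducible matrix, and
\<open>c x \<ge> 1\<close> gives it a positive diagonal, so it is primitive.\<close>

lemma PF_degree_le_card:
  fixes S :: "real set"
  assumes fin: "finite S" and ne: "S \<noteq> {}" and pos: "\<And>x. x \<in> S \<Longrightarrow> x > 0"
    and dec: "\<And>x. x \<in> S \<Longrightarrow> \<exists>c :: real \<Rightarrow> nat. c x \<ge> 1 \<and> l * x = (\<Sum>y\<in>S. real (c y) * y)"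
  shows "PF_degree l \<le> card S"
proof -
  obtain c :: "real \<Rightarrow> real \<Rightarrow> nat" where c: "\<And>x. x \<in> S \<Longrightarrow> c x x \<ge> 1"
    "\<And>x. x \<in> S \<Longrightarrow> l * x = (\<Sum>y\<in>S. real (c x y) * y)" using dec by metis
  define closed where "closed T \<longleftrightarrow> T \<subseteq> S \<and> T \<noteq> {} \<and> (\<forall>x\<in>T. \<forall>y\<in>S. c x y > 0 \<longrightarrow> y \<in> T)" for T
  have "closed S" using ne by (auto simp: closed_def)
  then obtain T where T: "closed T" and minT: "\<And>T'. closed T' \<Longrightarrow> card T \<le> card T'"
    using arg_min_natI[of closed S card] arg_min_nat_le[of closed _ card] by metis
  have TS: "T \<subseteq> S" and Tne: "T \<noteq> {}" and Tc: "\<And>x y. x \<in> T \<Longrightarrow> y \<in> S \<Longrightarrow> c x y > 0 \<Longrightarrow> y \<in> T"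
    using T by (auto simp: closed_def)
  have finT: "finite T" using TS fin by (rule finite_subset)
  define n where "n = card T"
  have n: "n > 0" using finT Tne by (simp add: n_def card_gt_0_iff)
  obtain e where e: "bij_betw e {..<n} T" using ex_bij_betw_nat_finite[OF finT] unfolding n_def
    by (metis atLeast0LessThan)
  have eT: "e i \<in> T" if "i < n" for i using e that by (auto simp: bij_betw_def)
  define A where "A = mat n n (\<lambda>(i, j). int (c (e i) (e j)))"
  have A: "A \<in> carrier_mat n n" by (simp add: A_def)
  have Aij: "A $$ (i, j) = int (c (e i) (e j))" if "i < n" "j < n" for i j using that by (simp add: A_def)
  have ev: "l * e i = (\<Sum>j<n. of_int (A $$ (i, j)) * e j)" if i: "i < n" for i
  proof -
    have "l * e i = (\<Sum>y\<in>S. real (c (e i) y) * y)" using c(2) eT[OF i] TS by auto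
    also have "\<dots> = (\<Sum>y\<in>T. real (c (e i) y) * y)"
      using Tc[OF eT[OF i]] TS fin by (intro sum.mono_neutral_right) auto
    also have "\<dots> = (\<Sum>j<n. real (c (e i) (e j)) * e j)"
      by (rule sum.reindex_bij_betw[OF e, symmetric])
    finally show ?thesis using i by (simp add: Aij)
  qed
  have diag: "A $$ (i, i) > 0" if "i < n" for i using c(1)[of "e i"] eT[OF that] TS that by (auto simp: Aij)
  have prim: "primitive_mat A"
  proof (rule primitive_mat_of_reachable[OF A _ diag])
    fix i j assume ij: "i < n" "j < n"
    let ?R = "{(i, j). i < n \<and> j < n \<and> A $$ (i, j) > 0}"
    \<comment> \<open>\<open>U\<close> collects what can be reached from \<open>e i\<close>. It is
      closed, so minimality of \<open>card T\<close> leaves only \<open>U = T\<close>, which is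
      strong connectivity.\<close>
    define U where "U = e ` {m. m < n \<and> (i, m) \<in> ?R\<^sup>*}"
    have "closed U"
      unfolding closed_def
    proof (intro conjI ballI impI)
      show "U \<subseteq> S" using eT TS by (auto simp: U_def)
      show "U \<noteq> {}" using ij by (auto simp: U_def)
      fix x y assume x: "x \<in> U" and y: "y \<in> S" "0 < c x y"
      obtain m where m: "m < n" "(i, m) \<in> ?R\<^sup>*" "x = e m" using x by (auto simp: U_def)
      have "y \<in> T" using Tc[of x y] y m eT by auto
      then obtain p where p: "p < n" "y = e p" using e by (auto simp: bij_betw_def)
      have "(m, p) \<in> ?R" using m p y by (auto simp: Aij)
      then have "(i, p) \<in> ?R\<^sup>*" using m(2) by (rule rtrancl_into_rtrancl[rotated])
      then show "y \<in> U" using p by (auto simp: U_def)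
    qed
    then have "card T \<le> card U" by (rule minT)
    moreover have "U \<subseteq> T" using eT by (auto simp: U_def)
    ultimately have "U = T" using finT by (metis card_seteq)
    then have "e j \<in> U" using eT[OF ij(2)] by simp
    then obtain m where "m < n" "(i, m) \<in> ?R\<^sup>*" "e j = e m" by (auto simp: U_def)
    moreover have "m = j" using e ij calculation by (auto simp: bij_betw_def inj_on_def)
    ultimately show "(i, j) \<in> ?R\<^sup>*" by simp
  qed (simp_all add: Aij)
  have "spectral_radius (map_mat of_int A) = l"
    by (rule spectral_radius_of_positive_eigenvector[OF A n _ _ ev]) (use eT TS pos in \<open>auto simp: Aij\<close>)
  then have "\<exists>A. A \<in> carrier_mat n n \<and> (\<forall>i < n. \<forall>j < n. A $$ (i, j) \<ge> 0) \<and> primitive_mat A \<and>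
      spectral_radius (map_mat of_int A) = l"
    using A prim by (intro exI[of _ A]) (auto simp: Aij)
  then have "PF_degree l \<le> n" unfolding PF_degree_def by (rule Least_le)
  also have "n \<le> card S" unfolding n_def by (rule card_mono[OF fin TS])
  finally show ?thesis .
qed

section \<open>Lattice points in a cone\<close>

lemma sum_eq_sum_multiplicity:
  fixes f :: "nat \<Rightarrow> real"
  assumes "finite S" and "\<And>k. k < m \<Longrightarrow> f k \<in> S"
  shows "(\<Sum>k<m. f k) = (\<Sum>z\<in>S. real (card {k. k < m \<and> f k = z}) * z)"
proof -
  have "(\<Sum>k<m. f k) = (\<Sum>z\<in>S. \<Sum>k\<in>{k. k \<in> {..<m} \<and> f k = z}. f k)"
    by (rule sum.group[symmetric]) (use assms in auto)
  also have "\<dots> = (\<Sum>z\<in>S. real (card {k. k < m \<and> f k = z}) * z)"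
    by (intro sum.cong refl) simp
  finally show ?thesis .
qed

text \<open>\<open>E\<close> and \<open>L\<close> are kept abstract so that the result applies both
  to the ring of integers and to its trace dual. \<open>cover\<close> only speaks about real
  multiples of elements of \<open>L\<close>, since the points that get rounded all lie on lines
  through such elements.\<close>

lemma PF_degree_le_lattice_points:
  fixes E :: "(real \<Rightarrow> complex) set" and L :: "real set" and \<alpha> :: "(real \<Rightarrow> complex) \<Rightarrow> real"
  assumes finE: "finite E" and \<iota>: "\<iota> \<in> E" "\<And>x. x \<in> L \<Longrightarrow> \<iota> x = of_real x"
    and \<alpha>: "\<And>\<sigma>. \<sigma> \<in> E \<Longrightarrow> \<alpha> \<sigma> > 0"
    and L_diff: "\<And>x y. x \<in> L \<Longrightarrow> y \<in> L \<Longrightarrow> x - y \<in> L" and L_mult: "\<And>x. x \<in> L \<Longrightarrow> l * x \<in> L"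
    and x0: "x0 \<in> L" "x0 \<noteq> 0"
    and \<sigma>_diff: "\<And>\<sigma> x y. \<sigma> \<in> E \<Longrightarrow> x \<in> L \<Longrightarrow> y \<in> L \<Longrightarrow> \<sigma> (x - y) = \<sigma> x - \<sigma> y"
    and \<sigma>_mult: "\<And>\<sigma> x. \<sigma> \<in> E \<Longrightarrow> x \<in> L \<Longrightarrow> \<sigma> (l * x) = \<sigma> l * \<sigma> x"
    and contract: "\<And>\<sigma>. \<sigma> \<in> E \<Longrightarrow> \<sigma> \<noteq> \<iota> \<Longrightarrow> cmod (\<sigma> l) \<le> \<rho> * l"
    and cover: "\<And>x s. x \<in> L \<Longrightarrow> \<exists>y\<in>L. (\<Sum>\<sigma>\<in>E. \<alpha> \<sigma> * (cmod (of_real s * \<sigma> x - \<sigma> y))\<^sup>2) \<le> R\<^sup>2"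
    and R: "R > 0" and \<rho>: "0 \<le> \<rho>" "\<rho> < 1" and l: "l > 1 + 4 / (1 - \<rho>)"
    and fin: "finite {x \<in> L. (\<Sum>\<sigma>\<in>E. \<alpha> \<sigma> * (cmod (\<sigma> x))\<^sup>2) \<le> (30 * R / (1 - \<rho>))\<^sup>2}"
  shows "PF_degree l \<le> card {x \<in> L. (\<Sum>\<sigma>\<in>E. \<alpha> \<sigma> * (cmod (\<sigma> x))\<^sup>2) \<le> (30 * R / (1 - \<rho>))\<^sup>2}"
proof -
  \<comment> \<open>\<open>W\<close> is the weighted Euclidean norm of the coordinates other than
    the identity, and \<open>a * x\<close> below is the weighted identity coordinate. The cone is
    \<open>w x \<le> a * x\<close>.\<close>
  define W where "W v = L2_set (\<lambda>\<sigma>. sqrt (\<alpha> \<sigma>) * cmod (v \<sigma>)) (E - {\<iota>})" for v :: "(real \<Rightarrow> complex) \<Rightarrow> complex"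
  define w where "w x = W (\<lambda>\<sigma>. \<sigma> x)" for x
  define a where "a = sqrt (\<alpha> \<iota>)"
  have a: "a > 0" using \<alpha> \<iota> by (simp add: a_def)
  have W0: "W v \<ge> 0" for v by (simp add: W_def)
  have W_sq: "(\<Sum>\<sigma>\<in>E. \<alpha> \<sigma> * (cmod (v \<sigma>))\<^sup>2) = (a * cmod (v \<iota>))\<^sup>2 + (W v)\<^sup>2" for v
  proof -
    have eq: "\<alpha> \<sigma> * (cmod (v \<sigma>))\<^sup>2 = (sqrt (\<alpha> \<sigma>) * cmod (v \<sigma>))\<^sup>2" if "\<sigma> \<in> E" for \<sigma>
      using \<alpha>[OF that] by (simp add: power_mult_distrib)
    have "(\<Sum>\<sigma>\<in>E. \<alpha> \<sigma> * (cmod (v \<sigma>))\<^sup>2) = (\<Sum>\<sigma>\<in>E. (sqrt (\<alpha> \<sigma>) * cmod (v \<sigma>))\<^sup>2)"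
      by (intro sum.cong refl eq)
    also have "\<dots> = (a * cmod (v \<iota>))\<^sup>2 + (\<Sum>\<sigma>\<in>E - {\<iota>}. (sqrt (\<alpha> \<sigma>) * cmod (v \<sigma>))\<^sup>2)"
      unfolding a_def by (rule sum.remove[OF finE \<iota>(1)])
    also have "(\<Sum>\<sigma>\<in>E - {\<iota>}. (sqrt (\<alpha> \<sigma>) * cmod (v \<sigma>))\<^sup>2) = (W v)\<^sup>2"
      unfolding W_def L2_set_def by (simp add: sum_nonneg)
    finally show ?thesis .
  qed
  have W_le: "W u \<le> c1 * W v1 + c2 * W v2"
    if "\<And>\<sigma>. \<sigma> \<in> E - {\<iota>} \<Longrightarrow> cmod (u \<sigma>) \<le> c1 * cmod (v1 \<sigma>) + c2 * cmod (v2 \<sigma>)" "c1 \<ge> 0" "c2 \<ge> 0"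
    for u v1 v2 and c1 c2 :: real
  proof -
    have "W u \<le> L2_set (\<lambda>\<sigma>. c1 * (sqrt (\<alpha> \<sigma>) * cmod (v1 \<sigma>)) + c2 * (sqrt (\<alpha> \<sigma>) * cmod (v2 \<sigma>))) (E - {\<iota>})"
      unfolding W_def
    proof (rule L2_set_mono)
      fix \<sigma> assume s: "\<sigma> \<in> E - {\<iota>}"
      have "sqrt (\<alpha> \<sigma>) * cmod (u \<sigma>) \<le> sqrt (\<alpha> \<sigma>) * (c1 * cmod (v1 \<sigma>) + c2 * cmod (v2 \<sigma>))"
        using that(1)[OF s] \<alpha>[of \<sigma>] s by (intro mult_left_mono) auto
      then show "sqrt (\<alpha> \<sigma>) * cmod (u \<sigma>) \<le> c1 * (sqrt (\<alpha> \<sigma>) * cmod (v1 \<sigma>)) + c2 * (sqrt (\<alpha> \<sigma>) * cmod (v2 \<sigma>))"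
        by (simp add: algebra_simps)
      show "0 \<le> sqrt (\<alpha> \<sigma>) * cmod (u \<sigma>)" using \<alpha>[of \<sigma>] s by simp
    qed
    also have "\<dots> \<le> L2_set (\<lambda>\<sigma>. c1 * (sqrt (\<alpha> \<sigma>) * cmod (v1 \<sigma>))) (E - {\<iota>}) + L2_set (\<lambda>\<sigma>. c2 * (sqrt (\<alpha> \<sigma>) * cmod (v2 \<sigma>))) (E - {\<iota>})"
      by (rule L2_set_triangle_ineq)
    also have "\<dots> = c1 * W v1 + c2 * W v2"
      unfolding W_def using that by (simp add: L2_set_right_distrib)
    finally show ?thesis .
  qed
  have l1: "l > 5"
  proof -
    have "4 / (1 - \<rho>) \<ge> 4" using \<rho> by (simp add: field_simps)
    then show ?thesis using l by simp
  qed
  have l2: "l * (1 - \<rho>) > 4 + (1 - \<rho>)"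
  proof -
    have "(1 + 4 / (1 - \<rho>)) * (1 - \<rho>) < l * (1 - \<rho>)" using l \<rho> by (intro mult_strict_right_mono) auto
    moreover have "(1 + 4 / (1 - \<rho>)) * (1 - \<rho>) = 4 + (1 - \<rho>)" using \<rho> by (simp add: field_simps)
    ultimately show ?thesis by simp
  qed
  have w_mult: "w (l * x) \<le> (\<rho> * l) * w x" if "x \<in> L" for x
  proof -
    have "w (l * x) \<le> (\<rho> * l) * W (\<lambda>\<sigma>. \<sigma> x) + 0 * W (\<lambda>\<sigma>. 0)" unfolding w_def
    proof (rule W_le)
      fix \<sigma> assume s: "\<sigma> \<in> E - {\<iota>}"
      have "cmod (\<sigma> l) * cmod (\<sigma> x) \<le> \<rho> * l * cmod (\<sigma> x)"
        using contract s by (intro mult_right_mono) auto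
      then show "cmod (\<sigma> (l * x)) \<le> \<rho> * l * cmod (\<sigma> x) + 0 * cmod 0"
        using \<sigma>_mult[of \<sigma> x] s that by (simp add: norm_mult)
    qed (use \<rho> l1 in auto)
    then show ?thesis by (simp add: w_def)
  qed
  \<comment> \<open>The factor 10 serves two purposes. It gives \<open>2 * R \<le> H / 5\<close>,
    the slack in height after rounding two endpoints. It also makes the gap between height and width
    of an unrounded piece at least \<open>(1 - \<rho>) / 2 * (6 / 5 * H) = 6 * R\<close>, more than
    the \<open>4 * R\<close> that rounding can consume.\<close>
  define H where "H = 10 * R / (1 - \<rho>)"
  have H: "H * (1 - \<rho>) = 10 * R" using \<rho> by (simp add: H_def)
  have HR: "H \<ge> 10 * R"
  proof -
    have "10 * R * (1 - \<rho>) \<le> 10 * R * 1" using \<rho> R by (intro mult_left_mono) auto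
    then show ?thesis using \<rho> by (simp add: H_def pos_le_divide_eq)
  qed
  have H0: "H > 0" using HR R by linarith
  have app: "\<exists>y\<in>L. \<bar>a * (s * x - y)\<bar> \<le> R \<and> W (\<lambda>\<sigma>. of_real s * \<sigma> x - \<sigma> y) \<le> R" if x: "x \<in> L" for x s
  proof -
    obtain y where y: "y \<in> L" "(\<Sum>\<sigma>\<in>E. \<alpha> \<sigma> * (cmod (of_real s * \<sigma> x - \<sigma> y))\<^sup>2) \<le> R\<^sup>2"
      using cover[OF x] by auto
    let ?v = "\<lambda>\<sigma>. of_real s * \<sigma> x - \<sigma> y"
    have le: "(a * cmod (?v \<iota>))\<^sup>2 + (W ?v)\<^sup>2 \<le> R\<^sup>2" using y(2) W_sq[of ?v] by simp
    have "cmod (?v \<iota>) = \<bar>s * x - y\<bar>"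
      using \<iota>(2)[OF x] \<iota>(2)[OF y(1)] by (metis norm_of_real of_real_diff of_real_mult)
    then have "\<bar>a * (s * x - y)\<bar> = a * cmod (?v \<iota>)" using a by (simp add: abs_mult)
    moreover have "a * cmod (?v \<iota>) \<le> R"
    proof (rule power2_le_imp_le)
      show "(a * cmod (?v \<iota>))\<^sup>2 \<le> R\<^sup>2" using le zero_le_power2[of "W ?v"] by linarith
    qed (use R in simp)
    moreover have "W ?v \<le> R"
    proof (rule power2_le_imp_le)
      show "(W ?v)\<^sup>2 \<le> R\<^sup>2" using le zero_le_power2[of "a * cmod (?v \<iota>)"] by linarith
    qed (use R in simp)
    ultimately show ?thesis by (intro bexI[OF _ y(1)] conjI) simp_all
  qed
  \<comment> \<open>The slab is just thick enough: unrounded pieces have height between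
    \<open>6 / 5 * H\<close> and \<open>9 / 5 * H\<close>, and rounding moves the height by at most
    \<open>2 * R \<le> H / 5\<close>.\<close>
  define S where "S = {x \<in> L. H \<le> a * x \<and> a * x \<le> 2 * H \<and> w x \<le> a * x}"
  let ?B = "{x \<in> L. (\<Sum>\<sigma>\<in>E. \<alpha> \<sigma> * (cmod (\<sigma> x))\<^sup>2) \<le> (30 * R / (1 - \<rho>))\<^sup>2}"
  have SB: "S \<subseteq> ?B"
  proof
    fix x assume x: "x \<in> S"
    have "(\<Sum>\<sigma>\<in>E. \<alpha> \<sigma> * (cmod (\<sigma> x))\<^sup>2) = (a * x)\<^sup>2 + (w x)\<^sup>2"
      using W_sq[of "\<lambda>\<sigma>. \<sigma> x"] \<iota>(2)[of x] x by (simp add: S_def w_def power_mult_distrib)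
    \<comment> \<open>In the cone both the height and the width are at most \<open>2 * H\<close>.
      The norm \<open>sqrt 8 * H\<close> is rounded up to \<open>3 * H\<close>, which explains the
      30 in the statement.\<close>
    also have "\<dots> \<le> (2 * H)\<^sup>2 + (2 * H)\<^sup>2"
      using x H0 W0 by (intro add_mono power_mono) (auto simp: S_def w_def)
    also have "\<dots> \<le> (3 * H)\<^sup>2" by (simp add: power_mult_distrib)
    also have "3 * H = 30 * R / (1 - \<rho>)" by (simp add: H_def)
    finally show "x \<in> ?B" using x by (simp add: S_def)
  qed
  have finS: "finite S" using SB fin by (rule finite_subset)
  have L0: "0 \<in> L" using L_diff[OF x0(1) x0(1)] by simp
  have "S \<noteq> {}"
  proof -
    obtain x1 where x1: "x1 \<in> L" "x1 > 0"
    proof (cases "x0 > 0")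
      case False
      then have "0 - x0 \<in> L" "0 - x0 > 0" using L_diff[OF L0 x0(1)] x0(2) by auto
      then show ?thesis using that by blast
    qed (use that x0 in blast)
    \<comment> \<open>Multiplication by \<open>l\<close> contracts the ratio of width to height by
      the factor \<rho>, so a high power of \<open>l\<close> carries \<open>x1\<close> deep into the
      cone.\<close>
    have pw: "l ^ k * x1 \<in> L \<and> w (l ^ k * x1) \<le> (\<rho> * l) ^ k * w x1" for k
    proof (induction k)
      case (Suc k)
      have "w (l * (l ^ k * x1)) \<le> (\<rho> * l) * w (l ^ k * x1)" using w_mult Suc by blast
      also have "\<dots> \<le> (\<rho> * l) * ((\<rho> * l) ^ k * w x1)" using Suc \<rho> l1 by (intro mult_left_mono) auto
      finally show ?case using Suc L_mult[of "l ^ k * x1"] by (simp add: mult_ac)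
    qed (use x1 in simp)
    have "(\<lambda>k. \<rho> ^ k * w x1) \<longlonglongrightarrow> 0 * w x1"
      using \<rho> by (intro tendsto_mult_right LIMSEQ_power_zero) simp
    then have "\<forall>\<^sub>F k in sequentially. \<rho> ^ k * w x1 < a * x1 / 10"
      using a x1 by (intro order_tendstoD(2)[of _ "0 * w x1"]) auto
    then obtain k where k: "\<rho> ^ k * w x1 < a * x1 / 10" using eventually_happens'[OF sequentially_bot] by blast
    define z where "z = l ^ k * x1"
    have z: "z \<in> L" "z > 0" using pw x1 l1 by (auto simp: z_def)
    \<comment> \<open>Rescaling puts \<open>z\<close> at height \<open>3 / 2 * H\<close>, the middle
      of the slab, where rounding by \<open>R\<close> can leave neither the slab nor the
      cone.\<close>
    define s where "s = 3 / 2 * H / (a * z)"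
    have s: "s > 0" "s * (a * z) = 3 / 2 * H" using H0 a z by (auto simp: s_def)
    have "w z \<le> l ^ k * (\<rho> ^ k * w x1)" using pw[of k] by (simp add: z_def power_mult_distrib mult_ac)
    also have "\<dots> \<le> l ^ k * (a * x1 / 10)" using k l1 by (intro mult_left_mono) auto
    also have "\<dots> = a * z / 10" by (simp add: z_def)
    finally have "s * w z \<le> s * (a * z / 10)" using s by (intro mult_left_mono) auto
    then have wz: "s * w z \<le> 3 / 20 * H" using s by simp
    obtain y where y: "y \<in> L" "\<bar>a * (s * z - y)\<bar> \<le> R" "W (\<lambda>\<sigma>. of_real s * \<sigma> z - \<sigma> y) \<le> R"
      using app[OF z(1), of s] by auto
    have "w y \<le> 1 * W (\<lambda>\<sigma>. of_real s * \<sigma> z - \<sigma> y) + s * W (\<lambda>\<sigma>. \<sigma> z)"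
      unfolding w_def
    proof (rule W_le)
      fix \<sigma>
      have "cmod (\<sigma> y) \<le> cmod (of_real s * \<sigma> z) + cmod (of_real s * \<sigma> z - \<sigma> y)"
        by (metis norm_minus_commute norm_triangle_sub)
      then show "cmod (\<sigma> y) \<le> 1 * cmod (of_real s * \<sigma> z - \<sigma> y) + s * cmod (\<sigma> z)"
        using s by (simp add: norm_mult)
    qed (use s in auto)
    then have wy: "w y \<le> R + 3 / 20 * H" using y(3) wz by (simp add: w_def)
    have "a * (s * z - y) = 3 / 2 * H - a * y" using s(2) by (simp add: algebra_simps)
    then have "\<bar>3 / 2 * H - a * y\<bar> \<le> R" using y(2) by simp
    then have "y \<in> S" using y(1) wy HR H0 by (auto simp: S_def)
    then show ?thesis by auto
  qed
  have "PF_degree l \<le> card S"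
  proof (rule PF_degree_le_card[OF finS \<open>S \<noteq> {}\<close>])
    fix x assume "x \<in> S"
    then have "0 < a * x" using H0 by (auto simp: S_def)
    then show "x > 0" using a by (simp add: zero_less_mult_iff)
  next
    fix x assume x: "x \<in> S"
    define h where "h = a * x"
    have xL: "x \<in> L" and h: "H \<le> h" "h \<le> 2 * H" "w x \<le> h" using x by (auto simp: S_def h_def)
    \<comment> \<open>Splitting \<open>l x - x\<close> rather than \<open>l x\<close> makes \<open>x\<close> itself a summand of \<open>l x\<close>; for \<open>l x - x\<close> to stay
      well inside the cone, \<open>l\<close> has to exceed \<open>1 + 4 / (1 - \<rho>)\<close>.\<close>
    define y where "y = l * x - x"
    have y: "y \<in> L" using L_diff[OF L_mult[OF xL] xL] by (simp add: y_def)
    have ay: "a * y = (l - 1) * h" by (simp add: y_def h_def algebra_simps)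
    have "w y \<le> 1 * W (\<lambda>\<sigma>. \<sigma> (l * x)) + 1 * W (\<lambda>\<sigma>. \<sigma> x)" unfolding w_def
    proof (rule W_le)
      fix \<sigma> assume "\<sigma> \<in> E - {\<iota>}"
      then have "\<sigma> y = \<sigma> (l * x) - \<sigma> x" unfolding y_def using \<sigma>_diff L_mult xL by auto
      then show "cmod (\<sigma> y) \<le> 1 * cmod (\<sigma> (l * x)) + 1 * cmod (\<sigma> x)"
        by (simp add: norm_triangle_ineq4)
    qed auto
    also have "\<dots> \<le> \<rho> * l * w x + w x" using w_mult[OF xL] by (simp add: w_def)
    also have "\<dots> \<le> \<rho> * l * h + h" using h \<rho> l1 by (intro add_mono mult_left_mono) auto
    finally have wy: "w y \<le> (\<rho> * l + 1) * h" by (simp add: algebra_simps)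
    have "4 * H \<le> (l - 1) * H" using l1 H0 by (intro mult_right_mono) auto
    also have "\<dots> \<le> (l - 1) * h" using h l1 by (intro mult_left_mono) auto
    finally have ay4: "4 * H \<le> a * y" by (simp add: ay)
    \<comment> \<open>With pieces of height at most \<open>9 / 5 * H\<close>, rounding up the number
      of pieces lowers the height of each by a factor of at most 3 / 2, because
      \<open>a * y \<ge> 4 * H\<close>. So they keep height at least
      \<open>6 / 5 * H\<close>.\<close>
    define m where "m = nat \<lceil>a * y / (9 / 5 * H)\<rceil>"
    have q0: "a * y / (9 / 5 * H) > 0" using ay4 H0 by simp
    then have m0: "m > 0" by (simp add: m_def)
    have "real m = of_int \<lceil>a * y / (9 / 5 * H)\<rceil>" using q0 by (simp add: m_def)
    then have "a * y / (9 / 5 * H) \<le> real m" "real m < a * y / (9 / 5 * H) + 1"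
      by linarith+
    then have m1: "a * y \<le> real m * (9 / 5 * H)" and m2: "real m * (9 / 5 * H) < a * y + 9 / 5 * H"
      using H0 by (auto simp: field_simps)
    define g where "g = a * y / real m"
    have gm: "g * real m = a * y" using m0 by (simp add: g_def)
    have g1: "g \<le> 9 / 5 * H" using m1 m0 by (simp add: g_def field_simps)
    have g2: "g \<ge> 6 / 5 * H"
    proof -
      have "real m * (9 / 5 * H) \<le> 3 / 2 * (a * y)" using m2 ay4 H0 by linarith
      then show ?thesis using m0 by (simp add: g_def field_simps)
    qed
    define u where "u = w y / real m"
    \<comment> \<open>Relative to its height, \<open>l * x\<close> has a margin of
      \<open>1 - \<rho>\<close> towards the boundary of the cone. Subtracting \<open>x\<close>
      lowers the height by \<open>h\<close> and may add \<open>h\<close> to the width; as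
      \<open>l * (1 - \<rho>) > 4\<close>, half of the relative margin survives.\<close>
    have gu: "g - u \<ge> 4 * R"
    proof -
      have "(l - 1) * (1 - \<rho>) / 2 \<le> (l - 1) - (\<rho> * l + 1)" using l2 \<rho> by (simp add: field_simps)
      then have "(l - 1) * (1 - \<rho>) / 2 * h \<le> ((l - 1) - (\<rho> * l + 1)) * h" using h H0 by (intro mult_right_mono) auto
      also have "\<dots> \<le> a * y - w y" using wy ay by (simp add: algebra_simps)
      finally have "(1 - \<rho>) / 2 * (a * y) \<le> a * y - w y" using ay by (simp add: mult_ac)
      then have "(1 - \<rho>) / 2 * (a * y) / real m \<le> (a * y - w y) / real m" using m0 by (intro divide_right_mono) auto
      then have "(1 - \<rho>) / 2 * g \<le> g - u" by (simp add: g_def u_def diff_divide_distrib)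
      moreover have "(1 - \<rho>) / 2 * (6 / 5 * H) \<le> (1 - \<rho>) / 2 * g" using g2 \<rho> by (intro mult_left_mono) auto
      moreover have "(1 - \<rho>) / 2 * (6 / 5 * H) = 3 / 5 * (H * (1 - \<rho>))" by simp
      ultimately show ?thesis using R H by linarith
    qed
    obtain P where P: "\<And>k. P k \<in> L" "\<And>k. \<bar>a * (real k / real m * y - P k)\<bar> \<le> R"
       "\<And>k. W (\<lambda>\<sigma>. of_real (real k / real m) * \<sigma> y - \<sigma> (P k)) \<le> R"
       "P 0 = 0" "P m = y"
    proof -
      have "\<forall>k. \<exists>p. p \<in> L \<and> \<bar>a * (real k / real m * y - p)\<bar> \<le> R \<and>
        W (\<lambda>\<sigma>. of_real (real k / real m) * \<sigma> y - \<sigma> p) \<le> R"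
        using app[OF y] by blast
      from choice[OF this] obtain P where P: "\<And>k. P k \<in> L \<and> \<bar>a * (real k / real m * y - P k)\<bar> \<le> R \<and>
        W (\<lambda>\<sigma>. of_real (real k / real m) * \<sigma> y - \<sigma> (P k)) \<le> R" by auto
      have Wz: "W v \<le> R" if "\<And>\<sigma>. \<sigma> \<in> E \<Longrightarrow> v \<sigma> = 0" for v
      proof -
        have "W v \<le> 0 * W v + 0 * W v" by (rule W_le) (use that in auto)
        then show ?thesis using R by simp
      qed
      have \<sigma>0: "\<sigma> 0 = 0" if "\<sigma> \<in> E" for \<sigma> using \<sigma>_diff[OF that L0 L0] by simp
      \<comment> \<open>Both endpoints are lattice points already. Keeping them unrounded makes the
        differences telescope to exactly \<open>y\<close>.\<close>
      define P' where "P' k = (if k = 0 then 0 else if k = m then y else P k)" for k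
      show ?thesis
      proof (rule that[of P'])
        fix k
        consider "k = 0" | "k = m" "k \<noteq> 0" | "k \<noteq> 0" "k \<noteq> m" by auto
        then have "P' k \<in> L \<and> \<bar>a * (real k / real m * y - P' k)\<bar> \<le> R \<and>
          W (\<lambda>\<sigma>. of_real (real k / real m) * \<sigma> y - \<sigma> (P' k)) \<le> R"
        proof cases
          case 1
          then show ?thesis using L0 R \<sigma>0 by (auto simp: P'_def intro!: Wz)
        next
          case 2
          then show ?thesis using y m0 R by (auto simp: P'_def intro!: Wz)
        next
          case 3
          then show ?thesis using P[of k] by (auto simp: P'_def)
        qed
        then show "P' k \<in> L" "\<bar>a * (real k / real m * y - P' k)\<bar> \<le> R"
          "W (\<lambda>\<sigma>. of_real (real k / real m) * \<sigma> y - \<sigma> (P' k)) \<le> R" by blast+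
      qed (use m0 in \<open>auto simp: P'_def\<close>)
    qed
    define \<delta> where "\<delta> k = P (Suc k) - P k" for k
    have \<delta>S: "\<delta> k \<in> S" for k
    proof -
      let ?t = "\<lambda>k. real k / real m"
      let ?e = "\<lambda>k \<sigma>. of_real (?t k) * \<sigma> y - \<sigma> (P k)"
      have \<delta>L: "\<delta> k \<in> L" using L_diff P by (simp add: \<delta>_def)
      have t: "?t (Suc k) - ?t k = 1 / real m" using m0 by (simp add: field_simps)
      have "a * (?t (Suc k) * y - P (Suc k)) - a * (?t k * y - P k) = a * ((?t (Suc k) - ?t k) * y - \<delta> k)"
        by (simp add: \<delta>_def algebra_simps)
      also have "\<dots> = g - a * \<delta> k" unfolding t by (simp add: g_def algebra_simps)
      finally have e: "a * (?t (Suc k) * y - P (Suc k)) - a * (?t k * y - P k) = g - a * \<delta> k" .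
      have "\<bar>p - q\<bar> \<le> 2 * R" if "\<bar>p\<bar> \<le> R" "\<bar>q\<bar> \<le> R" for p q using that by linarith
      from this[OF P(2)[of "Suc k"] P(2)[of k]] have "\<bar>g - a * \<delta> k\<bar> \<le> 2 * R" unfolding e .
      then have b1: "g - 2 * R \<le> a * \<delta> k" "a * \<delta> k \<le> g + 2 * R" by linarith+
      have "W (\<lambda>\<sigma>. \<sigma> (\<delta> k)) \<le> 1 * W (\<lambda>\<sigma>. ?e k \<sigma> - ?e (Suc k) \<sigma>) + (1 / real m) * W (\<lambda>\<sigma>. \<sigma> y)"
      proof (rule W_le)
        fix \<sigma> assume s: "\<sigma> \<in> E - {\<iota>}"
        have "\<sigma> (\<delta> k) = \<sigma> (P (Suc k)) - \<sigma> (P k)" unfolding \<delta>_def using \<sigma>_diff P s by auto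
        also have "\<dots> = (?e k \<sigma> - ?e (Suc k) \<sigma>) + of_real (?t (Suc k) - ?t k) * \<sigma> y"
          by (simp add: algebra_simps del: of_nat_Suc)
        finally have "cmod (\<sigma> (\<delta> k)) \<le> cmod (?e k \<sigma> - ?e (Suc k) \<sigma>) + cmod (of_real (?t (Suc k) - ?t k) * \<sigma> y)"
          using norm_triangle_ineq by metis
        then show "cmod (\<sigma> (\<delta> k)) \<le> 1 * cmod (?e k \<sigma> - ?e (Suc k) \<sigma>) + (1 / real m) * cmod (\<sigma> y)"
          unfolding t by (simp add: norm_mult norm_divide)
      qed auto
      also have "W (\<lambda>\<sigma>. ?e k \<sigma> - ?e (Suc k) \<sigma>) \<le> 1 * W (?e k) + 1 * W (?e (Suc k))"
        by (rule W_le) (auto simp: norm_triangle_ineq4 simp del: of_nat_Suc)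
      finally have "w (\<delta> k) \<le> 2 * R + u" using P(3)[of k] P(3)[of "Suc k"]
        by (simp add: w_def u_def del: of_nat_Suc)
      then show ?thesis using b1 g1 g2 gu HR H0 \<delta>L R by (auto simp: S_def)
    qed
    have sum\<delta>: "(\<Sum>k<m. \<delta> k) = y"
      unfolding \<delta>_def using P(4,5) by (subst sum_lessThan_telescope) simp
    define c where "c z = card {k. k < m \<and> \<delta> k = z} + (if z = x then 1 else 0)" for z
    have "(\<Sum>z\<in>S. real (c z) * z) = (\<Sum>z\<in>S. real (card {k. k < m \<and> \<delta> k = z}) * z) + (\<Sum>z\<in>S. if z = x then z else 0)"
      unfolding sum.distrib[symmetric] by (intro sum.cong refl) (auto simp: c_def algebra_simps)
    also have "(\<Sum>z\<in>S. if z = x then z else 0) = x" using x finS by simp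
    also have "(\<Sum>z\<in>S. real (card {k. k < m \<and> \<delta> k = z}) * z) = y"
      using sum_eq_sum_multiplicity[OF finS, of m \<delta>] \<delta>S sum\<delta> by simp
    finally have "l * x = (\<Sum>z\<in>S. real (c z) * z)" by (simp add: y_def)
    moreover have "c x \<ge> 1" by (simp add: c_def)
    ultimately show "\<exists>c :: real \<Rightarrow> nat. c x \<ge> 1 \<and> l * x = (\<Sum>y\<in>S. real (c y) * y)" by blast
  qed
  also have "card S \<le> card ?B" by (rule card_mono[OF fin SB])
  finally show ?thesis .
qed

section \<open>Korkin-Zolotarev reduction\<close>

definition psd_form :: "real set \<Rightarrow> (real \<Rightarrow> real \<Rightarrow> real) \<Rightarrow> bool" where
  "psd_form M B \<longleftrightarrow> (\<forall>x\<in>M. \<forall>y\<in>M. B x y = B y x) \<and>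
     (\<forall>x\<in>M. \<forall>y\<in>M. \<forall>z\<in>M. B (x + y) z = B x z + B y z) \<and> (\<forall>x\<in>M. B x x \<ge> 0)"

definition additive_subgroup :: "real set \<Rightarrow> bool" where
  "additive_subgroup M \<longleftrightarrow> 0 \<in> M \<and> (\<forall>x\<in>M. \<forall>y\<in>M. x + y \<in> M) \<and> (\<forall>x\<in>M. - x \<in> M)"

lemma additive_subgroupD:
  assumes "additive_subgroup M"
  shows "0 \<in> M" "x \<in> M \<Longrightarrow> y \<in> M \<Longrightarrow> x + y \<in> M" "x \<in> M \<Longrightarrow> - x \<in> M"
    "x \<in> M \<Longrightarrow> y \<in> M \<Longrightarrow> x - y \<in> M"
  using assms unfolding additive_subgroup_def by (auto simp: diff_conv_add_uminus simp del: add_uminus_conv_diff)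

lemma additive_subgroup_of_int_mult:
  assumes M: "additive_subgroup M" and x: "x \<in> M"
  shows "of_int k * x \<in> M"
proof (induction k rule: int_induct[of _ 0])
  case base
  then show ?case using M by (simp add: additive_subgroupD)
next
  case (step1 i)
  then show ?case using additive_subgroupD(2)[OF M step1(2) x] by (simp add: algebra_simps)
next
  case (step2 i)
  then show ?case using additive_subgroupD(4)[OF M step2(2) x] by (simp add: algebra_simps)
qed

lemma additive_subgroup_sum:
  assumes M: "additive_subgroup M" and "\<And>i. i \<in> I \<Longrightarrow> f i \<in> M"
  shows "sum f I \<in> M"
  using assms(2) by (induction I rule: infinite_finite_induct) (auto simp: additive_subgroupD[OF M])

lemma additive_on_of_int:
  fixes l :: "real \<Rightarrow> real"
  assumes M: "additive_subgroup M" and x: "x \<in> M"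
    and add: "\<And>x y. x \<in> M \<Longrightarrow> y \<in> M \<Longrightarrow> l (x + y) = l x + l y"
  shows "l (of_int k * x) = of_int k * l x"
proof -
  have l0: "l 0 = 0" using add[of 0 0] additive_subgroupD(1)[OF M] by simp
  note mem = additive_subgroup_of_int_mult[OF M x]
  show ?thesis
  proof (induction k rule: int_induct[of _ 0])
    case base
    then show ?case using l0 by simp
  next
    case (step1 i)
    then show ?case using add[OF mem[of i] x] by (simp add: algebra_simps)
  next
    case (step2 i)
    then show ?case using add[OF mem[of "i - 1"] x] by (simp add: algebra_simps)
  qed
qed

lemma additive_on_sum:
  fixes l :: "real \<Rightarrow> real"
  assumes M: "additive_subgroup M" and f: "\<And>i. i \<in> I \<Longrightarrow> f i \<in> M"
    and add: "\<And>x y. x \<in> M \<Longrightarrow> y \<in> M \<Longrightarrow> l (x + y) = l x + l y"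
  shows "l (sum f I) = (\<Sum>i\<in>I. l (f i))"
proof -
  have l0: "l 0 = 0" using add[of 0 0] additive_subgroupD(1)[OF M] by simp
  show ?thesis using f
  proof (induction I rule: infinite_finite_induct)
    case (insert i I)
    then show ?case using add[of "f i" "sum f I"] additive_subgroup_sum[OF M, of I f] by simp
  qed (simp_all add: l0)
qed

context
  fixes M :: "real set" and B :: "real \<Rightarrow> real \<Rightarrow> real"
  assumes M: "additive_subgroup M" and B: "psd_form M B"
begin

lemma form_add: "x \<in> M \<Longrightarrow> y \<in> M \<Longrightarrow> z \<in> M \<Longrightarrow> B (x + y) z = B x z + B y z"
  and form_sym: "x \<in> M \<Longrightarrow> y \<in> M \<Longrightarrow> B x y = B y x"
  and form_nonneg: "x \<in> M \<Longrightarrow> B x x \<ge> 0"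
  using B by (auto simp: psd_form_def)

lemma form_of_int: "x \<in> M \<Longrightarrow> z \<in> M \<Longrightarrow> B (of_int k * x) z = of_int k * B x z"
  using additive_on_of_int[OF M, of x "\<lambda>x. B x z"] form_add by simp

lemma form_diff:
  assumes "x \<in> M" "y \<in> M" "z \<in> M"
  shows "B (x - y) z = B x z - B y z"
proof -
  have "B (x - y + y) z = B (x - y) z + B y z" using assms additive_subgroupD(4)[OF M] by (intro form_add) auto
  then show ?thesis by simp
qed

lemma form_comb:
  assumes "x \<in> M" "y \<in> M"
  shows "B (of_int p * x - of_int q * y) (of_int p * x - of_int q * y)
    = of_int p ^ 2 * B x x - 2 * of_int p * of_int q * B x y + of_int q ^ 2 * B y y"
proof -
  note mem = additive_subgroup_of_int_mult[OF M]
  let ?z = "of_int p * x - of_int q * y"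
  have z: "?z \<in> M" using mem assms additive_subgroupD(4)[OF M] by blast
  have e: "B ?z u = of_int p * B x u - of_int q * B y u" if "u \<in> M" for u
    using that assms mem by (simp add: form_diff form_of_int)
  have bx: "B x ?z = of_int p * B x x - of_int q * B x y" using e[OF assms(1)] form_sym[OF assms(1) z] form_sym[OF assms] by simp
  have bz: "B y ?z = of_int p * B x y - of_int q * B y y" using e[OF assms(2)] form_sym[OF assms(2) z] by simp
  show ?thesis unfolding e[OF z] bx bz by (simp add: algebra_simps power2_eq_square)
qed

text \<open>The usual proof inserts \<open>x - t * y\<close> with real \<open>t\<close>, which
  \<open>M\<close> need not contain. Instead \<open>t\<close> is approximated by
  \<open>q / p\<close>: non-negativity at \<open>p * x - q * y\<close> with \<open>q\<close> the
  rounding of \<open>p * t\<close> gives \<open>0 \<le> p^2 * \<Delta> + B y y / 4\<close>, and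
  large \<open>p\<close> rules out a negative \<Delta>.\<close>

lemma form_Cauchy_Schwarz:
  assumes x: "x \<in> M" and y: "y \<in> M"
  shows "(B x y)\<^sup>2 \<le> B x x * B y y"
proof (cases "B y y = 0")
  case True
  have "B x y = 0"
  proof (rule ccontr)
    assume ne: "B x y \<noteq> 0"
    obtain n :: nat where n: "B x x < real n" using reals_Archimedean2 by blast
    \<comment> \<open>For a null vector \<open>y\<close> the value at \<open>x - q * y\<close> is
      affine in \<open>q\<close>; this \<open>q\<close> has the sign of \<open>B x y\<close> and is
      large enough to make the value negative.\<close>
    define q where "q = \<lceil>real n / \<bar>B x y\<bar>\<rceil> * sgn_class.sgn (if B x y > 0 then 1 else - 1 :: int)"
    have "real n \<le> of_int \<lceil>real n / \<bar>B x y\<bar>\<rceil> * \<bar>B x y\<bar>"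
      using ne by (simp add: pos_divide_le_eq[symmetric])
    then have "real n \<le> of_int q * B x y" by (auto simp: q_def split: if_splits)
    moreover have "0 \<le> B x x - 2 * of_int q * B x y"
      using form_comb[OF x y, of 1 q] form_nonneg[of "of_int 1 * x - of_int q * y"]
        additive_subgroup_of_int_mult[OF M] additive_subgroupD(4)[OF M] x y True by simp
    ultimately show False using n by (simp add: mult.assoc)
  qed
  then show ?thesis using True by simp
next
  case False
  then have by0: "B y y > 0" using form_nonneg[OF y] by simp
  define t where "t = B x y / B y y"
  define \<Delta> where "\<Delta> = B x x - t\<^sup>2 * B y y"
  have ineq: "0 \<le> of_int p ^ 2 * \<Delta> + B y y / 4" for p :: int
  proof -
    define q where "q = round (of_int p * t)"
    have r: "\<bar>of_int p * t - of_int q\<bar> \<le> 1 / 2" unfolding q_def by (metis of_int_round_abs_le abs_minus_commute)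
    have "0 \<le> B (of_int p * x - of_int q * y) (of_int p * x - of_int q * y)"
      using additive_subgroup_of_int_mult[OF M] additive_subgroupD(4)[OF M] x y by (intro form_nonneg) auto
    also have "\<dots> = of_int p ^ 2 * \<Delta> + (of_int p * t - of_int q)\<^sup>2 * B y y"
      unfolding form_comb[OF x y] \<Delta>_def t_def using by0 by (simp add: field_simps power2_eq_square)
    also have "(of_int p * t - of_int q)\<^sup>2 \<le> (1 / 2)\<^sup>2" using r by (metis abs_ge_zero power2_abs power_mono)
    finally show ?thesis using by0 by (simp add: power2_eq_square mult_right_mono)
  qed
  have "\<Delta> \<ge> 0"
  proof (rule ccontr)
    assume neg: "\<not> ?thesis"
    obtain n :: nat where n: "B y y / 4 / (- \<Delta>) < real n" using reals_Archimedean2 by blast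
    have "0 < - \<Delta>" using neg by simp
    from iffD1[OF pos_divide_less_eq[OF this] n] have n1: "B y y / 4 < real n * (- \<Delta>)" .
    have "0 < B y y / 4 / (- \<Delta>)" using by0 neg by (intro divide_pos_pos) auto
    then have "n > 0" using n by (cases n) auto
    then have "real n \<le> real n ^ 2" by (simp add: power2_eq_square)
    then have "real n * (- \<Delta>) \<le> real n ^ 2 * (- \<Delta>)" using neg by (intro mult_right_mono) auto
    then show False using ineq[of "int n"] n1 by simp
  qed
  then show ?thesis unfolding \<Delta>_def t_def using by0 by (simp add: field_simps power2_eq_square)
qed

end

text \<open>Discreteness up to null vectors. Projected forms vanish on the basis vectors already
  chosen, so the elements of bounded value can be finite in number only modulo the null
  vectors.\<close>

definition finite_mod :: "real set \<Rightarrow> (real \<Rightarrow> real \<Rightarrow> real) \<Rightarrow> bool" where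
  "finite_mod M C \<longleftrightarrow> (\<forall>c. \<exists>F. finite F \<and> F \<subseteq> M \<and> (\<forall>x\<in>M. C x x \<le> c \<longrightarrow> (\<exists>y\<in>F. C (x - y) (x - y) = 0)))"

text \<open>The subgroup \<open>M\<close> stays the same during the reduction. Instead of passing to the quotient by \<open>b\<close>, one
replaces the form by its projection, which has \<open>b\<close> as a null vector.\<close>

definition project_form :: "(real \<Rightarrow> real \<Rightarrow> real) \<Rightarrow> real \<Rightarrow> real \<Rightarrow> real \<Rightarrow> real" where
  "project_form C b x y = C x y - C x b * C y b / C b b"

text \<open>By Cauchy-Schwarz the value of \<open>C\<close> does not change under null vectors, so
  it suffices to minimise over finitely many representatives of the elements no longer than
  \<open>x0\<close>.\<close>

lemma finite_mod_has_minimum: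
  assumes M: "additive_subgroup M" and C: "psd_form M C" and fm: "finite_mod M C"
    and ex: "x0 \<in> M" "C x0 x0 > 0"
  obtains b where "b \<in> M" "C b b > 0" "\<And>x. x \<in> M \<Longrightarrow> C x x > 0 \<Longrightarrow> C b b \<le> C x x"
proof -
  note CS = form_Cauchy_Schwarz[OF M C] and mem = additive_subgroupD[OF M]
  obtain F where F: "finite F" "F \<subseteq> M" "\<And>x. x \<in> M \<Longrightarrow> C x x \<le> C x0 x0 \<Longrightarrow> \<exists>y\<in>F. C (x - y) (x - y) = 0"
    using fm unfolding finite_mod_def by meson
  have same: "C x x = C y y" if "x \<in> M" "y \<in> M" "C (x - y) (x - y) = 0" for x y
  proof -
    have d: "x - y \<in> M" using mem that by blast
    have "C (x - y) x = 0" "C (x - y) y = 0" using CS[OF d that(1)] CS[OF d that(2)] that(3) by auto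
    then show ?thesis using that form_diff[OF M C] form_sym[OF M C] by (metis eq_iff_diff_eq_0)
  qed
  let ?G = "{y \<in> F. C y y > 0}"
  have "?G \<noteq> {}" using F(3)[OF ex(1)] same[OF ex(1)] ex F(2) by fastforce
  then have "Min ((\<lambda>y. C y y) ` ?G) \<in> (\<lambda>y. C y y) ` ?G" using F(1) by (intro Min_in) auto
  then obtain b where b: "b \<in> ?G" "Min ((\<lambda>y. C y y) ` ?G) = C b b" by blast
  have b_le: "C b b \<le> C y y" if "y \<in> ?G" for y
    unfolding b(2)[symmetric] using F(1) that by (intro Min_le) auto
  show ?thesis
  proof (rule that[of b])
    fix x assume x: "x \<in> M" "C x x > 0"
    show "C b b \<le> C x x"
    proof (cases "C x x \<le> C x0 x0")
      case True
      then obtain y where "y \<in> F" "C (x - y) (x - y) = 0" using F(3) x by blast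
      then show ?thesis using same[of x y] b_le[of y] x F(2) by auto
    next
      case False
      obtain y where "y \<in> F" "C (x0 - y) (x0 - y) = 0" using F(3)[OF ex(1)] by blast
      then show ?thesis using same[of x0 y] b_le[of y] ex F(2) False by auto
    qed
  qed (use b F(2) in auto)
qed

context
  fixes M :: "real set" and C :: "real \<Rightarrow> real \<Rightarrow> real" and b :: real
  assumes M: "additive_subgroup M" and C: "psd_form M C" and b: "b \<in> M" "C b b > 0"
begin

lemma project_form_psd: "psd_form M (project_form C b)"
  unfolding psd_form_def
proof (intro conjI ballI)
  fix x y assume "x \<in> M" "y \<in> M"
  then show "project_form C b x y = project_form C b y x"
    using form_sym[OF M C] by (simp add: project_form_def)
next
  fix x y z assume "x \<in> M" "y \<in> M" "z \<in> M"
  then show "project_form C b (x + y) z = project_form C b x z + project_form C b y z"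
    using form_add[OF M C] b by (simp add: project_form_def algebra_simps add_divide_distrib)
next
  fix x assume "x \<in> M"
  then show "project_form C b x x \<ge> 0"
    using form_Cauchy_Schwarz[OF M C, of x b] b by (simp add: project_form_def power2_eq_square pos_divide_le_eq)
qed

text \<open>Pythagoras: the component orthogonal to \<open>b\<close> is untouched by a shift along
  \<open>b\<close>, and rounding the coefficient reduces the other component to at most
  \<open>C b b / 4\<close>.\<close>

lemma project_form_shift:
  assumes x: "x \<in> M"
  shows "C (x - of_int k * b) (x - of_int k * b) = project_form C b x x + (C x b / C b b - of_int k)\<^sup>2 * C b b"
proof -
  have e: "C (x - of_int k * b) (x - of_int k * b) = C x x - 2 * of_int k * C x b + of_int k ^ 2 * C b b"
    using form_comb[OF M C x b(1), of 1 k] unfolding of_int_1 mult_1_left mult_1_right power_one .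
  show ?thesis unfolding e project_form_def using b by (simp add: field_simps power2_eq_square)
qed

lemma project_form_round:
  assumes x: "x \<in> M"
  obtains k :: int where "x - of_int k * b \<in> M" "C (x - of_int k * b) (x - of_int k * b) \<le> project_form C b x x + C b b / 4"
proof (rule that)
  let ?k = "round (C x b / C b b)"
  show "x - of_int ?k * b \<in> M"
    using additive_subgroupD(4)[OF M x additive_subgroup_of_int_mult[OF M b(1)]] .
  have "\<bar>C x b / C b b - of_int ?k\<bar> \<le> 1 / 2" by (metis of_int_round_abs_le abs_minus_commute)
  then have "(C x b / C b b - of_int ?k)\<^sup>2 \<le> (1 / 2)\<^sup>2" by (metis abs_ge_zero power2_abs power_mono)
  then have "(C x b / C b b - of_int ?k)\<^sup>2 * C b b \<le> (1 / 2)\<^sup>2 * C b b" using b by (intro mult_right_mono) auto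
  then show "C (x - of_int ?k * b) (x - of_int ?k * b) \<le> project_form C b x x + C b b / 4"
    unfolding project_form_shift[OF x] by (simp add: power2_eq_square)
qed

text \<open>If the projection vanishes, rounding leaves a vector of value at most
  \<open>C b b / 4\<close>, below the positive minimum, hence a null vector. So minimality of
  \<open>b\<close> is what ensures that the new null vectors are the old ones plus integer multiples
  of \<open>b\<close>.\<close>

lemma project_form_kernel:
  assumes min: "\<And>x. x \<in> M \<Longrightarrow> C x x > 0 \<Longrightarrow> C b b \<le> C x x" and x: "x \<in> M"
  shows "project_form C b x x = 0 \<longleftrightarrow> (\<exists>k::int. C (x - of_int k * b) (x - of_int k * b) = 0)"
proof
  assume 0: "project_form C b x x = 0"
  obtain k :: int where k: "x - of_int k * b \<in> M" "C (x - of_int k * b) (x - of_int k * b) \<le> C b b / 4"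
    using project_form_round[OF x] 0 by auto
  then have "\<not> C (x - of_int k * b) (x - of_int k * b) > 0" using min[OF k(1)] b by auto
  then show "\<exists>k::int. C (x - of_int k * b) (x - of_int k * b) = 0" using form_nonneg[OF M C k(1)] by force
next
  assume "\<exists>k::int. C (x - of_int k * b) (x - of_int k * b) = 0"
  then obtain k :: int where "project_form C b x x + (C x b / C b b - of_int k)\<^sup>2 * C b b = 0"
    using project_form_shift[OF x] by auto
  moreover have "project_form C b x x \<ge> 0" using form_nonneg[OF M project_form_psd x] .
  ultimately show "project_form C b x x = 0" using b by (simp add: add_nonneg_eq_0_iff)
qed

text \<open>A rounded representative still has value at least \<open>C b b\<close> by minimality, of
  which at most a quarter lies along \<open>b\<close>. This is the source of the powers of 3 / 4 in
  the bounds for the Gram-Schmidt lengths.\<close>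

lemma project_form_lower:
  assumes min: "\<And>x. x \<in> M \<Longrightarrow> C x x > 0 \<Longrightarrow> C b b \<le> C x x" and x: "x \<in> M" "project_form C b x x > 0"
  shows "project_form C b x x \<ge> 3 / 4 * C b b"
proof -
  obtain k :: int where k: "x - of_int k * b \<in> M" "C (x - of_int k * b) (x - of_int k * b) \<le> project_form C b x x + C b b / 4"
    using project_form_round[OF x(1)] by auto
  have "C (x - of_int k * b) (x - of_int k * b) \<ge> project_form C b x x"
    unfolding project_form_shift[OF x(1)] using b by simp
  then have "C b b \<le> C (x - of_int k * b) (x - of_int k * b)" using min[OF k(1)] x by simp
  then show ?thesis using k by simp
qed

text \<open>Every class with bounded projection has a rounded representative with bounded
  \<open>C\<close>-value, so the finite set for the bound \<open>c + C b b / 4\<close> can be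
  reused.\<close>

lemma project_form_finite_mod:
  assumes fm: "finite_mod M C"
  shows "finite_mod M (project_form C b)"
  unfolding finite_mod_def
proof
  fix c
  obtain F where F: "finite F" "F \<subseteq> M" "\<And>x. x \<in> M \<Longrightarrow> C x x \<le> c + C b b / 4 \<Longrightarrow> \<exists>y\<in>F. C (x - y) (x - y) = 0"
    using fm unfolding finite_mod_def by meson
  have "\<exists>y\<in>F. project_form C b (x - y) (x - y) = 0" if x: "x \<in> M" "project_form C b x x \<le> c" for x
  proof -
    obtain k :: int where k: "x - of_int k * b \<in> M" "C (x - of_int k * b) (x - of_int k * b) \<le> project_form C b x x + C b b / 4"
      using project_form_round[OF x(1)] by auto
    then obtain y where y: "y \<in> F" "C (x - of_int k * b - y) (x - of_int k * b - y) = 0"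
      using F(3)[OF k(1)] x by fastforce
    have "x - y \<in> M" using F(2) y x additive_subgroupD(4)[OF M] by blast
    then have "0 \<le> project_form C b (x - y) (x - y)" "project_form C b (x - y) (x - y) + (C (x - y) b / C b b - of_int k)\<^sup>2 * C b b = 0"
      using form_nonneg[OF M project_form_psd] project_form_shift[of "x - y" k] y(2) by (auto simp: algebra_simps)
    then have "project_form C b (x - y) (x - y) = 0" using b by (simp add: add_nonneg_eq_0_iff)
    then show ?thesis using y by blast
  qed
  then show "\<exists>F. finite F \<and> F \<subseteq> M \<and> (\<forall>x\<in>M. project_form C b x x \<le> c \<longrightarrow> (\<exists>y\<in>F. project_form C b (x - y) (x - y) = 0))"
    using F by blast
qed

end

text \<open>The left-hand side is the value of the form at \<open>s x - y\<close>. It is written out since \<open>M\<close> need not contain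
\<open>s x\<close> for real \<open>s\<close>.\<close>

definition covers :: "real set \<Rightarrow> (real \<Rightarrow> real \<Rightarrow> real) \<Rightarrow> real \<Rightarrow> bool" where
  "covers M B R \<longleftrightarrow> (\<forall>x\<in>M. \<forall>s. \<exists>y\<in>M. s\<^sup>2 * B x x - 2 * s * B x y + B y y \<le> R\<^sup>2)"

text \<open>The \<open>g i\<close> are the Gram-Schmidt lengths and the \<open>l i\<close> the Gram-Schmidt coordinates with
respect to \<open>b\<close>. The remainder form is the form projected along \<open>b 0, \<dots>, b (k - 1)\<close>.\<close>

definition reduced_flag :: "real set \<Rightarrow> (real \<Rightarrow> real \<Rightarrow> real) \<Rightarrow> real \<Rightarrow> nat \<Rightarrow>
    (nat \<Rightarrow> real) \<Rightarrow> (nat \<Rightarrow> real) \<Rightarrow> (nat \<Rightarrow> real \<Rightarrow> real) \<Rightarrow> bool" where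
  "reduced_flag M B m k b g l \<longleftrightarrow>
     (\<forall>i<k. b i \<in> M \<and> g i > 0 \<and> (\<forall>x\<in>M. \<forall>y\<in>M. l i (x + y) = l i x + l i y) \<and> l i (b i) = 1 \<and>
        (\<forall>j<i. l i (b j) = 0) \<and> (g i)\<^sup>2 \<ge> (3 / 4) ^ i * m \<and> (\<forall>R>0. covers M B R \<longrightarrow> g i \<le> 3 * R))"

definition remainder_form :: "real set \<Rightarrow> (real \<Rightarrow> real \<Rightarrow> real) \<Rightarrow> real \<Rightarrow> nat \<Rightarrow>
    (nat \<Rightarrow> real) \<Rightarrow> (nat \<Rightarrow> real) \<Rightarrow> (nat \<Rightarrow> real \<Rightarrow> real) \<Rightarrow> (real \<Rightarrow> real \<Rightarrow> real) \<Rightarrow> bool" where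
  "remainder_form M B m k b g l C \<longleftrightarrow> psd_form M C \<and> finite_mod M C \<and>
     (\<forall>x\<in>M. C x x > 0 \<longrightarrow> C x x \<ge> (3 / 4) ^ k * m) \<and>
     (\<forall>x\<in>M. C x x = 0 \<longleftrightarrow> (\<exists>c :: nat \<Rightarrow> int. x = (\<Sum>i<k. of_int (c i) * b i))) \<and>
     (\<forall>x\<in>M. \<forall>y\<in>M. B x y = (\<Sum>i<k. (g i)\<^sup>2 * l i x * l i y) + C x y)"

text \<open>The new vector is a shortest non-null one for the remainder form. Its square length
  becomes the next Gram-Schmidt square, and its inner products, divided by that square, become the
  next coordinate function.\<close>

lemma flag_step:
  assumes M: "additive_subgroup M" and fl: "reduced_flag M B m k b g l"
    and rem: "remainder_form M B m k b g l C" and ex: "x0 \<in> M" "C x0 x0 > 0"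
  shows "\<exists>b g l C. reduced_flag M B m (Suc k) b g l \<and> remainder_form M B m (Suc k) b g l C"
proof -
  have C: "psd_form M C" and fm: "finite_mod M C"
    and low: "\<And>x. x \<in> M \<Longrightarrow> C x x > 0 \<Longrightarrow> C x x \<ge> (3 / 4) ^ k * m"
    and ker: "\<And>x. x \<in> M \<Longrightarrow> C x x = 0 \<longleftrightarrow> (\<exists>c :: nat \<Rightarrow> int. x = (\<Sum>i<k. of_int (c i) * b i))"
    and dec: "\<And>x y. x \<in> M \<Longrightarrow> y \<in> M \<Longrightarrow> B x y = (\<Sum>i<k. (g i)\<^sup>2 * l i x * l i y) + C x y"
    using rem unfolding remainder_form_def by auto
  have flD: "b i \<in> M" "g i > 0" "l i (b i) = 1" "(g i)\<^sup>2 \<ge> (3 / 4) ^ i * m"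
    "\<And>x y. x \<in> M \<Longrightarrow> y \<in> M \<Longrightarrow> l i (x + y) = l i x + l i y" "\<And>j. j < i \<Longrightarrow> l i (b j) = 0"
    "\<And>R. R > 0 \<Longrightarrow> covers M B R \<Longrightarrow> g i \<le> 3 * R" if "i < k" for i
    using fl that unfolding reduced_flag_def by auto
  note sym = form_sym[OF M C] and CS = form_Cauchy_Schwarz[OF M C]
  obtain \<beta> where \<beta>: "\<beta> \<in> M" "C \<beta> \<beta> > 0" and min: "\<And>x. x \<in> M \<Longrightarrow> C x x > 0 \<Longrightarrow> C \<beta> \<beta> \<le> C x x"
    using finite_mod_has_minimum[OF M C fm ex] by blast
  define b' where "b' = b(k := \<beta>)"
  define g' where "g' = g(k := sqrt (C \<beta> \<beta>))"
  define l' where "l' = l(k := \<lambda>x. C x \<beta> / C \<beta> \<beta>)"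
  \<comment> \<open>The earlier basis vectors are null vectors of \<open>C\<close>, hence orthogonal
    to everything. This yields the triangular condition on the new coordinate function.\<close>
  have orth: "C (b j) \<beta> = 0" if "j < k" for j
  proof -
    have "b j = (\<Sum>i<k. of_int (if i = j then 1 else 0) * b i)"
      using that by (simp add: if_distrib[of of_int] if_distrib[of "\<lambda>x. x * _"] cong: if_cong)
    then have "\<exists>c :: nat \<Rightarrow> int. b j = (\<Sum>i<k. of_int (c i) * b i)" by (rule exI[where x = "\<lambda>i. if i = j then 1 else 0"])
    then have "C (b j) (b j) = 0" using ker[OF flD(1)[OF that]] by simp
    then show ?thesis using CS[OF flD(1)[OF that] \<beta>(1)] by simp
  qed
  have bound: "sqrt (C \<beta> \<beta>) \<le> 3 * R" if R: "R > 0" and cov: "covers M B R" for R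
  proof -
    define t where "t = sqrt (C \<beta> \<beta>)"
    have t: "t > 0" "t\<^sup>2 = C \<beta> \<beta>" using \<beta> by (auto simp: t_def)
    \<comment> \<open>The multiple \<open>s * \<beta>\<close> has projected length
      \<open>3 / 2 * R\<close>. A lattice point within \<open>R\<close> of it has projected length
      between \<open>R / 2\<close> and \<open>5 / 2 * R\<close>: it is not null, so by minimality
      \<beta> is no longer than it.\<close>
    define s where "s = 3 / 2 * R / t"
    obtain y where y: "y \<in> M" "s\<^sup>2 * B \<beta> \<beta> - 2 * s * B \<beta> y + B y y \<le> R\<^sup>2"
      using cov \<beta>(1) unfolding covers_def by blast
    \<comment> \<open>Dropping the first \<open>k\<close> Gram-Schmidt coordinates only decreases
      the distance, so the covering estimate passes to the remainder form.\<close>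
    have "0 \<le> (\<Sum>i<k. (g i)\<^sup>2 * (s * l i \<beta> - l i y)\<^sup>2)" by (intro sum_nonneg) simp
    also have "\<dots> = s\<^sup>2 * (\<Sum>i<k. (g i)\<^sup>2 * l i \<beta> * l i \<beta>) - 2 * s * (\<Sum>i<k. (g i)\<^sup>2 * l i \<beta> * l i y) + (\<Sum>i<k. (g i)\<^sup>2 * l i y * l i y)"
      unfolding sum_distrib_left sum_subtractf[symmetric] sum.distrib[symmetric]
      by (intro sum.cong refl) (simp add: power2_eq_square algebra_simps)
    finally have le: "s\<^sup>2 * C \<beta> \<beta> - 2 * s * C \<beta> y + C y y \<le> R\<^sup>2"
      using y(2) unfolding dec[OF \<beta>(1) \<beta>(1)] dec[OF \<beta>(1) y(1)] dec[OF y(1) y(1)] by (simp add: algebra_simps)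
    define u where "u = sqrt (C y y)"
    have u: "u \<ge> 0" "u\<^sup>2 = C y y" using form_nonneg[OF M C y(1)] by (auto simp: u_def)
    have "C \<beta> y \<le> t * u"
    proof (rule power2_le_imp_le)
      show "(C \<beta> y)\<^sup>2 \<le> (t * u)\<^sup>2" using CS[OF \<beta>(1) y(1)] t u by (simp add: power_mult_distrib)
    qed (use t u in auto)
    then have "s * C \<beta> y \<le> s * (t * u)" using t R by (intro mult_left_mono) (auto simp: s_def)
    moreover have "s * (t * u) = 3 / 2 * R * u" "s\<^sup>2 * C \<beta> \<beta> = (3 / 2 * R)\<^sup>2"
      using t(1) unfolding t(2)[symmetric] by (auto simp: s_def power2_eq_square)
    ultimately have "(3 / 2 * R)\<^sup>2 - 2 * (3 / 2 * R * u) + u\<^sup>2 \<le> R\<^sup>2" using le u by linarith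
    then have "(3 / 2 * R - u)\<^sup>2 \<le> R\<^sup>2" by (simp add: power2_eq_square algebra_simps)
    then have "\<bar>3 / 2 * R - u\<bar> \<le> R" using R by (metis abs_le_square_iff abs_of_pos)
    then have u1: "u > 0" "u \<le> 3 * R" using R by linarith+
    then have "C y y > 0" unfolding u(2)[symmetric] by simp
    then have "C \<beta> \<beta> \<le> C y y" using min y(1) by blast
    then have "t \<le> u" by (simp add: t_def u_def)
    then show ?thesis using u1 by (simp add: t_def)
  qed
  have "reduced_flag M B m (Suc k) b' g' l'"
    unfolding reduced_flag_def
  proof (intro allI impI)
    fix i assume "i < Suc k"
    then consider "i < k" | "i = k" by linarith
    then show "b' i \<in> M \<and> g' i > 0 \<and> (\<forall>x\<in>M. \<forall>y\<in>M. l' i (x + y) = l' i x + l' i y) \<and> l' i (b' i) = 1 \<and>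
        (\<forall>j<i. l' i (b' j) = 0) \<and> (g' i)\<^sup>2 \<ge> (3 / 4) ^ i * m \<and> (\<forall>R>0. covers M B R \<longrightarrow> g' i \<le> 3 * R)"
    proof cases
      case 1
      then show ?thesis using flD[OF 1] by (auto simp: b'_def g'_def l'_def)
    next
      case 2
      then show ?thesis using \<beta> orth bound low[OF \<beta>] form_add[OF M C]
        by (auto simp: b'_def g'_def l'_def add_divide_distrib)
    qed
  qed
  moreover have "remainder_form M B m (Suc k) b' g' l' (project_form C \<beta>)"
    unfolding remainder_form_def
  proof (intro conjI ballI impI)
    show "psd_form M (project_form C \<beta>)" by (rule project_form_psd[OF M C \<beta>])
    show "finite_mod M (project_form C \<beta>)" by (rule project_form_finite_mod[OF M C \<beta> fm])
  next
    fix x assume x: "x \<in> M" "project_form C \<beta> x x > 0"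
    have "3 / 4 * C \<beta> \<beta> \<le> project_form C \<beta> x x" by (rule project_form_lower[OF M C \<beta> min x])
    then show "(3 / 4) ^ Suc k * m \<le> project_form C \<beta> x x" using low[OF \<beta>] by simp
  next
    fix x assume x: "x \<in> M"
    have mem: "x - of_int j * \<beta> \<in> M" for j
      using additive_subgroupD(4)[OF M x additive_subgroup_of_int_mult[OF M \<beta>(1)]] .
    have k1: "project_form C \<beta> x x = 0 \<longleftrightarrow> (\<exists>j::int. C (x - of_int j * \<beta>) (x - of_int j * \<beta>) = 0)"
      by (rule project_form_kernel[OF M C \<beta> min x])
    have k2: "C (x - of_int j * \<beta>) (x - of_int j * \<beta>) = 0 \<longleftrightarrow> (\<exists>c :: nat \<Rightarrow> int. x - of_int j * \<beta> = (\<Sum>i<k. of_int (c i) * b i))" for j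
      by (rule ker[OF mem])
    have "project_form C \<beta> x x = 0 \<longleftrightarrow> (\<exists>j::int. \<exists>c :: nat \<Rightarrow> int. x - of_int j * \<beta> = (\<Sum>i<k. of_int (c i) * b i))"
      by (simp only: k1 k2)
    also have "\<dots> \<longleftrightarrow> (\<exists>c :: nat \<Rightarrow> int. x = (\<Sum>i<Suc k. of_int (c i) * b' i))"
    proof
      assume "\<exists>j::int. \<exists>c :: nat \<Rightarrow> int. x - of_int j * \<beta> = (\<Sum>i<k. of_int (c i) * b i)"
      then obtain j :: int and c :: "nat \<Rightarrow> int" where "x - of_int j * \<beta> = (\<Sum>i<k. of_int (c i) * b i)" by blast
      then have "x = (\<Sum>i<Suc k. of_int ((c(k := j)) i) * b' i)" by (simp add: b'_def)
      then show "\<exists>c :: nat \<Rightarrow> int. x = (\<Sum>i<Suc k. of_int (c i) * b' i)" by blast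
    next
      assume "\<exists>c :: nat \<Rightarrow> int. x = (\<Sum>i<Suc k. of_int (c i) * b' i)"
      then obtain c :: "nat \<Rightarrow> int" where "x = (\<Sum>i<Suc k. of_int (c i) * b' i)" by blast
      then have "x - of_int (c k) * \<beta> = (\<Sum>i<k. of_int (c i) * b i)" by (simp add: b'_def)
      then show "\<exists>j::int. \<exists>c :: nat \<Rightarrow> int. x - of_int j * \<beta> = (\<Sum>i<k. of_int (c i) * b i)" by blast
    qed
    finally show "project_form C \<beta> x x = 0 \<longleftrightarrow> (\<exists>c :: nat \<Rightarrow> int. x = (\<Sum>i<Suc k. of_int (c i) * b' i))" .
  next
    fix x y assume xy: "x \<in> M" "y \<in> M"
    show "B x y = (\<Sum>i<Suc k. (g' i)\<^sup>2 * l' i x * l' i y) + project_form C \<beta> x y"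
      using dec[OF xy] \<beta>(2) by (simp add: g'_def l'_def project_form_def power2_eq_square)
  qed
  ultimately show ?thesis by blast
qed

text \<open>The coordinate function of the last index with a non-zero coefficient kills all earlier
  basis vectors and reads off that coefficient.\<close>

lemma reduced_flag_independent:
  assumes M: "additive_subgroup M" and fl: "reduced_flag M B m k b g l"
    and z: "(\<Sum>i<k. of_int (c i) * b i) = 0" and i: "i < k"
  shows "(c i :: int) = 0"
proof (rule ccontr)
  assume ne: "c i \<noteq> 0"
  let ?I = "{i. i < k \<and> c i \<noteq> 0}"
  define p where "p = Max ?I"
  have "p \<in> ?I" unfolding p_def using i ne by (intro Max_in) auto
  then have p: "p < k" "c p \<noteq> 0" by auto
  have gt: "c j = 0" if "p < j" "j < k" for j
  proof (rule ccontr)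
    assume "c j \<noteq> 0"
    then have "j \<le> p" unfolding p_def using that by (intro Max_ge) auto
    then show False using that by simp
  qed
  have bM: "b j \<in> M" if "j < k" for j using fl that by (auto simp: reduced_flag_def)
  have add: "l p (x + y) = l p x + l p y" if "x \<in> M" "y \<in> M" for x y
    using fl p that by (auto simp: reduced_flag_def)
  have lz: "l p (of_int (c j) * b j) = of_int (c j) * l p (b j)" if "j < k" for j
    using additive_on_of_int[OF M bM[OF that] add] .
  have "l p 0 = (\<Sum>j<k. l p (of_int (c j) * b j))"
    unfolding z[symmetric] by (rule additive_on_sum[OF M]) (use bM add additive_subgroup_of_int_mult[OF M] in auto)
  also have "\<dots> = (\<Sum>j<k. if j = p then of_int (c p) else 0)"
  proof (intro sum.cong refl)
    fix j assume "j \<in> {..<k}"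
    then have j: "j < k" by simp
    consider "j < p" | "j = p" | "j > p" by linarith
    then show "l p (of_int (c j) * b j) = (if j = p then of_int (c p) else 0)"
      using lz[OF j] gt[OF _ j] fl p by cases (auto simp: reduced_flag_def)
  qed
  also have "\<dots> = of_int (c p)" using p by simp
  finally show False using p add[of 0 0] additive_subgroupD(1)[OF M] by simp
qed

text \<open>The vectors of a flag are independent, so \<open>rank\<close> bounds its length. The
  remainder form of a longest flag has to vanish, since \<open>flag_step\<close> would extend the
  flag otherwise; then the basis spans and the form is diagonal in the coordinates.\<close>

lemma exists_reduced_flag:
  assumes M: "additive_subgroup M" and B: "psd_form M B" and m: "m > 0"
    and fin: "\<And>c. finite {x \<in> M. B x x \<le> c}" and min: "\<And>x. x \<in> M \<Longrightarrow> x \<noteq> 0 \<Longrightarrow> B x x \<ge> m"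
    and rank: "\<And>k b. (\<And>i. i < k \<Longrightarrow> b i \<in> M) \<Longrightarrow>
      (\<And>c :: nat \<Rightarrow> int. (\<Sum>i<k. of_int (c i) * b i) = 0 \<Longrightarrow> \<forall>i<k. c i = 0) \<Longrightarrow> k \<le> d"
  shows "\<exists>n b g l. n \<le> d \<and> reduced_flag M B m n b g l \<and>
    (\<forall>x\<in>M. \<exists>c :: nat \<Rightarrow> int. x = (\<Sum>i<n. of_int (c i) * b i)) \<and>
    (\<forall>x\<in>M. \<forall>y\<in>M. B x y = (\<Sum>i<n. (g i)\<^sup>2 * l i x * l i y))"
proof -
  define P where "P k \<longleftrightarrow> (\<exists>b g l C. reduced_flag M B m k b g l \<and> remainder_form M B m k b g l C)" for k
  have B0: "B 0 0 = 0" using form_of_int[OF M B, of 0 0 0] additive_subgroupD(1)[OF M] by simp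
  have "finite_mod M B" unfolding finite_mod_def
  proof
    fix c
    show "\<exists>F. finite F \<and> F \<subseteq> M \<and> (\<forall>x\<in>M. B x x \<le> c \<longrightarrow> (\<exists>y\<in>F. B (x - y) (x - y) = 0))"
      by (rule exI[of _ "{x \<in> M. B x x \<le> c}"]) (use fin B0 in force)
  qed
  moreover have "B x x = 0 \<longleftrightarrow> x = 0" if "x \<in> M" for x using B0 min[OF that] m by (cases "x = 0") auto
  moreover have "B x x \<ge> m" if "x \<in> M" "B x x > 0" for x using min[OF that(1)] that B0 by (cases "x = 0") auto
  ultimately have "remainder_form M B m 0 (\<lambda>_. 0) (\<lambda>_. 0) (\<lambda>_ _. 0) B"
    using B by (auto simp: remainder_form_def)
  then have P0: "P 0" unfolding P_def by (auto simp: reduced_flag_def)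
  have le: "k \<le> d" if Pk: "P k" for k
  proof -
    obtain b g l where fl: "reduced_flag M B m k b g l" using Pk unfolding P_def by blast
    show ?thesis
      by (rule rank[of k b]) (use fl reduced_flag_independent[OF M fl] in \<open>auto simp: reduced_flag_def\<close>)
  qed
  define n where "n = Max {k. P k}"
  have finP: "finite {k. P k}" using le by (auto intro: finite_subset[of _ "{..d}"])
  have "n \<in> {k. P k}" unfolding n_def using P0 finP by (intro Max_in) auto
  then have n: "P n" by simp
  then obtain b g l C where fl: "reduced_flag M B m n b g l" and rem: "remainder_form M B m n b g l C"
    by (auto simp: P_def)
  have nS: "\<not> P (Suc n)" using Max_ge[OF finP, of "Suc n"] by (auto simp: n_def)
  have C: "psd_form M C"
    and ker: "\<forall>x\<in>M. C x x = 0 \<longleftrightarrow> (\<exists>c :: nat \<Rightarrow> int. x = (\<Sum>i<n. of_int (c i) * b i))"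
    and dec: "\<forall>x\<in>M. \<forall>y\<in>M. B x y = (\<Sum>i<n. (g i)\<^sup>2 * l i x * l i y) + C x y"
    using rem unfolding remainder_form_def by blast+
  have C0: "C x x = 0" if x: "x \<in> M" for x
  proof (rule ccontr)
    assume "C x x \<noteq> 0"
    then have "C x x > 0" using form_nonneg[OF M C x] by simp
    then have "P (Suc n)" unfolding P_def by (rule flag_step[OF M fl rem x])
    then show False using nS by simp
  qed
  have Cxy: "C x y = 0" if "x \<in> M" "y \<in> M" for x y
    using form_Cauchy_Schwarz[OF M C that] C0[OF that(1)] by simp
  have "\<forall>x\<in>M. \<exists>c :: nat \<Rightarrow> int. x = (\<Sum>i<n. of_int (c i) * b i)" using ker C0 by blast
  moreover have "\<forall>x\<in>M. \<forall>y\<in>M. B x y = (\<Sum>i<n. (g i)\<^sup>2 * l i x * l i y)"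
    using dec Cxy by simp
  ultimately show ?thesis using le[OF n] fl by blast
qed

section \<open>The field generated by a real algebraic integer and its embeddings\<close>

definition rat_eval :: "rat poly \<Rightarrow> 'a :: field_char_0 \<Rightarrow> 'a" where
  "rat_eval p x = poly (map_poly of_rat p) x"

lemma map_poly_of_rat_mult: "map_poly of_rat (p * q) = (map_poly of_rat p * map_poly of_rat q :: 'a :: field_char_0 poly)"
  by (rule poly_eqI) (simp add: coeff_map_poly coeff_mult of_rat_sum of_rat_mult)

lemma map_poly_of_rat_add: "map_poly of_rat (p + q) = (map_poly of_rat p + map_poly of_rat q :: 'a :: field_char_0 poly)"
  by (rule poly_eqI) (simp add: coeff_map_poly of_rat_add)

lemma rat_eval_add: "rat_eval (p + q) x = rat_eval p x + rat_eval q x"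
  by (simp add: rat_eval_def map_poly_of_rat_add)

lemma rat_eval_mult: "rat_eval (p * q) x = rat_eval p x * rat_eval q x"
  by (simp add: rat_eval_def map_poly_of_rat_mult)

lemma rat_eval_0 [simp]: "rat_eval 0 x = 0"
  and rat_eval_1 [simp]: "rat_eval 1 x = 1"
  and rat_eval_const: "rat_eval [:c:] x = of_rat c"
  and rat_eval_pCons: "rat_eval (pCons c p) x = of_rat c + x * rat_eval p x"
  and rat_eval_X: "rat_eval [:0, 1:] x = x"
  by (simp_all add: rat_eval_def of_rat_hom.map_poly_pCons_hom)

lemma rat_eval_smult: "rat_eval (Polynomial.smult c p) x = of_rat c * rat_eval p x"
  using rat_eval_mult[of "[:c:]" p x] by (simp add: rat_eval_const)

lemma rat_eval_uminus: "rat_eval (- p) x = - rat_eval p x"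
  using rat_eval_smult[of "-1" p x] by simp

lemma rat_eval_diff: "rat_eval (p - q) x = rat_eval p x - rat_eval q x"
  using rat_eval_add[of p "- q" x] by (simp add: rat_eval_uminus)

lemma rat_eval_sum: "rat_eval (sum f A) x = (\<Sum>i\<in>A. rat_eval (f i) x)"
  by (induction A rule: infinite_finite_induct) (simp_all add: rat_eval_add)

lemma of_real_of_rat: "complex_of_real (of_rat q) = of_rat q"
  by (cases q) (simp add: of_rat_rat)

lemma rat_eval_of_real: "rat_eval p (of_real x) = (of_real (rat_eval p x) :: complex)"
  by (induction p) (simp_all add: rat_eval_pCons of_real_of_rat)

text \<open>This justifies the \<open>THE\<close> in \<open>min_poly\<close>. Division with
  remainder shows that an annihilator of least degree divides all others, which gives both
  irreducibility and uniqueness of its monic multiple.\<close>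

lemma min_poly_unique_existence:
  assumes "algebraic (x :: complex)"
  shows "\<exists>!p. monic p \<and> irreducible p \<and> poly (map_poly of_rat p) x = 0"
proof -
  obtain q :: "int poly" where q: "q \<noteq> 0" "poly (map_poly of_int q) x = 0" using assms by (rule algebraicE')
  have "map_poly of_rat (map_poly of_int q) = (map_poly of_int q :: complex poly)"
    by (rule poly_eqI) (simp add: coeff_map_poly)
  then have "map_poly of_int q \<noteq> (0 :: rat poly) \<and> rat_eval (map_poly of_int q) x = 0"
    using q by (simp add: rat_eval_def)
  then obtain p where p: "p \<noteq> 0" "rat_eval p x = 0"
    and least: "\<And>r. r \<noteq> 0 \<Longrightarrow> rat_eval r x = 0 \<Longrightarrow> degree p \<le> degree r"
    using ex_has_least_nat[of "\<lambda>p. p \<noteq> 0 \<and> rat_eval p x = 0" "map_poly of_int q" degree] by blast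
  have dvd: "p dvd r" if "rat_eval r x = 0" for r
  proof -
    have "rat_eval r x = rat_eval p x * rat_eval (r div p) x + rat_eval (r mod p) x"
      by (metis mult_div_mod_eq rat_eval_add rat_eval_mult)
    then have "rat_eval (r mod p) x = 0" using that p by simp
    then have "r mod p = 0" using least[of "r mod p"] degree_mod_less[of p r] p by force
    then show ?thesis by auto
  qed
  define f where "f = Polynomial.smult (inverse (lead_coeff p)) p"
  have f: "monic f" "rat_eval f x = 0" using p by (auto simp: f_def rat_eval_smult)
  have dvd_f: "f dvd r" if "rat_eval r x = 0" for r
    using dvd[OF that] p by (simp add: f_def smult_dvd_iff)
  have f0: "f \<noteq> 0" using f by auto
  have nu: "\<not> f dvd 1"
  proof
    assume "f dvd 1"
    then obtain c where "1 = f * c" by (elim dvdE)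
    then have "rat_eval (f * c) x = 1" by (metis rat_eval_1)
    then show False using f by (simp add: rat_eval_mult)
  qed
  have irr: "irreducible f"
  proof (rule irreducibleI)
    fix a b assume ab: "f = a * b"
    then have "rat_eval a x = 0 \<or> rat_eval b x = 0" using f by (simp add: rat_eval_mult)
    then show "a dvd 1 \<or> b dvd 1"
    proof
      assume "rat_eval a x = 0"
      then have "a * b dvd a * 1" using dvd_f ab by simp
      then show ?thesis using f0 ab by (subst (asm) dvd_mult_cancel_left) auto
    next
      assume "rat_eval b x = 0"
      then have "b * a dvd b * 1" using dvd_f ab by (simp add: mult.commute)
      then show ?thesis using f0 ab by (subst (asm) dvd_mult_cancel_left) auto
    qed
  qed (use f0 nu in auto)
  show ?thesis
  proof (rule ex1I[of _ f])
    show "monic f \<and> irreducible f \<and> poly (map_poly of_rat f) x = 0" using f irr by (simp add: rat_eval_def)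
  next
    fix h assume h: "monic h \<and> irreducible h \<and> poly (map_poly of_rat h) x = 0"
    then have "f dvd h" using dvd_f by (simp add: rat_eval_def)
    then obtain c where c: "h = f * c" by (elim dvdE)
    then have "c dvd 1" using h nu irreducibleD by blast
    then obtain a where a: "c = [:a:]" using is_unit_poly_iff by blast
    have "lead_coeff h = lead_coeff f * lead_coeff c" by (simp add: c lead_coeff_mult)
    then have "a = 1" using h f a by simp
    then show "h = f" using c a by simp
  qed
qed

lemma min_poly_props:
  assumes "algebraic (x :: complex)"
  shows "monic (min_poly x)" "irreducible (min_poly x)" "rat_eval (min_poly x) x = 0"
  using theI'[OF min_poly_unique_existence[OF assms]] unfolding min_poly_def rat_eval_def by auto

text \<open>A non-zero element of least degree in the ideal generated by \<open>p\<close> and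
  \<open>f\<close> divides both. The identity supplies inverses in the field generated by
  \<open>l\<close>, and it shows that a polynomial vanishing at a root of \<open>f\<close> is a
  multiple of \<open>f\<close>.\<close>

lemma irreducible_dvd_or_Bezout:
  fixes f :: "rat poly"
  assumes "irreducible f"
  shows "f dvd p \<or> (\<exists>u v. u * p + v * f = 1)"
proof (cases "f dvd p")
  case False
  have f0: "f \<noteq> 0" using assms by auto
  define I where "I h \<longleftrightarrow> (\<exists>u v. h = u * p + v * f)" for h
  have I_f: "I f" and I_p: "I p"
    unfolding I_def by (intro exI[of _ 0] exI[of _ 1], simp, intro exI[of _ 1] exI[of _ 0], simp)
  obtain h where h: "h \<noteq> 0" "I h" and least: "\<And>r. r \<noteq> 0 \<Longrightarrow> I r \<Longrightarrow> degree h \<le> degree r"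
    using ex_has_least_nat[of "\<lambda>h. h \<noteq> 0 \<and> I h" f degree] f0 I_f by blast
  have dvd: "h dvd r" if r: "I r" for r
  proof -
    obtain u v u' v' where uv: "h = u * p + v * f" "r = u' * p + v' * f" using h r by (auto simp: I_def)
    define w where "w = r div h"
    have "r mod h = r - w * h" by (simp add: w_def minus_div_mult_eq_mod)
    also have "\<dots> = (u' * p + v' * f) - w * (u * p + v * f)" by (simp only: uv[symmetric])
    also have "\<dots> = (u' - w * u) * p + (v' - w * v) * f" by (simp add: algebra_simps)
    finally have "I (r mod h)" unfolding I_def by blast
    then have "r mod h = 0" using least[of "r mod h"] degree_mod_less[OF h(1), of r] by force
    then show ?thesis by auto
  qed
  obtain c where c: "f = h * c" using dvd[OF I_f] by (elim dvdE)
  then consider "h dvd 1" | "c dvd 1" using assms irreducibleD by blast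
  then show ?thesis
  proof cases
    case 1
    then obtain w where w: "1 = h * w" by (elim dvdE)
    obtain u v where "h = u * p + v * f" using h by (auto simp: I_def)
    then have "(w * u) * p + (w * v) * f = 1" unfolding w by (simp add: algebra_simps)
    then show ?thesis by blast
  next
    case 2
    then have "f dvd h" using c by (metis dvd_mult_unit_iff dvd_refl mult_unit_dvd_iff)
    then show ?thesis using False dvd[OF I_p] dvd_trans by blast
  qed
qed simp

section \<open>The number field of a real algebraic integer and its complex embeddings\<close>

locale algebraic_real =
  fixes l :: real
  assumes alg: "algebraic_int l"
begin

definition f :: "rat poly" where "f = min_poly (of_real l)"
definition d :: nat where "d = degree f"
definition K :: "real set" where "K = QQ_adj l"
definition OK :: "real set" where "OK = ring_of_integers K"
definition E :: "(real \<Rightarrow> complex) set" where "E = embeddings K"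

lemma monic_f: "monic f" and irreducible_f: "irreducible f" and f_l_complex: "rat_eval f (complex_of_real l) = 0"
proof -
  have "algebraic (complex_of_real l)" using alg by auto
  from min_poly_props[OF this] show "monic f" "irreducible f" "rat_eval f (complex_of_real l) = 0"
    by (auto simp: f_def)
qed

lemma f_nonzero: "f \<noteq> 0" using monic_f by auto

lemma f_l: "rat_eval f l = 0"
  using f_l_complex by (simp add: rat_eval_of_real)

lemma dvd_iff_root:
  fixes z :: "'a :: field_char_0"
  assumes "rat_eval f z = 0"
  shows "f dvd p \<longleftrightarrow> rat_eval p z = 0"
proof
  assume "rat_eval p z = 0"
  then have "\<not> (\<exists>u v. u * p + v * f = 1)"
    using assms by (metis rat_eval_1 rat_eval_add rat_eval_mult mult_zero_right add_0 zero_neq_one)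
  then show "f dvd p" using irreducible_dvd_or_Bezout[OF irreducible_f] by blast
qed (use assms in \<open>auto simp: rat_eval_mult elim!: dvdE\<close>)

lemma d_pos: "d > 0"
proof (rule ccontr)
  assume "\<not> ?thesis"
  then have "degree f = 0" by (simp add: d_def)
  then obtain c where "f = [:c:]" by (metis degree_eq_zeroE)
  then have "is_unit f" using f_nonzero by simp
  then show False using irreducible_f by (simp add: irreducible_def)
qed

lemma conjugates_eq: "conjugates l = {z. rat_eval f z = 0}"
  by (simp add: conjugates_def rat_eval_def f_def)

lemma rsquarefree_f: "rsquarefree (map_poly of_rat f :: complex poly)"
  unfolding rsquarefree_roots
proof (intro allI notI)
  fix z :: complex
  assume z: "poly (map_poly of_rat f) z = 0 \<and> poly (pderiv (map_poly of_rat f)) z = 0"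
  then have "rat_eval f z = 0" "rat_eval (pderiv f) z = 0"
    by (auto simp: rat_eval_def of_rat_hom.map_poly_pderiv)
  then have "f dvd pderiv f" using dvd_iff_root by blast
  then show False using d_pos not_dvd_pderiv[of f] by (simp add: d_def)
qed

lemma card_conjugates: "card (conjugates l) = d" and finite_conjugates: "finite (conjugates l)"
proof -
  have "coeff (map_poly of_rat f :: complex poly) (degree f) = 1"
    using monic_f by (simp add: of_rat_hom.coeff_map_poly_hom)
  then have "map_poly of_rat f \<noteq> (0 :: complex poly)" by auto
  then have "card {z. poly (map_poly of_rat f :: complex poly) z = 0} = degree (map_poly of_rat f :: complex poly)"
    using rsquarefree_f rsquarefree_card_degree by blast
  then show c: "card (conjugates l) = d" by (simp add: conjugates_eq rat_eval_def d_def of_rat_hom.degree_map_poly_hom)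
  show "finite (conjugates l)" using c d_pos by (metis card.infinite less_irrefl)
qed

lemma l_conjugate: "complex_of_real l \<in> conjugates l"
  by (simp add: conjugates_eq f_l_complex)

lemma K_eq: "K = range (\<lambda>p. rat_eval p l)"
proof
  have "is_subfield (range (\<lambda>p. rat_eval p l))"
    unfolding is_subfield_def
  proof (intro conjI ballI)
    show "0 \<in> range (\<lambda>p. rat_eval p l)" by (rule range_eqI[of _ _ 0]) simp
    show "1 \<in> range (\<lambda>p. rat_eval p l)" by (rule range_eqI[of _ _ 1]) simp
  next
    fix x y assume "x \<in> range (\<lambda>p. rat_eval p l)" "y \<in> range (\<lambda>p. rat_eval p l)"
    then obtain p q where pq: "x = rat_eval p l" "y = rat_eval q l" by auto
    show "x + y \<in> range (\<lambda>p. rat_eval p l)" by (rule range_eqI[of _ _ "p + q"]) (simp add: rat_eval_add pq)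
    show "x * y \<in> range (\<lambda>p. rat_eval p l)" by (rule range_eqI[of _ _ "p * q"]) (simp add: rat_eval_mult pq)
  next
    fix x assume "x \<in> range (\<lambda>p. rat_eval p l)"
    then obtain p where p: "x = rat_eval p l" by auto
    show "- x \<in> range (\<lambda>p. rat_eval p l)" by (rule range_eqI[of _ _ "- p"]) (simp add: rat_eval_uminus p)
    show "inverse x \<in> range (\<lambda>p. rat_eval p l)"
    proof (cases "x = 0")
      case True
      then show ?thesis by (intro range_eqI[of _ _ 0]) simp
    next
      case False
      then have "\<not> f dvd p" using dvd_iff_root[OF f_l] p by simp
      then obtain u v where "u * p + v * f = 1" using irreducible_dvd_or_Bezout[OF irreducible_f] by blast
      then have "rat_eval (u * p + v * f) l = 1" by simp
      then have "rat_eval u l * x = 1" using p f_l by (simp add: rat_eval_add rat_eval_mult)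
      then have "inverse x = rat_eval u l" using False by (simp add: field_simps)
      then show ?thesis by blast
    qed
  qed
  moreover have "l \<in> range (\<lambda>p. rat_eval p l)" by (rule range_eqI[of _ _ "[:0, 1:]"]) (simp add: rat_eval_X)
  ultimately show "K \<subseteq> range (\<lambda>p. rat_eval p l)" unfolding K_def QQ_adj_def by blast
next
  have "rat_eval p l \<in> F" if F: "is_subfield F" "l \<in> F" for p F
  proof -
    have add: "x + y \<in> F" and mult: "x * y \<in> F" if "x \<in> F" "y \<in> F" for x y using F that by (auto simp: is_subfield_def)
    have z: "0 \<in> F" and o: "1 \<in> F" and um: "\<And>x. x \<in> F \<Longrightarrow> - x \<in> F" and iv: "\<And>x. x \<in> F \<Longrightarrow> inverse x \<in> F"
      using F by (auto simp: is_subfield_def)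
    have nat: "real n \<in> F" for n by (induction n) (use z o add in auto)
    have int: "real_of_int k \<in> F" for k
      by (cases k rule: int_cases2) (use nat um in auto)
    have rat: "of_rat q \<in> F" for q :: rat
    proof -
      have "q = of_int (fst (quotient_of q)) / of_int (snd (quotient_of q))" by (metis quotient_of_div prod.collapse)
      then have "of_rat q = real_of_int (fst (quotient_of q)) * inverse (real_of_int (snd (quotient_of q)))"
        by (metis of_rat_of_int_eq of_rat_divide divide_inverse)
      then show ?thesis using mult int iv by simp
    qed
    show ?thesis
      by (induction p) (use z rat add mult F in \<open>auto simp: rat_eval_pCons\<close>)
  qed
  then show "range (\<lambda>p. rat_eval p l) \<subseteq> K" unfolding K_def QQ_adj_def by blast
qed

lemma rat_eval_in_K: "rat_eval p l \<in> K" by (simp add: K_eq)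

lemma l_in_K: "l \<in> K" using rat_eval_in_K[of "[:0, 1:]"] by (simp add: rat_eval_X)

lemma of_rat_in_K: "of_rat q \<in> K" using rat_eval_in_K[of "[:q:]"] by (simp add: rat_eval_const)

lemma of_int_in_K: "of_int q \<in> K" using of_rat_in_K[of "of_int q"] by simp

lemma K_add: "x \<in> K \<Longrightarrow> y \<in> K \<Longrightarrow> x + y \<in> K"
  and K_mult: "x \<in> K \<Longrightarrow> y \<in> K \<Longrightarrow> x * y \<in> K"
  and K_uminus: "x \<in> K \<Longrightarrow> - x \<in> K"
  unfolding K_eq by (auto simp: rat_eval_add[symmetric] rat_eval_mult[symmetric] rat_eval_uminus[symmetric])

lemma K_diff: "x \<in> K \<Longrightarrow> y \<in> K \<Longrightarrow> x - y \<in> K"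
  using K_add[OF _ K_uminus] by force

lemma K_power: "x \<in> K \<Longrightarrow> x ^ n \<in> K"
  using of_int_in_K[of 1] by (induction n) (auto intro: K_mult)

lemma K_sum: "(\<And>i. i \<in> A \<Longrightarrow> g i \<in> K) \<Longrightarrow> sum g A \<in> K"
  using of_int_in_K[of 0] by (induction A rule: infinite_finite_induct) (auto intro: K_add)

context
  fixes \<sigma> assumes \<sigma>: "\<sigma> \<in> E"
begin

lemma emb_add: "x \<in> K \<Longrightarrow> y \<in> K \<Longrightarrow> \<sigma> (x + y) = \<sigma> x + \<sigma> y"
  and emb_mult: "x \<in> K \<Longrightarrow> y \<in> K \<Longrightarrow> \<sigma> (x * y) = \<sigma> x * \<sigma> y"
  and emb_1: "\<sigma> 1 = 1" and emb_outside: "x \<notin> K \<Longrightarrow> \<sigma> x = 0"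
  using \<sigma> by (auto simp: E_def embeddings_def)

lemma emb_0: "\<sigma> 0 = 0"
  using emb_add[of 0 0] of_int_in_K[of 0] by simp

lemma emb_uminus: "x \<in> K \<Longrightarrow> \<sigma> (- x) = - \<sigma> x"
  using emb_add[of x "- x"] emb_0 K_uminus by (simp add: eq_neg_iff_add_eq_0 add.commute)

lemma emb_diff: "x \<in> K \<Longrightarrow> y \<in> K \<Longrightarrow> \<sigma> (x - y) = \<sigma> x - \<sigma> y"
  using emb_add[of x "- y"] emb_uminus K_uminus by simp

lemma emb_of_int_mult: "x \<in> K \<Longrightarrow> \<sigma> (of_int k * x) = of_int k * \<sigma> x"
proof (induction k rule: int_induct[of _ 0])
  case base
  then show ?case by (simp add: emb_0)
next
  case (step1 i)
  then show ?case using emb_add[of "of_int i * x" x] of_int_in_K K_mult by (simp add: algebra_simps)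
next
  case (step2 i)
  then show ?case using emb_diff[of "of_int i * x" x] of_int_in_K K_mult by (simp add: algebra_simps)
qed

lemma emb_of_int: "\<sigma> (of_int k) = of_int k"
  using emb_of_int_mult[of 1 k] of_int_in_K[of 1] emb_1 by simp

lemma emb_of_rat: "\<sigma> (of_rat q) = of_rat q"
proof -
  let ?a = "fst (quotient_of q)" and ?b = "snd (quotient_of q)"
  have b: "?b \<noteq> 0" using quotient_of_denom_pos' [of q] by simp
  have q: "q = of_int ?a / of_int ?b" by (metis quotient_of_div prod.collapse)
  then have "of_int ?b * q = of_int ?a" using b by (metis nonzero_mult_div_cancel_left of_int_eq_0_iff times_divide_eq_right)
  then have r: "of_int ?b * of_rat q = (of_int ?a :: 'b :: field_char_0)" by (metis of_rat_mult of_rat_of_int_eq)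
  have "of_int ?b * \<sigma> (of_rat q) = of_int ?a"
    using emb_of_int_mult[OF of_rat_in_K, of ?b q] r emb_of_int by metis
  also have "\<dots> = of_int ?b * of_rat q" using r by metis
  finally show ?thesis using b by simp
qed

lemma emb_rat_eval: "x \<in> K \<Longrightarrow> rat_eval p x \<in> K \<and> \<sigma> (rat_eval p x) = rat_eval p (\<sigma> x)"
proof (induction p)
  case 0
  then show ?case using emb_0 of_int_in_K[of 0] by simp
next
  case (pCons a p)
  then show ?case using of_rat_in_K K_mult K_add
    by (auto simp: rat_eval_pCons emb_add emb_mult emb_of_rat)
qed

lemma emb_sum: "(\<And>i. i \<in> A \<Longrightarrow> g i \<in> K) \<Longrightarrow> \<sigma> (sum g A) = (\<Sum>i\<in>A. \<sigma> (g i))"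
  by (induction A rule: infinite_finite_induct) (auto simp: emb_0 emb_add K_sum)

lemma emb_power: "x \<in> K \<Longrightarrow> \<sigma> (x ^ n) = \<sigma> x ^ n"
  by (induction n) (auto simp: emb_1 emb_mult K_power)

lemma emb_conjugate: "\<sigma> l \<in> conjugates l"
  using emb_rat_eval[OF l_in_K, of f] f_l emb_0 by (simp add: conjugates_eq)

lemma emb_algebraic_int:
  assumes "x \<in> K" "algebraic_int x"
  shows "algebraic_int (\<sigma> x)"
proof -
  obtain p where p: "poly (map_poly of_int p) x = 0" "lead_coeff p = 1"
    using assms(2) by (auto simp: algebraic_int_altdef_ipoly)
  have e: "rat_eval (map_poly of_int p) y = poly (map_poly of_int p) y" for y :: "'b :: field_char_0"
    unfolding rat_eval_def by (rule arg_cong[of _ _ "\<lambda>q. poly q y"], rule poly_eqI) (simp add: coeff_map_poly)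
  have "rat_eval (map_poly of_int p) x = 0" using e p by metis
  then have "rat_eval (map_poly of_int p) (\<sigma> x) = 0" using emb_rat_eval[OF assms(1)] emb_0 by metis
  then have "poly (map_poly of_int p) (\<sigma> x) = 0" using e by metis
  then show ?thesis using p(2) by (auto simp: algebraic_int_altdef_ipoly)
qed

lemma emb_min_poly_root:
  assumes "x \<in> K" "algebraic_int x"
  shows "\<sigma> x \<in> conjugates x"
proof -
  have "algebraic (complex_of_real x)" using assms by auto
  from min_poly_props(3)[OF this] have "rat_eval (min_poly (of_real x)) x = 0" by (simp add: rat_eval_of_real)
  then have "rat_eval (min_poly (of_real x)) (\<sigma> x) = 0" using emb_rat_eval[OF assms(1)] emb_0 by metis
  then show ?thesis by (simp add: conjugates_def rat_eval_def)
qed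

end

lemma emb_inj: "inj_on (\<lambda>\<sigma>. \<sigma> l) E"
proof (rule inj_onI, rule ext)
  fix \<sigma> \<tau> x assume st: "\<sigma> \<in> E" "\<tau> \<in> E" "\<sigma> l = \<tau> l"
  show "\<sigma> x = \<tau> x"
  proof (cases "x \<in> K")
    case True
    then obtain p where "x = rat_eval p l" by (auto simp: K_eq)
    then show ?thesis using emb_rat_eval[OF st(1) l_in_K] emb_rat_eval[OF st(2) l_in_K] st(3) by metis
  qed (simp add: emb_outside[OF st(1)] emb_outside[OF st(2)])
qed

lemma emb_exists:
  assumes z: "z \<in> conjugates l"
  shows "\<exists>\<sigma>\<in>E. \<sigma> l = z"
proof -
  \<comment> \<open>The choice of the polynomial is immaterial: two polynomials that agree at
    \<open>l\<close> differ by a multiple of \<open>f\<close>, which also vanishes at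
    \<open>z\<close>. The value 0 outside \<open>K\<close> is the normalisation demanded by
    \<open>embeddings\<close>.\<close>
  define \<sigma> where "\<sigma> x = (if x \<in> K then rat_eval (SOME p. rat_eval p l = x) z else 0)" for x
  have z0: "rat_eval f z = 0" using z by (simp add: conjugates_eq)
  have val: "\<sigma> (rat_eval p l) = rat_eval p z" for p
  proof -
    let ?q = "SOME q. rat_eval q l = rat_eval p l"
    have "rat_eval ?q l = rat_eval p l" by (rule someI) (rule refl)
    then have "f dvd ?q - p" using dvd_iff_root[OF f_l] by (simp add: rat_eval_diff)
    then have "rat_eval ?q z = rat_eval p z" using dvd_iff_root[OF z0] by (simp add: rat_eval_diff)
    then show ?thesis by (simp add: \<sigma>_def rat_eval_in_K)
  qed
  have "\<sigma> \<in> E"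
    unfolding E_def embeddings_def
  proof (intro CollectI conjI ballI allI impI)
    fix x y assume "x \<in> K" "y \<in> K"
    then obtain p q where pq: "x = rat_eval p l" "y = rat_eval q l" by (auto simp: K_eq)
    show "\<sigma> (x + y) = \<sigma> x + \<sigma> y" unfolding pq rat_eval_add[symmetric] val by (simp add: rat_eval_add)
    show "\<sigma> (x * y) = \<sigma> x * \<sigma> y" unfolding pq rat_eval_mult[symmetric] val by (simp add: rat_eval_mult)
  next
    show "\<sigma> 1 = 1" using val[of 1] by simp
  qed (simp add: \<sigma>_def)
  moreover have "\<sigma> l = z" using val[of "[:0, 1:]"] by (simp add: rat_eval_X)
  ultimately show ?thesis by blast
qed

lemma emb_bij: "bij_betw (\<lambda>\<sigma>. \<sigma> l) E (conjugates l)"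
  unfolding bij_betw_def using emb_inj emb_exists emb_conjugate by (auto simp: image_iff)

lemma finite_E: "finite E" and card_E: "card E = d"
  using bij_betw_finite[OF emb_bij] bij_betw_same_card[OF emb_bij] finite_conjugates card_conjugates by auto

lemma field_degree_eq: "field_degree K = d"
  using card_E by (simp add: field_degree_def E_def)

text \<open>The inclusion of \<open>K\<close>, cut off outside \<open>K\<close> because embeddings
  are total functions on the reals that vanish there.\<close>

definition idE :: "real \<Rightarrow> complex" where "idE x = (if x \<in> K then of_real x else 0)"

lemma idE_in_E: "idE \<in> E"
  using K_add K_mult of_int_in_K[of 1] unfolding E_def embeddings_def idE_def by auto

lemma cnj_E: "\<sigma> \<in> E \<Longrightarrow> (\<lambda>x. cnj (\<sigma> x)) \<in> E"
  unfolding E_def embeddings_def by auto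

lemma sum_cnj_E: "(\<Sum>\<sigma>\<in>E. h (\<lambda>x. cnj (\<sigma> x))) = (\<Sum>\<sigma>\<in>E. h \<sigma>)"
  by (rule sum.reindex_bij_witness[of _ "\<lambda>\<sigma> x. cnj (\<sigma> x)" "\<lambda>\<sigma> x. cnj (\<sigma> x)"]) (auto intro: cnj_E)

end

section \<open>Traces and the ring of integers\<close>

text \<open>The determinant trick: \<open>z\<close> is an eigenvalue of an integer matrix, hence a
  root of its monic integral characteristic polynomial.\<close>

lemma algebraic_int_of_eigenvector:
  fixes z :: complex and v :: "nat \<Rightarrow> complex" and A :: "nat \<Rightarrow> nat \<Rightarrow> int"
  assumes v: "i0 < n" "v i0 \<noteq> 0"
    and ev: "\<And>i. i < n \<Longrightarrow> z * v i = (\<Sum>j<n. of_int (A i j) * v j)"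
  shows "algebraic_int z"
proof -
  define M where "M = mat n n (\<lambda>(i, j). A i j)"
  have M: "M \<in> carrier_mat n n" and Mc: "map_mat of_int M \<in> carrier_mat n n" by (auto simp: M_def)
  define w where "w = vec n v"
  have "map_mat of_int M *\<^sub>v w = z \<cdot>\<^sub>v w"
  proof (rule eq_vecI)
    fix i assume "i < dim_vec (z \<cdot>\<^sub>v w)"
    then have i: "i < n" by (simp add: w_def)
    have "(map_mat of_int M *\<^sub>v w) $ i = (\<Sum>j<n. of_int (A i j) * v j)"
      using i by (simp add: M_def w_def scalar_prod_def atLeast0LessThan)
    then show "(map_mat of_int M *\<^sub>v w) $ i = (z \<cdot>\<^sub>v w) $ i" using i ev[OF i] by (simp add: w_def)
  qed (simp add: M_def w_def)
  moreover have "w \<noteq> 0\<^sub>v n"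
  proof
    assume "w = 0\<^sub>v n"
    then have "w $ i0 = 0" using v by simp
    then show False using v by (simp add: w_def)
  qed
  ultimately have "eigenvector (map_mat of_int M) w z" using M by (auto simp: eigenvector_def w_def)
  then have "eigenvalue (map_mat of_int M) z" unfolding eigenvalue_def by blast
  then have "poly (map_poly of_int (char_poly M)) z = 0"
    using eigenvalue_root_char_poly[OF Mc] of_int_hom.char_poly_hom[OF M] by metis
  moreover have "lead_coeff (char_poly M) = 1" using degree_monic_char_poly[OF M] by simp
  ultimately show ?thesis by (auto simp: algebraic_int_altdef_ipoly)
qed

definition int_span :: "nat \<Rightarrow> (nat \<Rightarrow> complex) \<Rightarrow> complex set" where
  "int_span n v = {\<Sum>j<n. of_int (c j) * v j | c :: nat \<Rightarrow> int. True}"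

lemma int_spanI: "a = (\<Sum>j<n. of_int (c j) * v j) \<Longrightarrow> a \<in> int_span n v"
  by (auto simp: int_span_def)

lemma int_span_add:
  assumes "a \<in> int_span n v" "b \<in> int_span n v"
  shows "a + b \<in> int_span n v"
proof -
  obtain c c' :: "nat \<Rightarrow> int" where "a = (\<Sum>j<n. of_int (c j) * v j)" "b = (\<Sum>j<n. of_int (c' j) * v j)"
    using assms by (auto simp: int_span_def)
  then have "a + b = (\<Sum>j<n. of_int (c j + c' j) * v j)" by (simp add: sum.distrib algebra_simps)
  then show ?thesis by (rule int_spanI)
qed

lemma int_span_of_int_mult:
  assumes "a \<in> int_span n v"
  shows "of_int k * a \<in> int_span n v"
proof -
  obtain c :: "nat \<Rightarrow> int" where "a = (\<Sum>j<n. of_int (c j) * v j)" using assms by (auto simp: int_span_def)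
  then have "of_int k * a = (\<Sum>j<n. of_int (k * c j) * v j)" by (simp add: sum_distrib_left algebra_simps)
  then show ?thesis by (rule int_spanI)
qed

lemma int_span_sum: "(\<And>i. i \<in> I \<Longrightarrow> f i \<in> int_span n v) \<Longrightarrow> sum f I \<in> int_span n v"
proof (induction I rule: infinite_finite_induct)
  case (insert i I)
  then show ?case by (simp add: int_span_add)
qed (auto simp: int_span_def intro!: exI[of _ "\<lambda>_. 0"])

lemma int_span_base:
  assumes "j < n"
  shows "v j \<in> int_span n v"
proof -
  have "v j = (\<Sum>i<n. of_int (if i = j then 1 else 0) * v i)"
    using assms by (simp add: if_distrib[of of_int] if_distrib[of "\<lambda>x. x * _"] cong: if_cong)
  then show ?thesis by (rule int_spanI)
qed

lemma int_span_stable: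
  assumes "\<And>j. j < n \<Longrightarrow> x * v j \<in> int_span n v" and "a \<in> int_span n v"
  shows "x * a \<in> int_span n v"
proof -
  obtain c :: "nat \<Rightarrow> int" where "a = (\<Sum>j<n. of_int (c j) * v j)" using assms(2) by (auto simp: int_span_def)
  then have "x * a = (\<Sum>j<n. of_int (c j) * (x * v j))" by (simp add: sum_distrib_left algebra_simps)
  then show ?thesis using assms(1) by (auto intro!: int_span_sum int_span_of_int_mult)
qed

lemma algebraic_int_of_stable:
  assumes "i0 < n" "v i0 \<noteq> 0" and stable: "\<And>j. j < n \<Longrightarrow> z * v j \<in> int_span n v"
  shows "algebraic_int z"
proof -
  have "\<forall>j. \<exists>c :: nat \<Rightarrow> int. j < n \<longrightarrow> z * v j = (\<Sum>i<n. of_int (c i) * v i)"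
    using stable by (auto simp: int_span_def)
  from choice[OF this] obtain A :: "nat \<Rightarrow> nat \<Rightarrow> int" where "\<And>j. j < n \<Longrightarrow> z * v j = (\<Sum>i<n. of_int (A j i) * v i)" by blast
  then show ?thesis by (rule algebraic_int_of_eigenvector[of i0 n v z A, OF assms(1,2)])
qed

lemma algebraic_int_power_reduction:
  assumes "algebraic_int (x :: complex)"
  obtains m and a :: "nat \<Rightarrow> int" where "m > 0" "x ^ m = (\<Sum>i<m. of_int (a i) * x ^ i)"
proof -
  obtain p where p: "poly (map_poly of_int p) x = 0" "lead_coeff p = 1"
    using assms by (auto simp: algebraic_int_altdef_ipoly)
  have "degree (map_poly of_int p :: complex poly) = degree p" by (rule degree_map_poly) simp
  then have "(\<Sum>i\<le>degree p. of_int (coeff p i) * x ^ i) = 0"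
    using p(1) by (simp add: poly_altdef coeff_map_poly)
  then have s: "(\<Sum>i<degree p. of_int (coeff p i) * x ^ i) + x ^ degree p = 0"
    using p(2) by (simp add: lessThan_Suc_atMost[symmetric])
  then have e: "x ^ degree p = (\<Sum>i<degree p. of_int (- coeff p i) * x ^ i)"
    by (simp add: sum_negf eq_neg_iff_add_eq_0 add.commute)
  have "degree p \<noteq> 0" by (rule notI) (use s in simp)
  then show ?thesis using that[of "degree p" "\<lambda>i. - coeff p i"] e by simp
qed

text \<open>The products \<open>x ^ i * y ^ j\<close> with \<open>i < m\<close> and
  \<open>j < n\<close> span a finitely generated group that is stable under multiplication by
  \<open>x\<close> and by \<open>y\<close>, hence by their sum and product. The index
  \<open>k\<close> encodes the pair of exponents by \<open>k div n\<close> and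
  \<open>k mod n\<close>.\<close>

lemma algebraic_int_plus_times:
  assumes "algebraic_int (x :: complex)" "algebraic_int y"
  shows "algebraic_int (x + y)" "algebraic_int (x * y)"
proof -
  obtain m and a :: "nat \<Rightarrow> int" where m: "m > 0" "x ^ m = (\<Sum>i<m. of_int (a i) * x ^ i)"
    using algebraic_int_power_reduction[OF assms(1)] .
  obtain n and b :: "nat \<Rightarrow> int" where n: "n > 0" "y ^ n = (\<Sum>i<n. of_int (b i) * y ^ i)"
    using algebraic_int_power_reduction[OF assms(2)] .
  define v where "v k = x ^ (k div n) * y ^ (k mod n)" for k
  let ?G = "int_span (m * n) v"
  have base: "x ^ i * y ^ j \<in> ?G" if "i < m" "j < n" for i j
  proof -
    have "i * n + j < m * n" using that
      by (metis Suc_leI add_less_cancel_left mult_Suc mult_le_mono1 add.commute less_le_trans)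
    then have "v (i * n + j) \<in> ?G" by (rule int_span_base)
    then show ?thesis using that by (simp add: v_def)
  qed
  have step_x: "x * v k \<in> ?G" if "k < m * n" for k
  proof -
    have i: "k div n < m" using that by (simp add: less_mult_imp_div_less)
    have j: "k mod n < n" using n by simp
    show ?thesis
    proof (cases "Suc (k div n) < m")
      case True
      then show ?thesis using base[OF True j] by (simp add: v_def mult.assoc)
    next
      case False
      then have "Suc (k div n) = m" using i by simp
      then have "x * v k = x ^ m * y ^ (k mod n)" by (auto simp: v_def)
      also have "\<dots> = (\<Sum>i<m. of_int (a i) * (x ^ i * y ^ (k mod n)))" by (simp add: m sum_distrib_right mult.assoc)
      also have "\<dots> \<in> ?G" using base j by (intro int_span_sum int_span_of_int_mult) auto
      finally show ?thesis .
    qed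
  qed
  have step_y: "y * v k \<in> ?G" if "k < m * n" for k
  proof -
    have i: "k div n < m" using that by (simp add: less_mult_imp_div_less)
    have j: "k mod n < n" using n by simp
    show ?thesis
    proof (cases "Suc (k mod n) < n")
      case True
      have "y * v k = x ^ (k div n) * y ^ Suc (k mod n)" by (simp add: v_def)
      then show ?thesis using base[OF i True] by (simp only:)
    next
      case False
      then have "Suc (k mod n) = n" using j by simp
      then have "y ^ n = y * y ^ (k mod n)" by (metis power_Suc)
      then have "y * v k = x ^ (k div n) * y ^ n" by (simp add: v_def)
      also have "\<dots> = (\<Sum>j<n. of_int (b j) * (x ^ (k div n) * y ^ j))" by (simp add: n sum_distrib_left mult_ac)
      also have "\<dots> \<in> ?G" using base i by (intro int_span_sum int_span_of_int_mult) auto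
      finally show ?thesis .
    qed
  qed
  have 0: "0 < m * n" "v 0 \<noteq> 0" using m n by (auto simp: v_def)
  show "algebraic_int (x + y)"
    by (rule algebraic_int_of_stable[of 0 "m * n" v, OF 0]) (simp add: distrib_right int_span_add step_x step_y)
  show "algebraic_int (x * y)"
    by (rule algebraic_int_of_stable[of 0 "m * n" v, OF 0]) (simp add: mult.assoc int_span_stable step_x step_y)
qed

lemma algebraic_int_sum_complex: "(\<And>i. i \<in> A \<Longrightarrow> algebraic_int (g i :: complex)) \<Longrightarrow> algebraic_int (sum g A)"
  by (induction A rule: infinite_finite_induct) (auto intro: algebraic_int_plus_times)

lemma algebraic_int_real_plus_times:
  assumes "algebraic_int (x :: real)" "algebraic_int y"
  shows "algebraic_int (x + y)" "algebraic_int (x * y)"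
proof -
  have "algebraic_int (complex_of_real x)" "algebraic_int (complex_of_real y)" using assms by auto
  from algebraic_int_plus_times[OF this]
  have "algebraic_int (complex_of_real (x + y))" "algebraic_int (complex_of_real (x * y))" by auto
  then show "algebraic_int (x + y)" "algebraic_int (x * y)" unfolding algebraic_int_of_real_iff .
qed

section \<open>Rational linear algebra and linear factors\<close>

lemma rat_family_card_le:
  fixes v w :: "nat \<Rightarrow> real"
  assumes indep: "\<And>q :: nat \<Rightarrow> rat. (\<Sum>i<k. of_rat (q i) * v i) = 0 \<Longrightarrow> \<forall>i<k. q i = 0"
    and span: "\<And>i. i < k \<Longrightarrow> \<exists>q :: nat \<Rightarrow> rat. v i = (\<Sum>j<n. of_rat (q j) * w j)"
  shows "k \<le> n"
proof -
  interpret vs: vector_space "\<lambda>(q :: rat) (x :: real). of_rat q * x"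
    by unfold_locales (simp_all add: algebra_simps of_rat_add of_rat_mult)
  \<comment> \<open>The dimension bound speaks about sets, so a repetition in the family has to be
    excluded before its image can be counted.\<close>
  have inj: "inj_on v {..<k}"
  proof (rule inj_onI, rule ccontr)
    fix i j assume ij: "i \<in> {..<k}" "j \<in> {..<k}" "v i = v j" "i \<noteq> j"
    define q :: "nat \<Rightarrow> rat" where "q p = (if p = i then 1 else 0) - (if p = j then 1 else 0)" for p
    have "(\<Sum>p<k. of_rat (q p) * v p) = (\<Sum>p<k. (if p = i then v p else 0) - (if p = j then v p else 0))"
      using ij by (intro sum.cong) (auto simp: q_def)
    also have "\<dots> = v i - v j" using ij by (simp add: sum_subtractf)
    finally have "\<forall>p<k. q p = 0" using indep ij by simp
    then show False using ij by (auto simp: q_def)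
  qed
  have "\<not> vs.dependent (v ` {..<k})"
  proof
    assume "vs.dependent (v ` {..<k})"
    then obtain t u where t: "finite t" "t \<subseteq> v ` {..<k}" "(\<Sum>x\<in>t. of_rat (u x) * x) = 0" "\<exists>x\<in>t. u x \<noteq> 0"
      unfolding vs.dependent_explicit by blast
    define q where "q i = (if v i \<in> t then u (v i) else 0)" for i
    have "(\<Sum>i<k. of_rat (q i) * v i) = (\<Sum>x\<in>v ` {..<k}. of_rat (if x \<in> t then u x else 0) * x)"
      unfolding sum.reindex[OF inj] q_def by simp
    also have "\<dots> = (\<Sum>x\<in>t. of_rat (u x) * x)"
      using t by (intro sum.mono_neutral_cong_right) auto
    finally have "\<forall>i<k. q i = 0" using indep t by simp
    moreover obtain i where "i < k" "v i \<in> t" "u (v i) \<noteq> 0" using t(2,4) by blast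
    ultimately show False by (auto simp: q_def)
  qed
  moreover have "v ` {..<k} \<subseteq> vs.span (w ` {..<n})"
  proof (rule image_subsetI)
    fix i assume "i \<in> {..<k}"
    then obtain q :: "nat \<Rightarrow> rat" where q: "v i = (\<Sum>j<n. of_rat (q j) * w j)" using span by auto
    show "v i \<in> vs.span (w ` {..<n})"
      unfolding q by (intro vs.span_sum vs.span_scale vs.span_base imageI)
  qed
  ultimately have "card (v ` {..<k}) \<le> card (w ` {..<n})" using vs.independent_span_bound by blast
  also have "\<dots> \<le> n" using card_image_le[of "{..<n}" w] by simp
  finally show ?thesis using card_image[OF inj] by simp
qed

lemma common_denominator:
  fixes q :: "nat \<Rightarrow> rat"
  obtains D :: int and c :: "nat \<Rightarrow> int" where "D \<noteq> 0" "\<And>i. i < k \<Longrightarrow> of_int D * q i = of_int (c i)"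
proof -
  define D where "D = (\<Prod>i<k. snd (quotient_of (q i)))"
  have D: "D \<noteq> 0" unfolding D_def using quotient_of_denom_pos' by (metis (no_types, lifting) less_irrefl prod_zero_iff finite_lessThan)
  have "\<exists>c::int. of_int D * q i = of_int c" if "i < k" for i
  proof -
    let ?a = "fst (quotient_of (q i))" and ?b = "snd (quotient_of (q i))"
    have b: "?b \<noteq> 0" using quotient_of_denom_pos'[of "q i"] by simp
    have "q i = of_int ?a / of_int ?b" by (metis quotient_of_div prod.collapse)
    then have q: "of_int ?b * q i = of_int ?a" using b by (metis nonzero_mult_div_cancel_left of_int_eq_0_iff times_divide_eq_right)
    have "?b dvd D" unfolding D_def using that by (intro dvd_prodI) auto
    then obtain e where "D = ?b * e" by (elim dvdE)
    then have "of_int D * q i = of_int e * (of_int ?b * q i)" by (simp add: mult_ac)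
    also have "\<dots> = of_int (e * ?a)" unfolding q by simp
    finally show ?thesis by blast
  qed
  then have "\<forall>i. \<exists>c::int. i < k \<longrightarrow> of_int D * q i = of_int c" by blast
  from choice[OF this] obtain c where "\<And>i. i < k \<Longrightarrow> of_int D * q i = of_int (c i)" by blast
  then show ?thesis using that D by blast
qed

lemma prod_linear_poly:
  fixes A :: "complex set"
  assumes "finite A"
  shows "degree (\<Prod>z\<in>A. [:- z, 1:]) = card A \<and> lead_coeff (\<Prod>z\<in>A. [:- z, 1:]) = 1"
  using assms
proof (induction A rule: finite_induct)
  case (insert x A)
  then have "(\<Prod>z\<in>A. [:- z, 1:]) \<noteq> 0" by auto
  then have d1: "degree ([:- x, 1:] * (\<Prod>z\<in>A. [:- z, 1:])) = Suc (card A)"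
    using insert by (subst degree_mult_eq) auto
  have d2: "lead_coeff ([:- x, 1:] * (\<Prod>z\<in>A. [:- z, 1:])) = 1"
    unfolding lead_coeff_mult conjunct2[OF insert.IH] by simp
  show ?case
    unfolding prod.insert[OF insert(1,2)] card_insert_disjoint[OF insert(1,2)] by (intro conjI d1 d2)
qed simp

section \<open>Traces, and finiteness of sets of integers with bounded conjugates\<close>

context algebraic_real
begin

text \<open>For a conjugate \<open>w\<close> this is \<open>f\<close> divided by
  \<open>X - w\<close>, the unnormalised Lagrange interpolation polynomial at
  \<open>w\<close>.\<close>

definition cofactor_poly :: "complex \<Rightarrow> complex poly" where
  "cofactor_poly w = (\<Prod>z\<in>conjugates l - {w}. [:- z, 1:])"

lemma f_factorization:
  assumes "w \<in> conjugates l"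
  shows "map_poly of_rat f = [:- w, 1:] * cofactor_poly w"
proof -
  have "lead_coeff (map_poly of_rat f :: complex poly) = 1"
    using monic_f by (simp add: of_rat_hom.coeff_map_poly_hom of_rat_hom.degree_map_poly_hom)
  then have "map_poly of_rat f = (\<Prod>z\<in>conjugates l. [:- z, 1:])"
    using complex_poly_decompose_rsquarefree[OF rsquarefree_f] by (simp add: conjugates_eq rat_eval_def)
  also have "\<dots> = [:- w, 1:] * cofactor_poly w"
    unfolding cofactor_poly_def by (rule prod.remove[OF finite_conjugates assms])
  finally show ?thesis .
qed

lemma cofactor_poly_eval:
  assumes "w \<in> conjugates l" "z \<in> conjugates l"
  shows "poly (cofactor_poly w) z = 0 \<longleftrightarrow> z \<noteq> w"
  using assms finite_conjugates by (auto simp: cofactor_poly_def poly_prod)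

lemma cofactor_poly_degree:
  assumes "w \<in> conjugates l"
  shows "degree (cofactor_poly w) = d - 1" "coeff (cofactor_poly w) (d - 1) = 1"
  using prod_linear_poly[of "conjugates l - {w}"] finite_conjugates card_conjugates assms
  by (auto simp: cofactor_poly_def)

text \<open>By Lagrange interpolation the sum is the coefficient of degree \<open>d - 1\<close> of \<open>g f' mod f\<close>.\<close>

lemma sum_conjugates_rational: "(\<Sum>z\<in>conjugates l. rat_eval g z) \<in> \<rat>"
proof -
  let ?C = "conjugates l"
  define P where "P = (\<Sum>w\<in>?C. Polynomial.smult (rat_eval g w) (cofactor_poly w))"
  define r where "r = (g * pderiv f) mod f"
  have eval_P: "poly P z = rat_eval g z * poly (cofactor_poly z) z" if z: "z \<in> ?C" for z
  proof -
    have "poly P z = (\<Sum>w\<in>?C. rat_eval g w * poly (cofactor_poly w) z)" by (simp add: P_def poly_sum)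
    also have "\<dots> = (\<Sum>w\<in>?C. if w = z then rat_eval g z * poly (cofactor_poly z) z else 0)"
      using cofactor_poly_eval z by (intro sum.cong) auto
    finally show ?thesis using z finite_conjugates by simp
  qed
  have eval_r: "poly (map_poly of_rat r) z = rat_eval g z * poly (cofactor_poly z) z" if z: "z \<in> ?C" for z
  proof -
    have fz: "rat_eval f z = 0" using z by (simp add: conjugates_eq)
    have "rat_eval (pderiv f) z = poly (pderiv (map_poly of_rat f)) z"
      by (simp add: rat_eval_def of_rat_hom.map_poly_pderiv)
    also have "\<dots> = poly (cofactor_poly z) z"
      unfolding f_factorization[OF z] pderiv_mult by (simp add: pderiv_pCons)
    finally have "rat_eval (g * pderiv f) z = rat_eval g z * poly (cofactor_poly z) z" by (simp add: rat_eval_mult)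
    moreover have "rat_eval (g * pderiv f) z = rat_eval f z * rat_eval (g * pderiv f div f) z + rat_eval r z"
      unfolding r_def by (metis mult_div_mod_eq rat_eval_add rat_eval_mult)
    ultimately show ?thesis using fz by (simp add: rat_eval_def)
  qed
  have deg_r: "degree r < d"
    using degree_mod_less[OF f_nonzero, of "g * pderiv f"] d_pos by (auto simp: r_def d_def)
  have "P = map_poly of_rat r"
  proof (rule poly_eqI_degree[of ?C])
    show "poly P z = poly (map_poly of_rat r) z" if "z \<in> ?C" for z using eval_P eval_r that by simp
    have "degree P \<le> d - 1" unfolding P_def
      by (rule degree_sum_le) (use finite_conjugates cofactor_poly_degree in \<open>auto intro: le_trans[OF degree_smult_le]\<close>)
    then show "degree P < card ?C" using card_conjugates d_pos by simp
    show "degree (map_poly of_rat r :: complex poly) < card ?C"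
      using deg_r card_conjugates by (simp add: of_rat_hom.degree_map_poly_hom)
  qed
  moreover have "coeff P (d - 1) = (\<Sum>z\<in>?C. rat_eval g z)"
    unfolding P_def coeff_sum using cofactor_poly_degree by (intro sum.cong) auto
  ultimately have "(\<Sum>z\<in>?C. rat_eval g z) = of_rat (coeff r (d - 1))" by (simp add: of_rat_hom.coeff_map_poly_hom)
  then show ?thesis by simp
qed

definition Tr :: "real \<Rightarrow> complex" where "Tr x = (\<Sum>\<sigma>\<in>E. \<sigma> x)"

lemma Tr_rational:
  assumes "x \<in> K"
  shows "Tr x \<in> \<rat>"
proof -
  obtain g where g: "x = rat_eval g l" using assms by (auto simp: K_eq)
  have "Tr x = (\<Sum>\<sigma>\<in>E. rat_eval g (\<sigma> l))"
    unfolding Tr_def g using emb_rat_eval[OF _ l_in_K] by (intro sum.cong) auto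
  also have "\<dots> = (\<Sum>z\<in>conjugates l. rat_eval g z)" by (rule sum.reindex_bij_betw[OF emb_bij])
  finally show ?thesis using sum_conjugates_rational by simp
qed

lemma OK_D: "x \<in> OK \<Longrightarrow> x \<in> K" "x \<in> OK \<Longrightarrow> algebraic_int x"
  by (auto simp: OK_def ring_of_integers_def)

lemma OK_I: "x \<in> K \<Longrightarrow> algebraic_int x \<Longrightarrow> x \<in> OK"
  by (auto simp: OK_def ring_of_integers_def)

lemma OK_add: "x \<in> OK \<Longrightarrow> y \<in> OK \<Longrightarrow> x + y \<in> OK"
  and OK_mult: "x \<in> OK \<Longrightarrow> y \<in> OK \<Longrightarrow> x * y \<in> OK"
  and OK_uminus: "x \<in> OK \<Longrightarrow> - x \<in> OK"
  using OK_D[of x] OK_D[of y] by (auto intro!: OK_I K_add K_mult K_uminus algebraic_int_real_plus_times)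

lemma OK_diff: "x \<in> OK \<Longrightarrow> y \<in> OK \<Longrightarrow> x - y \<in> OK"
  using OK_add[OF _ OK_uminus] by force

lemma l_in_OK: "l \<in> OK" using l_in_K alg by (rule OK_I)

lemma of_int_in_OK: "of_int k \<in> OK"
  by (rule OK_I[OF of_int_in_K]) (simp add: int_imp_algebraic_int)

lemma OK_power: "x \<in> OK \<Longrightarrow> x ^ n \<in> OK"
  using of_int_in_OK[of 1] by (induction n) (auto intro: OK_mult)

lemma OK_subgroup: "additive_subgroup OK"
  using of_int_in_OK[of 0] by (auto simp: additive_subgroup_def OK_add OK_uminus)

lemma Tr_OK:
  assumes "x \<in> OK"
  shows "Tr x \<in> \<int>"
proof (rule rational_algebraic_int_is_int)
  show "algebraic_int (Tr x)" unfolding Tr_def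
    using assms OK_D by (intro algebraic_int_sum_complex emb_algebraic_int) auto
  show "Tr x \<in> \<rat>" using assms OK_D by (intro Tr_rational) auto
qed

text \<open>Non-vanishing of the Vandermonde determinant of the conjugates. Combining the relations
  with the coefficients of \<open>cofactor_poly (\<tau> l)\<close>, which vanishes at all conjugates
  but \<open>\<tau> l\<close>, isolates \<open>u \<tau>\<close>.\<close>

lemma emb_nondegenerate:
  assumes zero: "\<And>j. j < d \<Longrightarrow> (\<Sum>\<sigma>\<in>E. u \<sigma> * \<sigma> l ^ j) = 0" and \<tau>: "\<tau> \<in> E"
  shows "u \<tau> = 0"
proof -
  let ?Q = "cofactor_poly (\<tau> l)"
  note \<tau>C = emb_conjugate[OF \<tau>]
  have ev: "poly ?Q z = (\<Sum>j<d. coeff ?Q j * z ^ j)" for z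
    unfolding poly_altdef cofactor_poly_degree[OF \<tau>C] using d_pos by (intro sum.cong) auto
  have "(\<Sum>\<sigma>\<in>E. u \<sigma> * poly ?Q (\<sigma> l)) = (\<Sum>\<sigma>\<in>E. \<Sum>j<d. coeff ?Q j * (u \<sigma> * \<sigma> l ^ j))"
    by (simp add: ev sum_distrib_left mult_ac)
  also have "\<dots> = (\<Sum>j<d. coeff ?Q j * (\<Sum>\<sigma>\<in>E. u \<sigma> * \<sigma> l ^ j))"
    by (subst sum.swap) (simp add: sum_distrib_left)
  also have "\<dots> = 0" using zero by simp
  finally have "(\<Sum>\<sigma>\<in>E. u \<sigma> * poly ?Q (\<sigma> l)) = 0" .
  moreover have "(\<Sum>\<sigma>\<in>E. u \<sigma> * poly ?Q (\<sigma> l)) = (\<Sum>\<sigma>\<in>E. if \<sigma> = \<tau> then u \<tau> * poly ?Q (\<tau> l) else 0)"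
  proof (intro sum.cong refl)
    fix \<sigma> assume s: "\<sigma> \<in> E"
    show "u \<sigma> * poly ?Q (\<sigma> l) = (if \<sigma> = \<tau> then u \<tau> * poly ?Q (\<tau> l) else 0)"
      using cofactor_poly_eval[OF \<tau>C emb_conjugate[OF s]] inj_onD[OF emb_inj _ s \<tau>] by auto
  qed
  ultimately have "u \<tau> * poly ?Q (\<tau> l) = 0" using finite_E \<tau> by simp
  then show ?thesis using cofactor_poly_eval[OF \<tau>C \<tau>C] by simp
qed

text \<open>An element \<open>x\<close> is determined by the integers \<open>Tr (x l\<^sup>j)\<close> for \<open>j < d\<close>, which are bounded.\<close>

lemma finite_OK_bounded: "finite {x \<in> OK. \<forall>\<sigma>\<in>E. cmod (\<sigma> x) \<le> c}"
proof -
  let ?A = "{x \<in> OK. \<forall>\<sigma>\<in>E. cmod (\<sigma> x) \<le> c}"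
  define \<Phi> where "\<Phi> x = map (\<lambda>j. Tr (x * l ^ j)) [0..<d]" for x
  define N where "N = (\<Sum>j<d. \<Sum>\<sigma>\<in>E. \<bar>c\<bar> * cmod (\<sigma> l) ^ j)"
  define Z :: "complex set" where "Z = of_int ` {- \<lceil>N\<rceil>..\<lceil>N\<rceil>}"
  have mem: "Tr (x * l ^ j) \<in> Z" if x: "x \<in> ?A" and j: "j < d" for x j
  proof -
    have xO: "x \<in> OK" "x \<in> K" using x OK_D by auto
    have "Tr (x * l ^ j) \<in> \<int>" using xO OK_mult OK_power l_in_OK by (intro Tr_OK) auto
    then obtain k where k: "Tr (x * l ^ j) = of_int k" by (auto elim: Ints_cases)
    have "cmod (Tr (x * l ^ j)) \<le> (\<Sum>\<sigma>\<in>E. cmod (\<sigma> (x * l ^ j)))" unfolding Tr_def by (rule norm_sum)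
    also have "\<dots> \<le> (\<Sum>\<sigma>\<in>E. \<bar>c\<bar> * cmod (\<sigma> l) ^ j)"
    proof (rule sum_mono)
      fix \<sigma> assume s: "\<sigma> \<in> E"
      have "cmod (\<sigma> (x * l ^ j)) = cmod (\<sigma> x) * cmod (\<sigma> l) ^ j"
        using xO l_in_K K_power by (simp add: emb_mult[OF s] emb_power[OF s] norm_mult norm_power)
      also have "\<dots> \<le> \<bar>c\<bar> * cmod (\<sigma> l) ^ j" using x s by (intro mult_right_mono) force+
      finally show "cmod (\<sigma> (x * l ^ j)) \<le> \<bar>c\<bar> * cmod (\<sigma> l) ^ j" .
    qed
    also have "\<dots> \<le> N" unfolding N_def using j
      by (intro member_le_sum[of j "{..<d}" "\<lambda>j. \<Sum>\<sigma>\<in>E. \<bar>c\<bar> * cmod (\<sigma> l) ^ j"]) (auto intro!: sum_nonneg)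
    finally have "\<bar>of_int k\<bar> \<le> N" by (simp add: k)
    then have "\<bar>k\<bar> \<le> \<lceil>N\<rceil>" by (metis ceiling_mono ceiling_of_int of_int_abs)
    then have "k \<in> {- \<lceil>N\<rceil>..\<lceil>N\<rceil>}" by auto
    then show ?thesis unfolding k Z_def by (rule imageI)
  qed
  have "\<Phi> ` ?A \<subseteq> {xs. set xs \<subseteq> Z \<and> length xs = d}" using mem by (auto simp: \<Phi>_def)
  moreover have "finite {xs. set xs \<subseteq> Z \<and> length xs = d}" by (rule finite_lists_length_eq) (simp add: Z_def)
  ultimately have "finite (\<Phi> ` ?A)" by (rule finite_subset)
  moreover have "inj_on \<Phi> ?A"
  proof (rule inj_onI)
    fix x y assume xy: "x \<in> ?A" "y \<in> ?A" "\<Phi> x = \<Phi> y"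
    then have K: "x \<in> K" "y \<in> K" using OK_D by auto
    \<comment> \<open>Equality of the traces says that the numbers \<open>\<sigma> (x - y)\<close>,
      taken as coefficients, annihilate all powers of \<open>l\<close> below
      \<open>d\<close>.\<close>
    have "idE (x - y) = 0"
    proof (rule emb_nondegenerate[OF _ idE_in_E, of "\<lambda>\<sigma>. \<sigma> (x - y)"])
      fix j assume j: "j < d"
      have "Tr (x * l ^ j) = Tr (y * l ^ j)" using xy(3) j by (auto simp: \<Phi>_def)
      then have "(\<Sum>\<sigma>\<in>E. \<sigma> (x * l ^ j) - \<sigma> (y * l ^ j)) = 0" by (simp add: Tr_def sum_subtractf)
      moreover have "\<sigma> (x * l ^ j) - \<sigma> (y * l ^ j) = \<sigma> (x - y) * \<sigma> l ^ j" if "\<sigma> \<in> E" for \<sigma>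
        using K l_in_K K_power by (simp add: emb_mult[OF that] emb_power[OF that] emb_diff[OF that] algebra_simps)
      ultimately show "(\<Sum>\<sigma>\<in>E. \<sigma> (x - y) * \<sigma> l ^ j) = 0" by simp
    qed
    then show "x = y" using K_diff[OF K] by (simp add: idE_def)
  qed
  ultimately show ?thesis by (rule finite_imageD)
qed

text \<open>Otherwise the powers of \<open>x\<close> would be infinitely many integers with bounded conjugates.\<close>

lemma emb_ge_1:
  assumes x: "x \<in> OK" "x \<noteq> 0"
  shows "\<exists>\<sigma>\<in>E. cmod (\<sigma> x) \<ge> 1"
proof (rule ccontr)
  assume "\<not> ?thesis"
  then have lt: "\<And>\<sigma>. \<sigma> \<in> E \<Longrightarrow> cmod (\<sigma> x) < 1" by auto
  have xK: "x \<in> K" using OK_D x by auto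
  have x1: "\<bar>x\<bar> < 1" using lt[OF idE_in_E] xK by (simp add: idE_def)
  let ?A = "{x \<in> OK. \<forall>\<sigma>\<in>E. cmod (\<sigma> x) \<le> 1}"
  have "range (\<lambda>n. x ^ n) \<subseteq> ?A"
  proof (intro image_subsetI CollectI conjI ballI)
    fix n \<sigma> assume s: "\<sigma> \<in> E"
    have "cmod (\<sigma> x) ^ n \<le> 1" using lt[OF s] by (intro power_le_one) auto
    then show "cmod (\<sigma> (x ^ n)) \<le> 1" by (simp add: emb_power[OF s xK] norm_power)
  qed (rule OK_power[OF x(1)])
  then have "finite (range (\<lambda>n. x ^ n))" using finite_OK_bounded finite_subset by blast
  moreover have "inj (\<lambda>n. x ^ n)"
  proof (rule injI)
    fix m n assume "x ^ m = x ^ n"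
    then have e: "\<bar>x\<bar> ^ m = \<bar>x\<bar> ^ n" by (metis power_abs)
    show "m = n"
    proof (rule ccontr)
      assume "m \<noteq> n"
      then consider "m < n" | "n < m" by linarith
      then show False
      proof cases
        case 1
        then show False using power_strict_decreasing[of m n "\<bar>x\<bar>"] x1 x(2) e by simp
      next
        case 2
        then show False using power_strict_decreasing[of n m "\<bar>x\<bar>"] x1 x(2) e by simp
      qed
    qed
  qed
  ultimately show False using finite_imageD[of "\<lambda>n. x ^ n" UNIV] infinite_UNIV_nat by blast
qed

section \<open>The rank of the ring of integers\<close>

lemma K_rational_coordinates:
  assumes "x \<in> K"
  shows "\<exists>q :: nat \<Rightarrow> rat. x = (\<Sum>j<d. of_rat (q j) * l ^ j)"
proof -
  obtain p where p: "x = rat_eval p l" using assms by (auto simp: K_eq)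
  define r where "r = p mod f"
  have "rat_eval p l = rat_eval f l * rat_eval (p div f) l + rat_eval r l"
    unfolding r_def by (metis mult_div_mod_eq rat_eval_add rat_eval_mult)
  then have x: "x = rat_eval r l" using p f_l by simp
  have deg: "degree r < d" using degree_mod_less[OF f_nonzero, of p] d_pos by (auto simp: r_def d_def)
  have "rat_eval r l = (\<Sum>j\<le>degree r. of_rat (coeff r j) * l ^ j)"
    by (simp add: rat_eval_def poly_altdef of_rat_hom.degree_map_poly_hom of_rat_hom.coeff_map_poly_hom)
  also have "\<dots> = (\<Sum>j<d. of_rat (coeff r j) * l ^ j)"
    using deg by (intro sum.mono_neutral_left) (auto simp: coeff_eq_0)
  finally show ?thesis using x by blast
qed

lemma powers_independent:
  fixes q :: "nat \<Rightarrow> rat"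
  assumes "(\<Sum>j<d. of_rat (q j) * l ^ j) = 0"
  shows "\<forall>j<d. q j = 0"
proof -
  define p where "p = (\<Sum>j<d. monom (q j) j)"
  have "rat_eval p l = (\<Sum>j<d. of_rat (q j) * l ^ j)"
    unfolding p_def rat_eval_sum by (simp add: rat_eval_def of_rat_hom.map_poly_hom_monom poly_monom)
  then have "f dvd p" using assms dvd_iff_root[OF f_l] by simp
  moreover have "degree p < degree f"
  proof -
    have "degree p \<le> d - 1" unfolding p_def by (rule degree_sum_le) (auto intro: le_trans[OF degree_monom_le])
    then show ?thesis using d_pos by (simp add: d_def)
  qed
  ultimately have "p = 0" by (metis dvd_imp_degree_le not_less)
  then have "coeff p j = 0" for j by simp
  moreover have "coeff p j = q j" if "j < d" for j
    using that by (simp add: p_def coeff_sum)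
  ultimately show ?thesis by metis
qed

text \<open>Clearing denominators turns a rational relation into an integral one, so the dimension
  of \<open>K\<close> over the rationals bounds families that are only known to be independent over
  the integers.\<close>

lemma independent_family_le_d:
  assumes b: "\<And>i. i < k \<Longrightarrow> b i \<in> K"
    and indep: "\<And>c :: nat \<Rightarrow> int. (\<Sum>i<k. of_int (c i) * b i) = 0 \<Longrightarrow> \<forall>i<k. c i = 0"
  shows "k \<le> d"
proof (rule rat_family_card_le)
  fix q :: "nat \<Rightarrow> rat" assume q: "(\<Sum>i<k. of_rat (q i) * b i) = 0"
  obtain D :: int and c :: "nat \<Rightarrow> int" where D: "D \<noteq> 0" and c: "\<And>i. i < k \<Longrightarrow> of_int D * q i = of_int (c i)"
    using common_denominator[of k q] by blast
  have c': "of_int (c i) = of_int D * real_of_rat (q i)" if "i < k" for i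
    using c[OF that] by (metis of_rat_mult of_rat_of_int_eq)
  have "(\<Sum>i<k. of_int (c i) * b i) = of_int D * (\<Sum>i<k. of_rat (q i) * b i)"
    unfolding sum_distrib_left by (intro sum.cong) (auto simp: c')
  then have "\<forall>i<k. c i = 0" using indep q by simp
  then show "\<forall>i<k. q i = 0" using c D by auto
qed (rule K_rational_coordinates[OF b])

text \<open>The powers of \<open>l\<close> below \<open>d\<close> are independent elements of
  \<open>OK\<close>. Together with \<open>independent_family_le_d\<close> this fixes the length of a
  full reduced flag.\<close>

lemma spanning_family_ge_d:
  assumes "\<And>x. x \<in> OK \<Longrightarrow> \<exists>c :: nat \<Rightarrow> int. x = (\<Sum>i<n. of_int (c i) * b i)"
  shows "d \<le> n"
proof (rule rat_family_card_le[where k = d and n = n and v = "\<lambda>j. l ^ j" and w = b])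
  fix j assume "j < d"
  obtain c :: "nat \<Rightarrow> int" where "l ^ j = (\<Sum>i<n. of_int (c i) * b i)" using assms OK_power l_in_OK by blast
  then have "l ^ j = (\<Sum>i<n. of_rat (of_int (c i)) * b i)" by simp
  then show "\<exists>q :: nat \<Rightarrow> rat. l ^ j = (\<Sum>i<n. of_rat (q i) * b i)" by (rule exI[where x = "\<lambda>i. of_int (c i)"])
qed (use powers_independent in blast)

end

section \<open>Trace forms and reduced integral bases\<close>

lemma Re_mult_cnj_self: "Re (u * cnj u) = (cmod u)\<^sup>2"
  unfolding cmod_power2 by (simp add: power2_eq_square)

section \<open>Weighted forms on the ring of integers\<close>

context algebraic_real
begin

definition tform :: "((real \<Rightarrow> complex) \<Rightarrow> real) \<Rightarrow> real \<Rightarrow> real \<Rightarrow> real" where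
  "tform \<alpha> x y = (\<Sum>\<sigma>\<in>E. \<alpha> \<sigma> * Re (\<sigma> x * cnj (\<sigma> y)))"

definition reduced_basis :: "((real \<Rightarrow> complex) \<Rightarrow> real) \<Rightarrow> real \<Rightarrow> (nat \<Rightarrow> real) \<Rightarrow> (nat \<Rightarrow> real) \<Rightarrow>
    (nat \<Rightarrow> real \<Rightarrow> real) \<Rightarrow> bool" where
  "reduced_basis \<alpha> m b g c \<longleftrightarrow> reduced_flag OK (tform \<alpha>) m d b g c \<and>
    (\<forall>x\<in>OK. \<exists>n :: nat \<Rightarrow> int. x = (\<Sum>i<d. of_int (n i) * b i)) \<and>
    (\<forall>x\<in>OK. \<forall>y\<in>OK. tform \<alpha> x y = (\<Sum>i<d. (g i)\<^sup>2 * c i x * c i y))"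

lemma reduced_basisD:
  assumes "reduced_basis \<alpha> m b g c"
  shows "reduced_flag OK (tform \<alpha>) m d b g c"
    and "\<forall>x\<in>OK. \<exists>n :: nat \<Rightarrow> int. x = (\<Sum>i<d. of_int (n i) * b i)"
    and "\<forall>x\<in>OK. \<forall>y\<in>OK. tform \<alpha> x y = (\<Sum>i<d. (g i)\<^sup>2 * c i x * c i y)"
  using assms unfolding reduced_basis_def by blast+

lemma tform_self: "tform \<alpha> x x = (\<Sum>\<sigma>\<in>E. \<alpha> \<sigma> * (cmod (\<sigma> x))\<^sup>2)"
  unfolding tform_def Re_mult_cnj_self ..

text \<open>Translates between the covering condition on embedded vectors and the formal expression
  in \<open>covers\<close>.\<close>

lemma tform_expand:
  "(\<Sum>\<sigma>\<in>E. \<alpha> \<sigma> * (cmod (of_real s * \<sigma> x - \<sigma> y))\<^sup>2) = s\<^sup>2 * tform \<alpha> x x - 2 * s * tform \<alpha> x y + tform \<alpha> y y"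
proof -
  have e: "(cmod (of_real s * u - v))\<^sup>2 = s\<^sup>2 * Re (u * cnj u) - 2 * s * Re (u * cnj v) + Re (v * cnj v)" for u v :: complex
    unfolding cmod_power2 by (simp add: power2_eq_square algebra_simps)
  show ?thesis
    unfolding tform_def e sum_distrib_left sum_subtractf[symmetric] sum.distrib[symmetric]
    by (intro sum.cong refl) (simp add: algebra_simps)
qed

lemma tform_qform: "qform K \<alpha> (minkowski K x) (minkowski K y) = tform \<alpha> x y"
  by (simp add: qform_def tform_def minkowski_def E_def)

context
  fixes \<alpha> :: "(real \<Rightarrow> complex) \<Rightarrow> real"
  assumes \<alpha>: "\<And>\<sigma>. \<sigma> \<in> E \<Longrightarrow> \<alpha> \<sigma> > 0"
begin

lemma tform_psd: "psd_form OK (tform \<alpha>)"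
  unfolding psd_form_def
proof (intro conjI ballI)
  fix x y
  have "Re (u * cnj v) = Re (v * cnj u)" for u v :: complex by simp
  then show "tform \<alpha> x y = tform \<alpha> y x" unfolding tform_def by (intro sum.cong refl) metis
next
  fix x y z assume "x \<in> OK" "y \<in> OK" "z \<in> OK"
  then show "tform \<alpha> (x + y) z = tform \<alpha> x z + tform \<alpha> y z"
    unfolding tform_def sum.distrib[symmetric] using OK_D
    by (intro sum.cong refl) (simp add: emb_add algebra_simps)
next
  fix x show "tform \<alpha> x x \<ge> 0" unfolding tform_self using \<alpha> by (auto intro!: sum_nonneg simp: less_imp_le)
qed

lemma weight_lower_bound: "\<exists>a>0. \<forall>\<sigma>\<in>E. a \<le> \<alpha> \<sigma>"
proof -
  have "E \<noteq> {}" using idE_in_E by auto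
  then have "Min (\<alpha> ` E) > 0" "\<forall>\<sigma>\<in>E. Min (\<alpha> ` E) \<le> \<alpha> \<sigma>" using finite_E \<alpha> by auto
  then show ?thesis by blast
qed

lemma emb_sq_le_tform: "\<sigma> \<in> E \<Longrightarrow> \<alpha> \<sigma> * (cmod (\<sigma> x))\<^sup>2 \<le> tform \<alpha> x x"
  unfolding tform_self using \<alpha>
  by (intro member_le_sum[OF _ _ finite_E, of _ "\<lambda>\<sigma>. \<alpha> \<sigma> * (cmod (\<sigma> x))\<^sup>2"]) (auto simp: less_imp_le)

lemma tform_finite: "finite {x \<in> OK. tform \<alpha> x x \<le> c}"
proof -
  obtain a where a: "a > 0" "\<And>\<sigma>. \<sigma> \<in> E \<Longrightarrow> a \<le> \<alpha> \<sigma>" using weight_lower_bound by blast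
  have "{x \<in> OK. tform \<alpha> x x \<le> c} \<subseteq> {x \<in> OK. \<forall>\<sigma>\<in>E. cmod (\<sigma> x) \<le> 1 + c / a}"
  proof (intro subsetI CollectI conjI ballI)
    fix x \<sigma> assume x: "x \<in> {x \<in> OK. tform \<alpha> x x \<le> c}" and s: "\<sigma> \<in> E"
    have "a * (cmod (\<sigma> x))\<^sup>2 \<le> \<alpha> \<sigma> * (cmod (\<sigma> x))\<^sup>2" using a s by (intro mult_right_mono) auto
    also have "\<dots> \<le> c" using emb_sq_le_tform[OF s, of x] x by auto
    finally have le: "(cmod (\<sigma> x))\<^sup>2 \<le> c / a" using a by (simp add: field_simps)
    have "2 * cmod (\<sigma> x) \<le> 1 + (cmod (\<sigma> x))\<^sup>2"
      using zero_le_power2[of "cmod (\<sigma> x) - 1"] by (simp add: power2_eq_square algebra_simps)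
    then have "cmod (\<sigma> x) \<le> 1 + (cmod (\<sigma> x))\<^sup>2" using norm_ge_zero[of "\<sigma> x"] by linarith
    then show "cmod (\<sigma> x) \<le> 1 + c / a" using le by simp
  qed auto
  then show ?thesis using finite_OK_bounded finite_subset by blast
qed

lemma tform_lower:
  assumes "\<And>\<sigma>. \<sigma> \<in> E \<Longrightarrow> m \<le> \<alpha> \<sigma>" and m: "m > 0" and x: "x \<in> OK" "x \<noteq> 0"
  shows "m \<le> tform \<alpha> x x"
proof -
  obtain \<sigma> where s: "\<sigma> \<in> E" "1 \<le> cmod (\<sigma> x)" using emb_ge_1[OF x] by blast
  have "m * 1 \<le> \<alpha> \<sigma> * (cmod (\<sigma> x))\<^sup>2"
    using assms(1)[OF s(1)] m s by (intro mult_mono) auto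
  then show ?thesis using emb_sq_le_tform[OF s(1), of x] by simp
qed

lemma exists_reduced_integral_basis:
  assumes m: "\<And>\<sigma>. \<sigma> \<in> E \<Longrightarrow> m \<le> \<alpha> \<sigma>" "m > 0"
  shows "\<exists>b g c. reduced_basis \<alpha> m b g c"
proof -
  have "\<exists>n b g c. n \<le> d \<and> reduced_flag OK (tform \<alpha>) m n b g c \<and>
    (\<forall>x\<in>OK. \<exists>e :: nat \<Rightarrow> int. x = (\<Sum>i<n. of_int (e i) * b i)) \<and>
    (\<forall>x\<in>OK. \<forall>y\<in>OK. tform \<alpha> x y = (\<Sum>i<n. (g i)\<^sup>2 * c i x * c i y))"
  proof (rule exists_reduced_flag[OF OK_subgroup tform_psd m(2) tform_finite])
    fix x assume "x \<in> OK" "x \<noteq> 0"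
    then show "m \<le> tform \<alpha> x x" using m by (intro tform_lower) auto
  next
    fix k b
    assume "\<And>i. i < k \<Longrightarrow> b i \<in> OK" and "\<And>c :: nat \<Rightarrow> int. (\<Sum>i<k. of_int (c i) * b i) = 0 \<Longrightarrow> \<forall>i<k. c i = 0"
    then show "k \<le> d" using OK_D(1) by (intro independent_family_le_d[of k b]) auto
  qed
  then obtain n b g c where n: "n \<le> d" and flag: "reduced_flag OK (tform \<alpha>) m n b g c"
    and span: "\<forall>x\<in>OK. \<exists>e :: nat \<Rightarrow> int. x = (\<Sum>i<n. of_int (e i) * b i)"
    and dec: "\<forall>x\<in>OK. \<forall>y\<in>OK. tform \<alpha> x y = (\<Sum>i<n. (g i)\<^sup>2 * c i x * c i y)" by blast
  have "d \<le> n" by (rule spanning_family_ge_d[where n = n and b = b]) (use span in blast)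
  then have "n = d" using n by simp
  then show ?thesis using flag span dec unfolding reduced_basis_def by blast
qed

end

section \<open>Integral bases and Gram determinants\<close>

lemma integral_basis_iff:
  "integral_basis K b \<longleftrightarrow> (\<forall>j<d. b j \<in> OK) \<and> (\<forall>x\<in>OK. \<exists>!n :: nat \<Rightarrow> int. (\<forall>j\<ge>d. n j = 0) \<and> x = (\<Sum>j<d. of_int (n j) * b j))"
  by (simp add: integral_basis_def field_degree_eq OK_def)

lemma integral_basisD:
  assumes "integral_basis K b"
  shows "\<And>i. i < d \<Longrightarrow> b i \<in> OK"
    and "\<And>x. x \<in> OK \<Longrightarrow> \<exists>n :: nat \<Rightarrow> int. x = (\<Sum>i<d. of_int (n i) * b i)"
    and "\<And>n :: nat \<Rightarrow> int. (\<Sum>i<d. of_int (n i) * b i) = 0 \<Longrightarrow> \<forall>i<d. n i = 0"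
proof -
  show "\<And>i. i < d \<Longrightarrow> b i \<in> OK" using assms by (simp add: integral_basis_iff)
  show "\<And>x. x \<in> OK \<Longrightarrow> \<exists>n :: nat \<Rightarrow> int. x = (\<Sum>i<d. of_int (n i) * b i)"
    using assms unfolding integral_basis_iff by blast
  fix n :: "nat \<Rightarrow> int" assume n: "(\<Sum>i<d. of_int (n i) * b i) = 0"
  define P where "P n \<longleftrightarrow> (\<forall>j\<ge>d. n j = 0) \<and> 0 = (\<Sum>j<d. of_int (n j) * b j)" for n :: "nat \<Rightarrow> int"
  have "\<exists>!n. P n" unfolding P_def
    by (rule bspec[OF conjunct2[OF assms[unfolded integral_basis_iff]] of_int_in_OK[of 0, simplified]])
  then obtain n0 where n0: "\<And>n'. P n' \<Longrightarrow> n' = n0" by (elim ex1E) blast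
  \<comment> \<open>Uniqueness in \<open>integral_basis\<close> concerns coefficient functions that
    vanish from \<open>d\<close> on, so the given coefficients are truncated before they are
    compared with zero.\<close>
  have p: "P (\<lambda>j. if j < d then n j else 0)" "P (\<lambda>j. 0)" using n by (simp_all add: P_def)
  show "\<forall>i<d. n i = 0"
  proof (intro allI impI)
    fix i assume "i < d"
    then show "n i = 0" using fun_cong[OF trans[OF n0[OF p(1)] sym[OF n0[OF p(2)]]], of i] by simp
  qed
qed

lemma reduced_basis_integral:
  assumes rb: "reduced_basis \<alpha> m b g c"
  shows "integral_basis K b"
  unfolding integral_basis_iff
proof (intro conjI ballI allI impI)
  fix x assume "x \<in> OK"
  then obtain n :: "nat \<Rightarrow> int" where n: "x = (\<Sum>i<d. of_int (n i) * b i)" using reduced_basisD(2)[OF rb] by blast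
  show "\<exists>!n :: nat \<Rightarrow> int. (\<forall>j\<ge>d. n j = 0) \<and> x = (\<Sum>j<d. of_int (n j) * b j)"
  proof (rule ex1I[of _ "\<lambda>j. if j < d then n j else 0"])
    fix n' :: "nat \<Rightarrow> int" assume n': "(\<forall>j\<ge>d. n' j = 0) \<and> x = (\<Sum>j<d. of_int (n' j) * b j)"
    have "(\<Sum>j<d. of_int (n' j - n j) * b j) = 0" using n n' by (simp add: algebra_simps sum_subtractf)
    then have "n' j - n j = 0" if "j < d" for j by (rule reduced_flag_independent[OF OK_subgroup reduced_basisD(1)[OF rb] _ that])
    then show "n' = (\<lambda>j. if j < d then n j else 0)" using n' by (intro ext) (simp add: not_less)
  qed (simp add: n)
qed (use reduced_basisD(1)[OF rb] in \<open>auto simp: reduced_flag_def\<close>)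

text \<open>Both bases are integral combinations of each other, so the transition matrix is
  invertible over the integers and its determinant is a unit.\<close>

lemma base_change_det:
  assumes b: "integral_basis K b" and w: "integral_basis K w"
  obtains C :: "int mat" where "C \<in> carrier_mat d d" "(det C)\<^sup>2 = 1"
    "\<And>j. j < d \<Longrightarrow> w j = (\<Sum>i<d. of_int (C $$ (i, j)) * b i)"
proof -
  have ex: "\<exists>C :: nat \<Rightarrow> nat \<Rightarrow> int. \<forall>j<d. u j = (\<Sum>i<d. of_int (C i j) * v i)"
    if u: "integral_basis K u" and v: "integral_basis K v" for u v
  proof -
    have "\<forall>j. \<exists>n :: nat \<Rightarrow> int. j < d \<longrightarrow> u j = (\<Sum>i<d. of_int (n i) * v i)"
      using integral_basisD(1)[OF u] integral_basisD(2)[OF v] by blast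
    from choice[OF this] obtain n :: "nat \<Rightarrow> nat \<Rightarrow> int" where "\<forall>j. j < d \<longrightarrow> u j = (\<Sum>i<d. of_int (n j i) * v i)" by blast
    then show ?thesis by (intro exI[of _ "\<lambda>i j. n j i"]) simp
  qed
  obtain C :: "nat \<Rightarrow> nat \<Rightarrow> int" where C: "\<forall>j<d. w j = (\<Sum>i<d. of_int (C i j) * b i)" using ex[OF w b] by blast
  obtain C' :: "nat \<Rightarrow> nat \<Rightarrow> int" where C': "\<forall>j<d. b j = (\<Sum>i<d. of_int (C' i j) * w i)" using ex[OF b w] by blast
  have one: "(\<Sum>j<d. C i j * C' j k) = (if i = k then 1 else 0)" if k: "k < d" "i < d" for i k
  proof -
    have "b k = (\<Sum>j<d. of_int (C' j k) * w j)" using C' k by blast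
    also have "\<dots> = (\<Sum>j<d. of_int (C' j k) * (\<Sum>i<d. of_int (C i j) * b i))" using C by (intro sum.cong refl) simp
    also have "\<dots> = (\<Sum>j<d. \<Sum>i<d. of_int (C i j * C' j k) * b i)" by (simp add: sum_distrib_left mult_ac)
    also have "\<dots> = (\<Sum>i<d. of_int (\<Sum>j<d. C i j * C' j k) * b i)"
      by (subst sum.swap) (simp add: sum_distrib_right)
    finally have "(\<Sum>i<d. of_int (\<Sum>j<d. C i j * C' j k) * b i) - b k = 0" by simp
    moreover have "b k = (\<Sum>i<d. of_int (if i = k then 1 else 0) * b i)"
      using k by (simp add: if_distrib[of of_int] if_distrib[of "\<lambda>x. x * _"] cong: if_cong)
    ultimately have "(\<Sum>i<d. of_int ((\<Sum>j<d. C i j * C' j k) - (if i = k then 1 else 0)) * b i) = 0"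
      unfolding of_int_diff left_diff_distrib sum_subtractf by simp
    from integral_basisD(3)[OF b this] have "(\<Sum>j<d. C i j * C' j k) - (if i = k then 1 else 0) = 0" using k by blast
    then show ?thesis by simp
  qed
  define M where "M = mat d d (\<lambda>(i, j). C i j)"
  define M' where "M' = mat d d (\<lambda>(i, j). C' i j)"
  have car: "M \<in> carrier_mat d d" "M' \<in> carrier_mat d d" by (auto simp: M_def M'_def)
  have "M * M' = 1\<^sub>m d"
    by (rule eq_matI) (auto simp: M_def M'_def scalar_prod_def atLeast0LessThan one)
  then have "det M * det M' = 1" using det_mult[OF car] by simp
  then have "det M = 1 \<or> det M = -1" using zmult_eq_1_iff by blast
  then have "(det M)\<^sup>2 = 1" by auto
  then show ?thesis using that[of M] car C by (simp add: M_def)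
qed

text \<open>The Gram matrix factors as the transpose of \<open>W\<close> times \<open>G * W\<close>,
  with \<open>G\<close> diagonal with entries the squares of the \<open>g i\<close> and
  \<open>W\<close> the Gram-Schmidt coordinates of the basis \<open>w\<close>. Here \<open>W\<close>
  is a unitriangular matrix times a unimodular one, so the square of its determinant is 1 for every
  integral basis.\<close>

lemma gram_det_reduced:
  assumes rb: "reduced_basis \<alpha> m b g c"
    and w: "integral_basis K w"
  shows "det (mat d d (\<lambda>(i, j). tform \<alpha> (w i) (w j))) = (\<Prod>i<d. g i)\<^sup>2"
proof -
  note fl = reduced_basisD(1)[OF rb]
    and dec = reduced_basisD(3)[OF rb]
  have b: "integral_basis K b" by (rule reduced_basis_integral[OF rb])
  obtain C :: "int mat" where C: "C \<in> carrier_mat d d" "(det C)\<^sup>2 = 1"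
    "\<And>j. j < d \<Longrightarrow> w j = (\<Sum>i<d. of_int (C $$ (i, j)) * b i)" using base_change_det[OF b w] by blast
  have bO: "\<And>i. i < d \<Longrightarrow> b i \<in> OK" and wO: "\<And>i. i < d \<Longrightarrow> w i \<in> OK"
    using integral_basisD(1)[OF b] integral_basisD(1)[OF w] by auto
  have add: "c i (x + y) = c i x + c i y" if "i < d" "x \<in> OK" "y \<in> OK" for i x y
    using fl that by (auto simp: reduced_flag_def)
  define T where "T = mat d d (\<lambda>(i, j). c i (b j))"
  define G where "G = mat d d (\<lambda>(i, j). if i = j then (g i)\<^sup>2 else 0)"
  define W where "W = mat d d (\<lambda>(i, j). c i (w j))"
  have car: "T \<in> carrier_mat d d" "G \<in> carrier_mat d d" "W \<in> carrier_mat d d" by (auto simp: T_def G_def W_def)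
  have cw: "c i (w j) = (\<Sum>k<d. c i (b k) * of_int (C $$ (k, j)))" if ij: "i < d" "j < d" for i j
  proof -
    have "c i (w j) = (\<Sum>k<d. c i (of_int (C $$ (k, j)) * b k))"
      unfolding C(3)[OF ij(2)]
      by (rule additive_on_sum[OF OK_subgroup]) (use ij bO add additive_subgroup_of_int_mult[OF OK_subgroup] in auto)
    also have "\<dots> = (\<Sum>k<d. c i (b k) * of_int (C $$ (k, j)))"
      by (intro sum.cong refl, subst additive_on_of_int[OF OK_subgroup]) (use ij bO add in auto)
    finally show ?thesis .
  qed
  have WT: "W = T * map_mat of_int C"
    by (rule eq_matI) (use C(1) cw in \<open>auto simp: W_def T_def scalar_prod_def atLeast0LessThan\<close>)
  have "det T = prod_list (diag_mat T)"
    by (rule det_upper_triangular[OF _ car(1)]) (use fl in \<open>auto simp: T_def reduced_flag_def intro!: upper_triangularI\<close>)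
  also have "\<dots> = (\<Prod>i<d. c i (b i))"
    by (simp add: prod_list_diag_prod T_def atLeast0LessThan)
  also have "\<dots> = 1" using fl by (simp add: reduced_flag_def)
  finally have detT: "det T = 1" .
  have "det G = prod_list (diag_mat G)"
    by (rule det_upper_triangular[OF _ car(2)]) (auto simp: G_def intro!: upper_triangularI)
  also have "\<dots> = (\<Prod>i<d. (g i)\<^sup>2)"
    by (simp add: prod_list_diag_prod G_def atLeast0LessThan)
  finally have detG: "det G = (\<Prod>i<d. g i)\<^sup>2" by (simp add: prod_power_distrib)
  have "det W = det T * det (map_mat real_of_int C)" unfolding WT using car C(1) by (intro det_mult) auto
  also have "det (map_mat real_of_int C) = of_int (det C)" by (rule of_int_hom.hom_det)
  finally have "(det W)\<^sup>2 = of_int ((det C)\<^sup>2)" by (simp add: detT)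
  then have detW: "(det W)\<^sup>2 = 1" by (simp add: C(2))
  have GW: "G * W = mat d d (\<lambda>(i, j). (g i)\<^sup>2 * c i (w j))"
  proof (rule eq_matI)
    fix i j assume "i < dim_row (mat d d (\<lambda>(i, j). (g i)\<^sup>2 * c i (w j)))" "j < dim_col (mat d d (\<lambda>(i, j). (g i)\<^sup>2 * c i (w j)))"
    then have ij: "i < d" "j < d" by auto
    have "(G * W) $$ (i, j) = (\<Sum>k<d. (if i = k then (g i)\<^sup>2 else 0) * c k (w j))"
      using ij by (simp add: G_def W_def scalar_prod_def atLeast0LessThan)
    also have "\<dots> = (\<Sum>k<d. if k = i then (g i)\<^sup>2 * c i (w j) else 0)" by (intro sum.cong) auto
    finally show "(G * W) $$ (i, j) = mat d d (\<lambda>(i, j). (g i)\<^sup>2 * c i (w j)) $$ (i, j)" using ij by simp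
  qed (auto simp: G_def W_def)
  have "mat d d (\<lambda>(i, j). tform \<alpha> (w i) (w j)) = transpose_mat W * (G * W)"
    unfolding GW
    by (rule eq_matI) (use wO dec in \<open>auto simp: W_def scalar_prod_def atLeast0LessThan mult_ac\<close>)
  also have "det \<dots> = det W * (det G * det W)"
    using car by (simp add: det_mult[of _ d] det_transpose[OF car(3)])
  also have "\<dots> = (det W)\<^sup>2 * det G" by (simp add: power2_eq_square)
  finally show ?thesis by (simp add: detW detG)
qed

text \<open>Lagrange interpolation finds a complex polynomial with value \<open>z \<sigma>\<close>
  at \<open>\<sigma> l\<close>. By the conjugation symmetry of \<open>z\<close> the polynomial with
  conjugated coefficients has the same values, hence so does their average, whose coefficients are
  real.\<close>

lemma KR_power_coordinates:
  assumes z: "z \<in> KR K"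
  shows "\<exists>t :: nat \<Rightarrow> real. \<forall>\<sigma>\<in>E. z \<sigma> = (\<Sum>j<d. of_real (t j) * \<sigma> l ^ j)"
proof -
  define P where "P = (\<Sum>\<tau>\<in>E. Polynomial.smult (z \<tau> / poly (cofactor_poly (\<tau> l)) (\<tau> l)) (cofactor_poly (\<tau> l)))"
  have degP: "degree P \<le> d - 1" unfolding P_def
    by (rule degree_sum_le) (use finite_E cofactor_poly_degree emb_conjugate in \<open>auto intro: le_trans[OF degree_smult_le]\<close>)
  have evP: "poly P (\<sigma> l) = z \<sigma>" if s: "\<sigma> \<in> E" for \<sigma>
  proof -
    have "poly P (\<sigma> l) = (\<Sum>\<tau>\<in>E. z \<tau> / poly (cofactor_poly (\<tau> l)) (\<tau> l) * poly (cofactor_poly (\<tau> l)) (\<sigma> l))"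
      by (simp add: P_def poly_sum)
    also have "\<dots> = (\<Sum>\<tau>\<in>E. if \<tau> = \<sigma> then z \<sigma> else 0)"
    proof (intro sum.cong refl)
      fix \<tau> assume t: "\<tau> \<in> E"
      show "z \<tau> / poly (cofactor_poly (\<tau> l)) (\<tau> l) * poly (cofactor_poly (\<tau> l)) (\<sigma> l) = (if \<tau> = \<sigma> then z \<sigma> else 0)"
        using cofactor_poly_eval[OF emb_conjugate[OF t] emb_conjugate[OF s]]
          cofactor_poly_eval[OF emb_conjugate[OF t] emb_conjugate[OF t]] inj_onD[OF emb_inj _ s t] by auto
    qed
    finally show ?thesis using s finite_E by simp
  qed
  have ev: "z \<sigma> = (\<Sum>j<d. coeff P j * \<sigma> l ^ j)" if s: "\<sigma> \<in> E" for \<sigma>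
  proof -
    have "z \<sigma> = (\<Sum>j\<le>degree P. coeff P j * \<sigma> l ^ j)" using evP[OF s] by (simp add: poly_altdef)
    also have "\<dots> = (\<Sum>j<d. coeff P j * \<sigma> l ^ j)"
      using degP d_pos by (intro sum.mono_neutral_left) (auto simp: coeff_eq_0)
    finally show ?thesis .
  qed
  have "z \<sigma> = (\<Sum>j<d. of_real (Re (coeff P j)) * \<sigma> l ^ j)" if s: "\<sigma> \<in> E" for \<sigma>
  proof -
    have "z (\<lambda>x. cnj (\<sigma> x)) = cnj (z \<sigma>)" using z s by (simp add: KR_def E_def)
    then have "z \<sigma> = cnj (z (\<lambda>x. cnj (\<sigma> x)))" by simp
    also have "\<dots> = (\<Sum>j<d. cnj (coeff P j) * \<sigma> l ^ j)" unfolding ev[OF cnj_E[OF s]] by simp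
    finally have e: "z \<sigma> = (\<Sum>j<d. cnj (coeff P j) * \<sigma> l ^ j)" .
    have r: "of_real (Re u) = (u + cnj u) / 2" for u by (simp add: complex_eq_iff)
    have "(\<Sum>j<d. of_real (Re (coeff P j)) * \<sigma> l ^ j)
       = ((\<Sum>j<d. coeff P j * \<sigma> l ^ j) + (\<Sum>j<d. cnj (coeff P j) * \<sigma> l ^ j)) / 2"
      unfolding r sum.distrib[symmetric] sum_divide_distrib by (intro sum.cong refl) (simp add: algebra_simps add_divide_distrib)
    also have "\<dots> = z \<sigma>" unfolding ev[OF s, symmetric] e[symmetric] by simp
    finally show ?thesis by simp
  qed
  then show ?thesis by (intro exI[of _ "\<lambda>j. Re (coeff P j)"]) simp
qed

text \<open>Rounding down real coordinates with respect to the powers of \<open>l\<close> reaches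
  every vector within a fixed distance. So the set whose infimum defines \<open>cov_max\<close> is
  non-empty.\<close>

lemma KR_covered:
  "\<exists>u. \<forall>x \<in> KR K. \<exists>y \<in> ring_of_integers K. qform K \<alpha> (x - minkowski K y) (x - minkowski K y) \<le> u"
proof (intro exI ballI)
  define u where "u = (\<Sum>\<sigma>\<in>E. \<bar>\<alpha> \<sigma>\<bar> * (\<Sum>j<d. cmod (\<sigma> l) ^ j)\<^sup>2)"
  fix z assume z: "z \<in> KR K"
  obtain t :: "nat \<Rightarrow> real" where t: "\<And>\<sigma>. \<sigma> \<in> E \<Longrightarrow> z \<sigma> = (\<Sum>j<d. of_real (t j) * \<sigma> l ^ j)"
    using KR_power_coordinates[OF z] by blast
  define y where "y = (\<Sum>j<d. of_int \<lfloor>t j\<rfloor> * l ^ j)"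
  have lp: "l ^ j \<in> K" "of_int k * l ^ j \<in> K" for j k using K_power[OF l_in_K] K_mult[OF of_int_in_K] by auto
  have y: "y \<in> OK" unfolding y_def
    by (intro additive_subgroup_sum[OF OK_subgroup] OK_mult of_int_in_OK OK_power l_in_OK)
  have bound: "cmod (z \<sigma> - \<sigma> y) \<le> (\<Sum>j<d. cmod (\<sigma> l) ^ j)" if s: "\<sigma> \<in> E" for \<sigma>
  proof -
    have "\<sigma> y = (\<Sum>j<d. of_int \<lfloor>t j\<rfloor> * \<sigma> l ^ j)"
      unfolding y_def using lp l_in_K by (simp add: emb_sum[OF s] emb_of_int_mult[OF s] emb_power[OF s])
    then have "z \<sigma> - \<sigma> y = (\<Sum>j<d. of_real (frac (t j)) * \<sigma> l ^ j)"
      unfolding t[OF s] by (simp add: sum_subtractf[symmetric] frac_def algebra_simps)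
    also have "cmod \<dots> \<le> (\<Sum>j<d. cmod (of_real (frac (t j)) * \<sigma> l ^ j))" by (rule norm_sum)
    also have "\<dots> \<le> (\<Sum>j<d. 1 * cmod (\<sigma> l) ^ j)"
      unfolding norm_mult norm_power using less_imp_le[OF frac_lt_1] by (intro sum_mono mult_right_mono) auto
    finally show ?thesis by simp
  qed
  have "qform K \<alpha> (z - minkowski K y) (z - minkowski K y) = (\<Sum>\<sigma>\<in>E. \<alpha> \<sigma> * (cmod (z \<sigma> - \<sigma> y))\<^sup>2)"
    unfolding qform_def E_def[symmetric] minkowski_def
    unfolding Re_mult_cnj_self by (intro sum.cong refl) simp
  also have "\<dots> \<le> u" unfolding u_def
    using bound by (intro sum_mono mult_mono power_mono) auto
  finally have "qform K \<alpha> (z - minkowski K y) (z - minkowski K y) \<le> u" .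
  then show "\<exists>y \<in> ring_of_integers K. qform K \<alpha> (z - minkowski K y) (z - minkowski K y) \<le> u"
    using y by (auto simp: OK_def)
qed

end

section \<open>The bound in terms of the thickness\<close>

lemma sum_single:
  assumes "finite A" "j \<in> A" "\<And>p. p \<in> A \<Longrightarrow> p \<noteq> j \<Longrightarrow> h p = 0"
  shows "sum h A = h j"
  using sum.mono_neutral_right[of A "{j}" h] assms by auto

text \<open>Degree at least 2 provides a conjugate other than \<open>l\<close>, so that
  \<open>spectral_ratio\<close> is the maximum of a non-empty set.\<close>

locale perron_number = algebraic_real +
  assumes perron: "perron l" and d2: "d \<ge> 2"
begin

definition \<rho> :: real where "\<rho> = spectral_ratio l"

lemma l_pos: "l > 0"
  using perron by (simp add: perron_def)

lemma finite_ratio: "finite ((\<lambda>z. cmod z / l) ` (conjugates l - {of_real l}))"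
  using finite_conjugates by simp

lemma \<rho>_mem: "\<rho> \<in> (\<lambda>z. cmod z / l) ` (conjugates l - {of_real l})"
proof -
  have "card (conjugates l - {of_real l}) = d - 1" using card_conjugates l_conjugate finite_conjugates by simp
  then have "conjugates l - {of_real l} \<noteq> {}" using d2 by force
  then show ?thesis unfolding \<rho>_def spectral_ratio_def using finite_ratio by (intro Max_in) auto
qed

lemma \<rho>_nonneg: "0 \<le> \<rho>" and \<rho>_less_1: "\<rho> < 1"
proof -
  obtain z where z: "z \<in> conjugates l" "z \<noteq> of_real l" "\<rho> = cmod z / l" using \<rho>_mem by auto
  then have "cmod z < l" using perron by (auto simp: perron_def)
  then show "0 \<le> \<rho>" "\<rho> < 1" using z(3) l_pos by auto
qed

lemma emb_contract:
  assumes "\<sigma> \<in> E" "\<sigma> \<noteq> idE"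
  shows "cmod (\<sigma> l) \<le> \<rho> * l"
proof -
  have "idE l = of_real l" using l_in_K by (simp add: idE_def)
  then have "\<sigma> l \<noteq> of_real l" using inj_onD[OF emb_inj _ assms(1) idE_in_E] assms(2) by auto
  then have "cmod (\<sigma> l) / l \<in> (\<lambda>z. cmod z / l) ` (conjugates l - {of_real l})"
    using emb_conjugate[OF assms(1)] by auto
  then have "cmod (\<sigma> l) / l \<le> \<rho>" unfolding \<rho>_def spectral_ratio_def by (rule Max_ge[OF finite_ratio])
  then show ?thesis using l_pos by (simp add: field_simps)
qed

text \<open>All conjugates of a Perron number in the interval are bounded by its right end. Hence
  there are finitely many such numbers in \<open>OK\<close>, and the \<open>Max\<close> in
  \<open>kappa\<close> is a genuine maximum.\<close>

lemma PF_degree_le_kappa: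
  assumes "l \<le> 1 + 4 / (1 - \<rho>)"
  shows "PF_degree l \<le> kappa K \<rho>"
proof -
  let ?M = "1 + 4 / (1 - \<rho>)"
  let ?A = "{a. a \<in> {1..?M} \<and> a \<in> K \<and> perron a}"
  have "?A \<subseteq> {x \<in> OK. \<forall>\<sigma>\<in>E. cmod (\<sigma> x) \<le> ?M}"
  proof (intro subsetI CollectI conjI ballI)
    fix a assume a: "a \<in> ?A"
    then have alg_a: "algebraic_int a" by (auto simp: perron_def)
    then show "a \<in> OK" using a OK_I by auto
    fix \<sigma> assume s: "\<sigma> \<in> E"
    have "\<sigma> a \<in> conjugates a" using emb_min_poly_root[OF s] a alg_a by auto
    then have "cmod (\<sigma> a) \<le> a"
      using a by (cases "\<sigma> a = of_real a") (auto simp: perron_def intro: less_imp_le)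
    then show "cmod (\<sigma> a) \<le> ?M" using a by auto
  qed
  then have "finite ?A" using finite_OK_bounded finite_subset by blast
  then have "finite (PF_degree ` ?A)" by simp
  moreover have "{PF_degree a | a. a \<in> {1..?M} \<and> a \<in> K \<and> perron a} = PF_degree ` ?A" by auto
  moreover have "l \<in> ?A" using assms perron l_in_K by (auto simp: perron_def)
  ultimately show ?thesis unfolding kappa_def by (simp only: Max_ge imageI)
qed

end

section \<open>Counting integers by Gram-Schmidt coordinates\<close>

context algebraic_real
begin

lemma flag_leading_coordinate:
  assumes fl: "reduced_flag OK B m d b g c" and p: "p < d"
    and zero: "\<And>i. p < i \<Longrightarrow> i < d \<Longrightarrow> n i = 0"
  shows "c p (\<Sum>i<d. of_int (n i) * b i) = of_int (n p)"
proof -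
  have bO: "\<And>i. i < d \<Longrightarrow> b i \<in> OK" and add: "\<And>x y. x \<in> OK \<Longrightarrow> y \<in> OK \<Longrightarrow> c p (x + y) = c p x + c p y"
    using fl p by (auto simp: reduced_flag_def)
  have "c p (\<Sum>i<d. of_int (n i) * b i) = (\<Sum>i<d. c p (of_int (n i) * b i))"
    by (rule additive_on_sum[OF OK_subgroup]) (use bO add additive_subgroup_of_int_mult[OF OK_subgroup] in auto)
  also have "\<dots> = (\<Sum>i<d. of_int (n i) * c p (b i))"
    by (intro sum.cong refl additive_on_of_int[OF OK_subgroup]) (use bO add in auto)
  also have "\<dots> = of_int (n p) * c p (b p)"
  proof (rule sum_single)
    fix i assume "i \<in> {..<d}" "i \<noteq> p"
    then consider "i < p" | "p < i" "i < d" by force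
    then show "of_int (n i) * c p (b i) = 0" using zero fl p by cases (auto simp: reduced_flag_def)
  qed (use p in auto)
  also have "c p (b p) = 1" using fl p by (auto simp: reduced_flag_def)
  finally show ?thesis by simp
qed

text \<open>If the coordinates beyond \<open>k\<close> vanish, so do the basis coefficients beyond
  \<open>k\<close>: the last non-zero one would equal its own coordinate. Then the coordinate at
  \<open>k\<close> is the integer coefficient there.\<close>

lemma flag_coordinate_integral:
  assumes rb: "reduced_basis \<alpha> m b g c"
    and z: "z \<in> OK" and k: "k < d" and zero: "\<And>p. k < p \<Longrightarrow> p < d \<Longrightarrow> c p z = 0"
  shows "\<exists>n :: int. c k z = of_int n"
proof -
  note fl = reduced_basisD(1)[OF rb]
    and span = reduced_basisD(2)[OF rb]
  obtain n :: "nat \<Rightarrow> int" where n: "z = (\<Sum>i<d. of_int (n i) * b i)" using span z by blast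
  have top: "n i = 0" if "k < i" "i < d" for i
  proof (rule ccontr)
    assume ne: "n i \<noteq> 0"
    let ?I = "{i. k < i \<and> i < d \<and> n i \<noteq> 0}"
    define p where "p = Max ?I"
    have "p \<in> ?I" unfolding p_def using that ne by (intro Max_in) auto
    then have p: "k < p" "p < d" "n p \<noteq> 0" by auto
    have above: "n j = 0" if j: "p < j" "j < d" for j
    proof (rule ccontr)
      assume "n j \<noteq> 0"
      then have "j \<le> p" unfolding p_def using j p by (intro Max_ge) auto
      then show False using j by simp
    qed
    from flag_leading_coordinate[OF fl p(2), of n, OF above] have "c p z = of_int (n p)" by (simp add: n)
    then show False using zero[OF p(1,2)] p(3) by simp
  qed
  from flag_leading_coordinate[OF fl k, of n, OF top] show ?thesis unfolding n by blast
qed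

lemma card_OK_le:
  assumes rb: "reduced_basis \<alpha> m b g c"
    and pd: "\<And>x. x \<in> OK \<Longrightarrow> tform \<alpha> x x = 0 \<Longrightarrow> x = 0"
    and r: "r \<ge> 0"
  shows "real (card {x \<in> OK. tform \<alpha> x x \<le> r\<^sup>2}) \<le> (\<Prod>i<d. 1 + 2 * r / g i)"
proof -
  note fl = reduced_basisD(1)[OF rb]
    and dec = reduced_basisD(3)[OF rb]
  \<comment> \<open>The coordinates are enumerated from last to first, since a Gram-Schmidt
    coordinate is integral only once all later ones vanish.\<close>
  define k where "k i = d - Suc i" for i
  have k: "k i < d" if "i < d" for i using that by (simp add: k_def)
  have g: "g i > 0" if "i < d" for i using fl that by (auto simp: reduced_flag_def)
  have add: "c i (x + y) = c i x + c i y" if "i < d" "x \<in> OK" "y \<in> OK" for i x y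
    using fl that by (auto simp: reduced_flag_def)
  have diff: "c i (x - y) = c i x - c i y" if "i < d" "x \<in> OK" "y \<in> OK" for i x y
    using add[of i "x - y" y] that OK_diff by simp
  have sq: "tform \<alpha> x x = (\<Sum>i<d. (g i * c i x)\<^sup>2)" if "x \<in> OK" for x
    using dec that by (simp add: power2_eq_square mult_ac)
  have "finite {x \<in> OK. tform \<alpha> x x \<le> r\<^sup>2} \<and>
    real (card {x \<in> OK. tform \<alpha> x x \<le> r\<^sup>2}) \<le> (\<Prod>i<d. 1 + 2 * r / g (k i))"
  proof (rule card_le_prod_of_coordinates[where Y = "\<lambda>i x. g (k i) * c (k i) x"])
    fix i a assume i: "i < d" and a: "a \<in> {x \<in> OK. tform \<alpha> x x \<le> r\<^sup>2}"
    have "(g (k i) * c (k i) a)\<^sup>2 \<le> (\<Sum>i<d. (g i * c i a)\<^sup>2)"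
      using k[OF i] by (intro member_le_sum[of "k i" "{..<d}" "\<lambda>i. (g i * c i a)\<^sup>2"]) auto
    also have "\<dots> \<le> r\<^sup>2" using a sq by auto
    finally show "\<bar>g (k i) * c (k i) a\<bar> \<le> r" using r by (metis abs_le_square_iff abs_of_nonneg)
  next
    fix i a a' assume i: "i < d" and a: "a \<in> {x \<in> OK. tform \<alpha> x x \<le> r\<^sup>2}" "a' \<in> {x \<in> OK. tform \<alpha> x x \<le> r\<^sup>2}"
      and eq: "\<And>j. j < i \<Longrightarrow> g (k j) * c (k j) a = g (k j) * c (k j) a'"
    have "\<exists>n :: int. c (k i) (a - a') = of_int n"
    proof (rule flag_coordinate_integral[OF rb])
      show "a - a' \<in> OK" using a OK_diff by auto
      show "k i < d" by (rule k[OF i])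
      fix p assume p: "k i < p" "p < d"
      define j where "j = d - Suc p"
      have j: "j < i" "k j = p" using p i by (auto simp: j_def k_def)
      have "c p a = c p a'" using eq[OF j(1)] g[OF p(2)] j(2) by simp
      then show "c p (a - a') = 0" using diff[OF p(2)] a by auto
    qed
    then obtain n :: int where n: "c (k i) (a - a') = of_int n" by blast
    have e: "of_int n = c (k i) a - c (k i) a'" using diff[OF k[OF i], of a a'] a n by simp
    have "g (k i) * c (k i) a - g (k i) * c (k i) a' = of_int n * g (k i)"
      unfolding e by (simp add: algebra_simps)
    then show "\<exists>n :: int. g (k i) * c (k i) a - g (k i) * c (k i) a' = of_int n * g (k i)" by blast
  next
    fix a a' assume a: "a \<in> {x \<in> OK. tform \<alpha> x x \<le> r\<^sup>2}" "a' \<in> {x \<in> OK. tform \<alpha> x x \<le> r\<^sup>2}"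
      and eq: "\<And>j. j < d \<Longrightarrow> g (k j) * c (k j) a = g (k j) * c (k j) a'"
    have mem: "a - a' \<in> OK" using a OK_diff by auto
    have "c p (a - a') = 0" if p: "p < d" for p
    proof -
      have "d - Suc p < d" "k (d - Suc p) = p" using p by (auto simp: k_def)
      then have "c p a = c p a'" using eq[of "d - Suc p"] g[OF p] by simp
      then show ?thesis using diff[OF p] a by auto
    qed
    then have "tform \<alpha> (a - a') (a - a') = 0" using sq[OF mem] by simp
    then show "a = a'" using pd[OF mem] by simp
  qed (use g k r in auto)
  moreover have "(\<Prod>i<d. 1 + 2 * r / g (k i)) = (\<Prod>i<d. 1 + 2 * r / g i)"
    unfolding k_def by (rule prod.nat_diff_reindex[of "\<lambda>i. 1 + 2 * r / g i" d])
  ultimately show ?thesis by simp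
qed

text \<open>The Gram determinant has the same value on every integral basis, in particular on the
  one picked by \<open>SOME\<close>.\<close>

lemma gram_det_eq:
  assumes rb: "reduced_basis \<alpha> m b g c"
  shows "gram_det K \<alpha> = (\<Prod>i<d. g i)\<^sup>2"
proof -
  define w where "w = (SOME \<omega>. integral_basis K \<omega>)"
  have "\<exists>\<omega>. integral_basis K \<omega>" using reduced_basis_integral[OF rb] by blast
  then have w: "integral_basis K w" unfolding w_def by (rule someI_ex)
  show ?thesis unfolding gram_det_def Let_def field_degree_eq tform_qform w_def[symmetric]
    by (rule gram_det_reduced[OF rb w])
qed

end

section \<open>From the covering radius to the thickness\<close>

context perron_number
begin

lemma PF_degree_le_cover:
  assumes \<alpha>: "\<alpha> \<in> weights K" and u: "u > 0"
    and cov: "\<forall>x \<in> KR K. \<exists>y \<in> ring_of_integers K. qform K \<alpha> (x - minkowski K y) (x - minkowski K y) \<le> u"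
    and large: "l > 1 + 4 / (1 - \<rho>)"
  shows "gram_det K \<alpha> > 0" "real (PF_degree l) \<le> (63 / (1 - \<rho>)) ^ d * (sqrt u ^ d / sqrt (gram_det K \<alpha>))"
proof -
  have pos: "\<And>\<sigma>. \<sigma> \<in> E \<Longrightarrow> \<alpha> \<sigma> > 0" using \<alpha> by (simp add: weights_def E_def)
  obtain m where m: "m > 0" "\<And>\<sigma>. \<sigma> \<in> E \<Longrightarrow> m \<le> \<alpha> \<sigma>" using weight_lower_bound[of \<alpha>] pos by blast
  obtain b g c where rb: "reduced_basis \<alpha> m b g c"
    using exists_reduced_integral_basis[of \<alpha> m] pos m by blast
  note fl = reduced_basisD(1)[OF rb]
  have g: "g i > 0" if "i < d" for i using fl that by (auto simp: reduced_flag_def)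
  have gd: "gram_det K \<alpha> = (\<Prod>i<d. g i)\<^sup>2" by (rule gram_det_eq[OF rb])
  have Pg: "(\<Prod>i<d. g i) > 0" using g by (intro prod_pos) auto
  then show "gram_det K \<alpha> > 0" unfolding gd by (rule zero_less_power)
  define R where "R = sqrt u"
  have R: "R > 0" "R\<^sup>2 = u" using u by (auto simp: R_def)
  have cover: "\<exists>y\<in>OK. (\<Sum>\<sigma>\<in>E. \<alpha> \<sigma> * (cmod (of_real s * \<sigma> x - \<sigma> y))\<^sup>2) \<le> R\<^sup>2" if x: "x \<in> OK" for x s
  proof -
    \<comment> \<open>The multiple \<open>s * x\<close> need not have its image come from
      \<open>K\<close>, so it is taken as a vector of \<open>KR K\<close> to which the covering
      hypothesis applies.\<close>
    define z where "z \<sigma> = (if \<sigma> \<in> E then of_real s * \<sigma> x else 0)" for \<sigma>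
    have "z \<in> KR K" using cnj_E by (auto simp: KR_def E_def[symmetric] z_def)
    then obtain y where y: "y \<in> OK" "qform K \<alpha> (z - minkowski K y) (z - minkowski K y) \<le> u"
      using cov by (auto simp: OK_def)
    have "qform K \<alpha> (z - minkowski K y) (z - minkowski K y) = (\<Sum>\<sigma>\<in>E. \<alpha> \<sigma> * (cmod (of_real s * \<sigma> x - \<sigma> y))\<^sup>2)"
      unfolding qform_def E_def[symmetric] Re_mult_cnj_self
      by (intro sum.cong refl) (simp add: z_def minkowski_def E_def[symmetric])
    then show ?thesis using y R by auto
  qed
  then have "covers OK (tform \<alpha>) R" unfolding covers_def tform_expand by simp
  then have gR: "g i \<le> 3 * R" if "i < d" for i using fl that R by (auto simp: reduced_flag_def)
  define r where "r = 30 * R / (1 - \<rho>)"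
  have \<rho>1: "1 - \<rho> > 0" "1 - \<rho> \<le> 1" using \<rho>_nonneg \<rho>_less_1 by auto
  have r: "r > 0" using R \<rho>1 by (simp add: r_def)
  have "PF_degree l \<le> card {x \<in> OK. (\<Sum>\<sigma>\<in>E. \<alpha> \<sigma> * (cmod (\<sigma> x))\<^sup>2) \<le> (30 * R / (1 - \<rho>))\<^sup>2}"
  proof (rule PF_degree_le_lattice_points[OF finite_E idE_in_E])
    show "idE x = complex_of_real x" if "x \<in> OK" for x using OK_D that by (simp add: idE_def)
    show "1 \<in> OK" using of_int_in_OK[of 1] by simp
    show "finite {x \<in> OK. (\<Sum>\<sigma>\<in>E. \<alpha> \<sigma> * (cmod (\<sigma> x))\<^sup>2) \<le> (30 * R / (1 - \<rho>))\<^sup>2}"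
      using tform_finite[of \<alpha>] pos unfolding tform_self by blast
    show "\<exists>y\<in>OK. (\<Sum>\<sigma>\<in>E. \<alpha> \<sigma> * (cmod (of_real s * \<sigma> x - \<sigma> y))\<^sup>2) \<le> R\<^sup>2" if "x \<in> OK" for x s
      by (rule cover[OF that])
    show "\<sigma> (x - y) = \<sigma> x - \<sigma> y" if "\<sigma> \<in> E" "x \<in> OK" "y \<in> OK" for \<sigma> x y
      using emb_diff[OF that(1)] OK_D that by simp
    show "\<sigma> (l * x) = \<sigma> l * \<sigma> x" if "\<sigma> \<in> E" "x \<in> OK" for \<sigma> x
      using emb_mult[OF that(1) l_in_K] OK_D that by simp
  qed (use pos OK_diff OK_mult l_in_OK emb_contract R \<rho>_nonneg \<rho>_less_1 large in auto)
  then have "real (PF_degree l) \<le> real (card {x \<in> OK. tform \<alpha> x x \<le> r\<^sup>2})" unfolding tform_self r_def by simp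
  also have "\<dots> \<le> (\<Prod>i<d. 1 + 2 * r / g i)"
  proof (rule card_OK_le[OF rb])
    fix x assume x: "x \<in> OK" "tform \<alpha> x x = 0"
    have "m \<le> tform \<alpha> x x" if "x \<noteq> 0" using m pos x that by (intro tform_lower) auto
    then show "x = 0" using x m by auto
  qed (use r in simp)
  also have "\<dots> \<le> (\<Prod>i<d. 63 / (1 - \<rho>) * (R / g i))"
  proof (rule prod_mono, intro conjI)
    fix i assume "i \<in> {..<d}"
    then have i: "i < d" by simp
    show "0 \<le> 1 + 2 * r / g i" using g[OF i] r by (simp add: add_nonneg_nonneg)
    have "3 * R * (1 - \<rho>) \<le> 3 * R * 1" using R \<rho>1 by (intro mult_left_mono) auto
    then have "3 * R \<le> 3 * R / (1 - \<rho>)" using \<rho>1 by (simp add: pos_le_divide_eq)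
    \<comment> \<open>The 63 is 3 + 60: the first part absorbs the summand 1 through
      \<open>g i \<le> 3 * R\<close>, the second is \<open>2 * r\<close>.\<close>
    then have "g i + 2 * r \<le> 3 * R / (1 - \<rho>) + 60 * R / (1 - \<rho>)" using gR[OF i] by (simp add: r_def)
    also have "\<dots> = 63 / (1 - \<rho>) * R" by (simp add: add_divide_distrib[symmetric])
    finally have "(g i + 2 * r) / g i \<le> 63 / (1 - \<rho>) * R / g i" using g[OF i] by (intro divide_right_mono) auto
    then show "1 + 2 * r / g i \<le> 63 / (1 - \<rho>) * (R / g i)" using g[OF i] by (simp add: add_divide_distrib)
  qed
  also have "\<dots> = (63 / (1 - \<rho>)) ^ d * (R ^ d / (\<Prod>i<d. g i))"
    by (simp add: prod.distrib prod_dividef power_divide)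
  also have "(\<Prod>i<d. g i) = sqrt (gram_det K \<alpha>)" using Pg by (simp add: gd)
  finally show "real (PF_degree l) \<le> (63 / (1 - \<rho>)) ^ d * (sqrt u ^ d / sqrt (gram_det K \<alpha>))"
    by (simp add: R_def)
qed

text \<open>The estimate holds for every weight and every admissible \<open>u\<close>. Solving it
  for the thickness, by raising to the power \<open>2 / d\<close>, gives a lower bound independent
  of both, which survives the infimum over \<open>u\<close> and then the one over the
  weights.\<close>

lemma PF_degree_le_tau_min:
  assumes large: "l > 1 + 4 / (1 - \<rho>)"
  shows "real (PF_degree l) \<le> (63 / (1 - \<rho>)) ^ d * tau_min K powr (real d / 2)"
proof -
  define C where "C = (63 / (1 - \<rho>)) ^ d"
  have C: "C > 0" using \<rho>_less_1 by (simp add: C_def)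
  define p where "p = real (PF_degree l) / C"
  have p: "p \<ge> 0" using C by (simp add: p_def)
  have thick: "p powr (2 / real d) \<le> thickness K \<alpha>" if \<alpha>: "\<alpha> \<in> weights K" for \<alpha>
  proof -
    let ?U = "{u. \<forall>x \<in> KR K. \<exists>y \<in> ring_of_integers K. qform K \<alpha> (x - minkowski K y) (x - minkowski K y) \<le> u}"
    have pos: "\<And>\<sigma>. \<sigma> \<in> embeddings K \<Longrightarrow> \<alpha> \<sigma> > 0" using \<alpha> by (simp add: weights_def)
    have Une: "?U \<noteq> {}" using KR_covered[of \<alpha>] by blast
    have nn: "qform K \<alpha> z z \<ge> 0" for z
      unfolding qform_def Re_mult_cnj_self using pos by (auto intro!: sum_nonneg simp: less_imp_le)
    have lower: "0 \<le> u" if "u \<in> ?U" for u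
    proof -
      have "(\<lambda>_. 0) \<in> KR K" by (simp add: KR_def)
      then show ?thesis using that nn order_trans by blast
    qed
    have key: "p powr (2 / real d) * gram_det K \<alpha> powr (1 / real d) \<le> u" and gpos: "gram_det K \<alpha> > 0"
      if U: "u \<in> ?U" and u: "u > 0" for u
    proof -
      from U have cov: "\<forall>x \<in> KR K. \<exists>y \<in> ring_of_integers K. qform K \<alpha> (x - minkowski K y) (x - minkowski K y) \<le> u" by simp
      show g: "gram_det K \<alpha> > 0" by (rule PF_degree_le_cover(1)[OF \<alpha> u cov large])
      have "real (PF_degree l) \<le> C * (sqrt u ^ d / sqrt (gram_det K \<alpha>))"
        unfolding C_def by (rule PF_degree_le_cover(2)[OF \<alpha> u cov large])
      then have "p \<le> sqrt u ^ d / sqrt (gram_det K \<alpha>)" using C by (simp add: p_def field_simps)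
      then have "p * sqrt (gram_det K \<alpha>) \<le> sqrt u ^ d" using g by (simp add: field_simps)
      then have "(p * sqrt (gram_det K \<alpha>)) powr (2 / real d) \<le> (sqrt u ^ d) powr (2 / real d)"
        using p g by (intro powr_mono2) auto
      moreover have "(sqrt u ^ d) powr (2 / real d) = u"
      proof -
        have "sqrt u ^ d = sqrt u powr real d" using u by (simp add: powr_realpow)
        then have "(sqrt u ^ d) powr (2 / real d) = sqrt u powr 2" using d_pos by (simp add: powr_powr)
        then show ?thesis using u by simp
      qed
      moreover have "(p * sqrt (gram_det K \<alpha>)) powr (2 / real d) = p powr (2 / real d) * gram_det K \<alpha> powr (1 / real d)"
        using p g by (simp add: powr_mult powr_half_sqrt[symmetric] powr_powr)
      ultimately show "p powr (2 / real d) * gram_det K \<alpha> powr (1 / real d) \<le> u" by simp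
    qed
    obtain u0 where u0: "u0 \<in> ?U" using Une by blast
    have "u0 + 1 \<in> ?U" using u0 by force
    then have g: "gram_det K \<alpha> > 0" using gpos[of "u0 + 1"] lower[OF u0] by simp
    have "p powr (2 / real d) * gram_det K \<alpha> powr (1 / real d) \<le> Inf ?U"
    proof (rule cInf_greatest[OF Une])
      fix u assume u: "u \<in> ?U"
      show "p powr (2 / real d) * gram_det K \<alpha> powr (1 / real d) \<le> u"
      \<comment> \<open>The estimate requires a positive \<open>u\<close>, but members of the set
        are only known to be non-negative; \<open>u + e\<close> is positive and still
        admissible.\<close>
      proof (rule field_le_epsilon)
        fix e :: real assume e: "e > 0"
        have "u + e \<in> ?U" using u e by force
        then show "p powr (2 / real d) * gram_det K \<alpha> powr (1 / real d) \<le> u + e"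
          using key[of "u + e"] lower[OF u] e by simp
      qed
    qed
    then show ?thesis using g unfolding thickness_def cov_max_def field_degree_eq
      by (simp add: pos_le_divide_eq)
  qed
  \<comment> \<open>Unit weights show that the infimum is taken over a non-empty set.\<close>
  have "(\<lambda>_. 1) \<in> weights K" by (simp add: weights_def)
  then have "p powr (2 / real d) \<le> tau_min K" unfolding tau_min_def
    using thick by (intro cInf_greatest) auto
  then have "(p powr (2 / real d)) powr (real d / 2) \<le> tau_min K powr (real d / 2)"
    by (intro powr_mono2) auto
  then have "p \<le> tau_min K powr (real d / 2)" using p d_pos by (simp add: powr_powr)
  then show ?thesis using C unfolding p_def C_def[symmetric] by (simp add: field_simps)
qed

end

section \<open>The discriminant and the dual lattice\<close>

lemma comm_ring_hom_cnj: "comm_ring_hom cnj"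
  by unfold_locales simp_all

lemma comm_ring_hom_of_real: "comm_ring_hom complex_of_real"
  by unfold_locales simp_all

section \<open>The discriminant as a Gram determinant\<close>

context algebraic_real
begin

lemma Tr_real: "x \<in> K \<Longrightarrow> Tr x = of_real (Re (Tr x))"
  using Tr_rational by (metis Rats_cases complex_eq_iff Im_complex_of_real Re_complex_of_real of_real_of_rat)

text \<open>Conjugation permutes the embeddings, so the sum equals its own conjugate and is
  real.\<close>

lemma tform_one_cnj:
  "(\<Sum>\<sigma>\<in>E. cnj (\<sigma> x) * \<sigma> y) = of_real (tform (\<lambda>_. 1) x y)"
proof -
  let ?s = "\<Sum>\<sigma>\<in>E. cnj (\<sigma> x) * \<sigma> y"
  have "?s = (\<Sum>\<sigma>\<in>E. cnj (cnj (\<sigma> x)) * cnj (\<sigma> y))"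
    using sum_cnj_E[of "\<lambda>\<sigma>. cnj (\<sigma> x) * \<sigma> y"] by simp
  also have "\<dots> = cnj ?s" by simp
  finally have "Im ?s = 0" by (metis complex_cnj_cancel_iff complex_eq_iff Reals_cnj_iff complex_is_Real_iff)
  moreover have "Re ?s = tform (\<lambda>_. 1) x y" by (simp add: tform_def mult.commute)
  ultimately show ?thesis by (simp add: complex_eq_iff)
qed

text \<open>For the matrix \<open>M\<close> of embedded basis vectors, transpose times
  \<open>M\<close> is the trace matrix and conjugate transpose times \<open>M\<close> is the Gram
  matrix. The first makes the square of the determinant real, the second determines its absolute
  value.\<close>

lemma det_embeddings:
  assumes rb: "reduced_basis (\<lambda>_. 1) m b g c"
    and w: "integral_basis K w" and e: "bij_betw e {..<d} E"
  defines "D \<equiv> det (mat d d (\<lambda>(i, j). e i (w j)))"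
  shows "(cmod D)\<^sup>2 = (\<Prod>i<d. g i)\<^sup>2"
    and "D\<^sup>2 = det (mat d d (\<lambda>(i, j). Tr (w i * w j)))"
    and "D\<^sup>2 \<in> \<real>"
proof -
  define M where "M = mat d d (\<lambda>(i, j). e i (w j))"
  have M: "M \<in> carrier_mat d d" by (simp add: M_def)
  have wO: "\<And>i. i < d \<Longrightarrow> w i \<in> OK" using integral_basisD(1)[OF w] .
  have wK: "\<And>i. i < d \<Longrightarrow> w i \<in> K" using wO OK_D by blast
  have eE: "\<And>i. i < d \<Longrightarrow> e i \<in> E" using e by (auto simp: bij_betw_def)
  have re: "(\<Sum>i<d. h (e i)) = (\<Sum>\<sigma>\<in>E. h \<sigma>)" for h :: "_ \<Rightarrow> complex"
    by (rule sum.reindex_bij_betw[OF e])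
  have DM: "D = det M" by (simp add: D_def M_def)
  have "transpose_mat M * M = mat d d (\<lambda>(i, j). Tr (w i * w j))"
  proof (rule eq_matI)
    fix i j assume "i < dim_row (mat d d (\<lambda>(i, j). Tr (w i * w j)))" "j < dim_col (mat d d (\<lambda>(i, j). Tr (w i * w j)))"
    then have ij: "i < d" "j < d" by auto
    have "(transpose_mat M * M) $$ (i, j) = (\<Sum>k<d. e k (w i) * e k (w j))"
      using ij by (simp add: M_def scalar_prod_def atLeast0LessThan)
    also have "\<dots> = (\<Sum>\<sigma>\<in>E. \<sigma> (w i) * \<sigma> (w j))" by (rule re[of "\<lambda>\<sigma>. \<sigma> (w i) * \<sigma> (w j)"])
    also have "\<dots> = Tr (w i * w j)" unfolding Tr_def
      using ij wK by (intro sum.cong refl) (simp add: emb_mult)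
    finally show "(transpose_mat M * M) $$ (i, j) = mat d d (\<lambda>(i, j). Tr (w i * w j)) $$ (i, j)" using ij by simp
  qed (auto simp: M_def)
  then show D2: "D\<^sup>2 = det (mat d d (\<lambda>(i, j). Tr (w i * w j)))"
    using det_mult[of "transpose_mat M" d M] det_transpose[OF M] M by (simp add: DM power2_eq_square)
  note hom_of_real = comm_ring_hom.hom_det[OF comm_ring_hom_of_real]
  have "mat d d (\<lambda>(i, j). Tr (w i * w j)) = map_mat complex_of_real (mat d d (\<lambda>(i, j). Re (Tr (w i * w j))))"
    by (rule eq_matI) (auto simp: Tr_real[symmetric] wK K_mult)
  then have "D\<^sup>2 = of_real (det (mat d d (\<lambda>(i, j). Re (Tr (w i * w j)))))"
    using D2 hom_of_real by metis
  then show "D\<^sup>2 \<in> \<real>" by simp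
  let ?G = "mat d d (\<lambda>(i, j). tform (\<lambda>_. 1) (w i) (w j))"
  have cM: "transpose_mat (map_mat cnj M) \<in> carrier_mat d d" using M by simp
  have "transpose_mat (map_mat cnj M) * M = map_mat complex_of_real ?G"
  proof (rule eq_matI)
    fix i j assume "i < dim_row (map_mat complex_of_real ?G)" "j < dim_col (map_mat complex_of_real ?G)"
    then have ij: "i < d" "j < d" by auto
    have "(transpose_mat (map_mat cnj M) * M) $$ (i, j) = (\<Sum>k<d. cnj (e k (w i)) * e k (w j))"
      using ij by (simp add: M_def scalar_prod_def atLeast0LessThan)
    also have "\<dots> = (\<Sum>\<sigma>\<in>E. cnj (\<sigma> (w i)) * \<sigma> (w j))" by (rule re[of "\<lambda>\<sigma>. cnj (\<sigma> (w i)) * \<sigma> (w j)"])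
    also have "\<dots> = of_real (tform (\<lambda>_. 1) (w i) (w j))" by (rule tform_one_cnj)
    finally show "(transpose_mat (map_mat cnj M) * M) $$ (i, j) = map_mat complex_of_real ?G $$ (i, j)" using ij by simp
  qed (auto simp: M_def)
  then have "det (transpose_mat (map_mat cnj M)) * det M = of_real (det ?G)"
    using det_mult[OF cM M] hom_of_real by metis
  moreover have "det (transpose_mat (map_mat cnj M)) = cnj (det M)"
    using det_transpose[of "map_mat cnj M" d] M comm_ring_hom.hom_det[OF comm_ring_hom_cnj] by simp
  moreover have "det ?G = (\<Prod>i<d. g i)\<^sup>2" by (rule gram_det_reduced[OF rb w])
  ultimately have "D * cnj D = of_real ((\<Prod>i<d. g i)\<^sup>2)" by (simp add: DM mult.commute)
  then show "(cmod D)\<^sup>2 = (\<Prod>i<d. g i)\<^sup>2" by (metis Re_mult_cnj_self Re_complex_of_real)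
qed

lemma exists_enumeration: "\<exists>e. bij_betw e {..<d} E"
  using ex_bij_betw_nat_finite[OF finite_E] card_E by (metis atLeast0LessThan)

text \<open>The result holds for any integral basis and any enumeration of the embeddings, hence for
  the value chosen by \<open>SOME\<close>.\<close>

lemma abs_discriminant:
  assumes rb: "reduced_basis (\<lambda>_. 1) m b g c"
  shows "\<bar>discriminant K\<bar> = (\<Prod>i<d. g i)\<^sup>2"
proof -
  let ?P = "\<lambda>D. \<exists>\<omega> e. integral_basis K \<omega> \<and> bij_betw e {..<field_degree K} (embeddings K) \<and>
      D = (det (mat (field_degree K) (field_degree K) (\<lambda>(i, j). e i (\<omega> j)))) ^ 2"
  obtain e where e: "bij_betw e {..<d} E" using exists_enumeration by blast
  have "\<exists>D. ?P D" using reduced_basis_integral[OF rb] e unfolding field_degree_eq E_def by blast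
  then have "?P (SOME D. ?P D)" by (rule someI_ex)
  then obtain w e where we: "integral_basis K w" "bij_betw e {..<d} E"
    "(SOME D. ?P D) = (det (mat d d (\<lambda>(i, j). e i (w j)))) ^ 2"
    unfolding field_degree_eq E_def by blast
  let ?D = "det (mat d d (\<lambda>(i, j). e i (w j)))"
  have "discriminant K = Re (?D\<^sup>2)" unfolding discriminant_def we(3) ..
  moreover have "?D\<^sup>2 \<in> \<real>" by (rule det_embeddings(3)[OF rb we(1,2)])
  ultimately have "\<bar>discriminant K\<bar> = cmod (?D\<^sup>2)" by (auto elim!: Reals_cases simp: norm_of_real)
  also have "\<dots> = (\<Prod>i<d. g i)\<^sup>2" using det_embeddings(1)[OF rb we(1,2)] by (simp add: norm_power)
  finally show ?thesis .
qed

lemma Tr_diff: "x \<in> K \<Longrightarrow> y \<in> K \<Longrightarrow> Tr (x - y) = Tr x - Tr y"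
  unfolding Tr_def sum_subtractf[symmetric] by (intro sum.cong refl) (simp add: emb_diff)

lemma Tr_of_rat_mult: "x \<in> K \<Longrightarrow> Tr (of_rat q * x) = of_rat q * Tr x"
  unfolding Tr_def sum_distrib_left by (intro sum.cong refl) (simp add: emb_mult emb_of_rat of_rat_in_K)

lemma Tr_sum: "(\<And>i. i \<in> A \<Longrightarrow> h i \<in> K) \<Longrightarrow> Tr (sum h A) = (\<Sum>i\<in>A. Tr (h i))"
  unfolding Tr_def by (subst sum.swap) (intro sum.cong refl, simp add: emb_sum)

lemma Tr_of_int_mult: "x \<in> K \<Longrightarrow> Tr (of_int q * x) = of_int q * Tr x"
  using Tr_of_rat_mult[of x "of_int q"] by simp

text \<open>The inverse different, that is, the dual of \<open>OK\<close> under the bilinear trace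
  form.\<close>

definition dual_lattice :: "real set" where
  "dual_lattice = {y \<in> K. \<forall>x\<in>OK. Tr (x * y) \<in> \<int>}"

lemma dual_lattice_diff: "x \<in> dual_lattice \<Longrightarrow> y \<in> dual_lattice \<Longrightarrow> x - y \<in> dual_lattice"
  unfolding dual_lattice_def using OK_D
  by (auto simp: K_diff right_diff_distrib Tr_diff K_mult)

lemma dual_lattice_OK_mult:
  assumes "a \<in> OK" "y \<in> dual_lattice"
  shows "a * y \<in> dual_lattice"
  unfolding dual_lattice_def
proof (intro CollectI conjI ballI)
  show "a * y \<in> K" using assms OK_D K_mult by (auto simp: dual_lattice_def)
  fix x assume "x \<in> OK"
  then have "Tr ((x * a) * y) \<in> \<int>" using assms OK_mult by (auto simp: dual_lattice_def)
  then show "Tr (x * (a * y)) \<in> \<int>" by (simp add: mult.assoc)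
qed

lemma one_dual_lattice: "1 \<in> dual_lattice"
  using of_int_in_K[of 1] Tr_OK by (auto simp: dual_lattice_def)

text \<open>The trace matrix of the basis is integral, and its determinant is non-zero because its
  absolute value is that of the Gram determinant. A column of the adjugate divided by the
  determinant gives rational coordinates of the dual vector.\<close>

lemma dual_basis:
  assumes rb: "reduced_basis (\<lambda>_. 1) m b g c"
    and k: "k < d"
  shows "\<exists>v\<in>dual_lattice. \<forall>i<d. Tr (b i * v) = (if i = k then 1 else 0)"
proof -
  note fl = reduced_basisD(1)[OF rb]
    and span = reduced_basisD(2)[OF rb]
  have bas: "integral_basis K b" by (rule reduced_basis_integral[OF rb])
  have bO: "\<And>i. i < d \<Longrightarrow> b i \<in> OK" using integral_basisD(1)[OF bas] .
  have bK: "\<And>i. i < d \<Longrightarrow> b i \<in> K" using bO OK_D by blast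
  have "\<forall>ij. \<exists>t :: int. fst ij < d \<longrightarrow> snd ij < d \<longrightarrow> Tr (b (fst ij) * b (snd ij)) = of_int t"
    using Tr_OK OK_mult bO by (metis Ints_cases)
  from choice[OF this] obtain t :: "nat \<times> nat \<Rightarrow> int" where t: "\<And>i j. i < d \<Longrightarrow> j < d \<Longrightarrow> Tr (b i * b j) = of_int (t (i, j))"
    by force
  define T where "T = mat d d t"
  have T: "T \<in> carrier_mat d d" by (simp add: T_def)
  obtain e where e: "bij_betw e {..<d} E" using exists_enumeration by blast
  let ?D = "det (mat d d (\<lambda>(i, j). e i (b j)))"
  have "map_mat of_int T = mat d d (\<lambda>(i, j). Tr (b i * b j))"
    by (rule eq_matI) (auto simp: T_def t)
  then have "?D\<^sup>2 = of_int (det T)"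
    using det_embeddings(2)[OF rb bas e] of_int_hom.hom_det by metis
  moreover have "?D \<noteq> 0"
  proof
    assume "?D = 0"
    then have "(\<Prod>i<d. g i)\<^sup>2 = 0" using det_embeddings(1)[OF rb bas e] by simp
    then show False using fl by (auto simp: reduced_flag_def)
  qed
  ultimately have det: "det T \<noteq> 0" by (metis of_int_0 power_eq_0_iff)
  define N where "N = adj_mat T"
  have N: "N \<in> carrier_mat d d" "T * N = det T \<cdot>\<^sub>m 1\<^sub>m d" using adj_mat[OF T] by (auto simp: N_def)
  define q :: "nat \<Rightarrow> rat" where "q j = of_int (N $$ (j, k)) / of_int (det T)" for j
  define v where "v = (\<Sum>j<d. of_rat (q j) * b j)"
  have vK: "v \<in> K" unfolding v_def using bK K_mult of_rat_in_K by (intro K_sum) auto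
  have tr: "Tr (b i * v) = (if i = k then 1 else 0)" if i: "i < d" for i
  proof -
    have "Tr (b i * v) = (\<Sum>j<d. Tr (of_rat (q j) * (b i * b j)))"
      unfolding v_def sum_distrib_left
      by (subst Tr_sum) (use bK i K_mult of_rat_in_K in \<open>auto simp: mult_ac\<close>)
    also have "\<dots> = (\<Sum>j<d. of_rat (q j) * of_int (t (i, j)))"
      using bK i K_mult t by (intro sum.cong refl) (simp add: Tr_of_rat_mult)
    also have "\<dots> = (\<Sum>j<d. of_int (t (i, j) * N $$ (j, k))) / of_int (det T)"
      unfolding sum_divide_distrib by (intro sum.cong refl) (simp add: q_def of_rat_divide)
    also have "\<dots> = of_int ((T * N) $$ (i, k)) / of_int (det T)"
      using N(1) i k by (simp add: T_def scalar_prod_def atLeast0LessThan)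
    also have "\<dots> = (if i = k then 1 else 0)" unfolding N(2) using i k det by simp
    finally show ?thesis .
  qed
  have "v \<in> dual_lattice"
    unfolding dual_lattice_def
  proof (intro CollectI conjI ballI)
    fix x assume "x \<in> OK"
    then obtain n :: "nat \<Rightarrow> int" where n: "x = (\<Sum>i<d. of_int (n i) * b i)" using span by blast
    have "Tr (x * v) = (\<Sum>i<d. Tr (of_int (n i) * (b i * v)))"
      unfolding n sum_distrib_right
      by (subst Tr_sum) (use bK vK K_mult of_int_in_K in \<open>auto simp: mult.assoc\<close>)
    also have "\<dots> = (\<Sum>i<d. of_int (n i) * (if i = k then 1 else 0))"
      using bK vK K_mult tr by (intro sum.cong refl) (simp add: Tr_of_int_mult)
    also have "\<dots> = of_int (n k)" by (subst sum_single[of _ k]) (use k in auto)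
    finally show "Tr (x * v) \<in> \<int>" by simp
  qed (rule vK)
  then show ?thesis using tr by blast
qed

text \<open>The diagonal decomposition is known on \<open>OK\<close> only. Bilinearity carries it
  over to real combinations of the embedded basis, which is where the conjugates of dual vectors
  live.\<close>

lemma real_combination_form:
  assumes rb: "reduced_basis (\<lambda>_. 1) m b g c"
  shows "(\<Sum>\<sigma>\<in>E. Re ((\<Sum>i<d. of_real (s i) * \<sigma> (b i)) * cnj (\<Sum>k<d. of_real (t k) * \<sigma> (b k))))
     = (\<Sum>j<d. (g j * (\<Sum>i<d. s i * c j (b i))) * (g j * (\<Sum>k<d. t k * c j (b k))))"
proof -
  note dec = reduced_basisD(3)[OF rb]
  have bO: "\<And>i. i < d \<Longrightarrow> b i \<in> OK" using reduced_basisD(1)[OF rb] by (simp add: reduced_flag_def)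
  have "(\<Sum>\<sigma>\<in>E. Re ((\<Sum>i<d. of_real (s i) * \<sigma> (b i)) * cnj (\<Sum>k<d. of_real (t k) * \<sigma> (b k))))
     = (\<Sum>\<sigma>\<in>E. \<Sum>i<d. \<Sum>k<d. s i * t k * Re (\<sigma> (b i) * cnj (\<sigma> (b k))))"
    unfolding cnj_sum sum_product Re_sum by (intro sum.cong refl) (simp add: algebra_simps)
  also have "\<dots> = (\<Sum>i<d. \<Sum>k<d. s i * t k * tform (\<lambda>_. 1) (b i) (b k))"
    unfolding tform_def sum_distrib_left mult_1_left
    by (subst sum.swap, intro sum.cong refl, subst sum.swap) simp
  also have "\<dots> = (\<Sum>i<d. \<Sum>k<d. \<Sum>j<d. s i * t k * ((g j)\<^sup>2 * c j (b i) * c j (b k)))"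
    using bO dec by (simp add: sum_distrib_left)
  also have "\<dots> = (\<Sum>j<d. \<Sum>i<d. \<Sum>k<d. s i * t k * ((g j)\<^sup>2 * c j (b i) * c j (b k)))"
    by (subst sum.swap, subst (2) sum.swap) (rule refl)
  also have "\<dots> = (\<Sum>j<d. (g j * (\<Sum>i<d. s i * c j (b i))) * (g j * (\<Sum>k<d. t k * c j (b k))))"
  proof (intro sum.cong refl)
    fix j
    have "(\<Sum>i<d. \<Sum>k<d. s i * t k * ((g j)\<^sup>2 * c j (b i) * c j (b k)))
       = (\<Sum>i<d. \<Sum>k<d. (g j)\<^sup>2 * ((s i * c j (b i)) * (t k * c j (b k))))"
      by (intro sum.cong refl) (simp add: mult_ac)
    also have "\<dots> = (g j)\<^sup>2 * ((\<Sum>i<d. s i * c j (b i)) * (\<Sum>k<d. t k * c j (b k)))"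
      by (subst sum_product) (simp only: sum_distrib_left)
    also have "\<dots> = (g j * (\<Sum>i<d. s i * c j (b i))) * (g j * (\<Sum>k<d. t k * c j (b k)))"
      by (simp only: power2_eq_square mult_ac)
    finally show "(\<Sum>i<d. \<Sum>k<d. s i * t k * ((g j)\<^sup>2 * c j (b i) * c j (b k)))
       = (g j * (\<Sum>i<d. s i * c j (b i))) * (g j * (\<Sum>k<d. t k * c j (b k)))" .
  qed
  finally show ?thesis .
qed

text \<open>The conjugated vector of an element of \<open>K\<close> is in general not the image of
  any element of \<open>K\<close>. It does lie in \<open>KR K\<close>, so it has real coordinates in
  the powers of \<open>l\<close> and therefore in the basis \<open>b\<close>.\<close>

lemma cnj_coordinates:
  assumes rb: "reduced_basis \<alpha> m b g c"
  shows "\<exists>t :: nat \<Rightarrow> real. \<forall>\<sigma>\<in>E. cnj (\<sigma> y) = (\<Sum>i<d. of_real (t i) * \<sigma> (b i))"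
proof -
  note span = reduced_basisD(2)[OF rb]
  have bO: "\<And>i. i < d \<Longrightarrow> b i \<in> OK" using reduced_basisD(1)[OF rb] by (simp add: reduced_flag_def)
  define z where "z \<sigma> = (if \<sigma> \<in> E then cnj (\<sigma> y) else 0)" for \<sigma>
  have "z \<in> KR K" using cnj_E by (auto simp: KR_def E_def[symmetric] z_def)
  then obtain r :: "nat \<Rightarrow> real" where r: "\<And>\<sigma>. \<sigma> \<in> E \<Longrightarrow> z \<sigma> = (\<Sum>j<d. of_real (r j) * \<sigma> l ^ j)"
    using KR_power_coordinates by blast
  have "\<forall>j. \<exists>n :: nat \<Rightarrow> int. l ^ j = (\<Sum>i<d. of_int (n i) * b i)" using span OK_power l_in_OK by blast
  from choice[OF this] obtain n :: "nat \<Rightarrow> nat \<Rightarrow> int" where n: "\<And>j. l ^ j = (\<Sum>i<d. of_int (n j i) * b i)" by blast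
  have bK: "\<And>i. i < d \<Longrightarrow> b i \<in> K" using bO OK_D by blast
  have nb: "of_int k * b i \<in> K" if "i < d" for i k using K_mult[OF of_int_in_K bK[OF that]] .
  have "cnj (\<sigma> y) = (\<Sum>i<d. of_real (\<Sum>j<d. r j * of_int (n j i)) * \<sigma> (b i))" if s: "\<sigma> \<in> E" for \<sigma>
  proof -
    have p: "\<sigma> l ^ j = (\<Sum>i<d. of_int (n j i) * \<sigma> (b i))" for j
    proof -
      have "\<sigma> l ^ j = \<sigma> (l ^ j)" by (simp add: emb_power[OF s l_in_K])
      also have "\<dots> = (\<Sum>i<d. \<sigma> (of_int (n j i) * b i))"
        unfolding n by (rule emb_sum[OF s]) (use nb in auto)
      also have "\<dots> = (\<Sum>i<d. of_int (n j i) * \<sigma> (b i))"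
        by (intro sum.cong refl emb_of_int_mult[OF s]) (use bK in auto)
      finally show ?thesis .
    qed
    have "cnj (\<sigma> y) = (\<Sum>j<d. of_real (r j) * \<sigma> l ^ j)" using r[OF s] s by (simp add: z_def)
    also have "\<dots> = (\<Sum>j<d. \<Sum>i<d. of_real (r j * of_int (n j i)) * \<sigma> (b i))"
      unfolding p by (simp add: sum_distrib_left mult.assoc)
    also have "\<dots> = (\<Sum>i<d. of_real (\<Sum>j<d. r j * of_int (n j i)) * \<sigma> (b i))"
      by (subst sum.swap) (simp add: sum_distrib_right)
    finally show ?thesis .
  qed
  then show ?thesis by (intro exI[of _ "\<lambda>i. \<Sum>j<d. r j * of_int (n j i)"]) simp
qed

text \<open>Forward substitution: \<open>c j (b i)\<close> vanishes for \<open>j > i\<close> and is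
  1 for \<open>j = i\<close>.\<close>

lemma triangular_solution:
  assumes fl: "reduced_flag OK B m d b g c"
    and eq: "\<And>i. i < k \<Longrightarrow> (\<Sum>j<d. g j * c j (b i) * X j) = 0" and k: "k < d"
  shows "j < k \<Longrightarrow> X j = 0" and "(\<Sum>j<d. g j * c j (b k) * X j) = g k * X k"
proof -
  have collapse: "(\<Sum>j<d. g j * c j (b i) * X j) = g i * X i"
    if i: "i < d" and z: "\<And>p. p < i \<Longrightarrow> X p = 0" for i
  proof -
    have "(\<Sum>j<d. g j * c j (b i) * X j) = g i * c i (b i) * X i"
    proof (rule sum_single)
      fix p assume "p \<in> {..<d}" "p \<noteq> i"
      then consider "p < i" | "i < p" "p < d" by force
      then show "g p * c p (b i) * X p = 0" using z fl by cases (auto simp: reduced_flag_def)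
    qed (use i in auto)
    then show ?thesis using fl i by (simp add: reduced_flag_def)
  qed
  have zero: "X j = 0" if "j < k" for j
    using that
  proof (induction j rule: less_induct)
    case (less j)
    then have "g j * X j = 0" using collapse[of j] eq[of j] k by simp
    moreover have "g j > 0" using fl less k by (auto simp: reduced_flag_def)
    ultimately show ?case by simp
  qed
  then show "j < k \<Longrightarrow> X j = 0" .
  show "(\<Sum>j<d. g j * c j (b k) * X j) = g k * X k" by (rule collapse[OF k]) (rule zero)
qed

text \<open>\<open>Y y\<close> lists the coordinates of the complex conjugate of \<open>y\<close> with respect to the orthonormalised
basis \<open>b\<close>. The conjugate enters because the trace form is bilinear, not sesquilinear.\<close>

lemma dual_coordinates:
  assumes rb: "reduced_basis (\<lambda>_. 1) m b g c"
  shows "\<exists>Y :: real \<Rightarrow> nat \<Rightarrow> real.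
    (\<forall>s. \<forall>x\<in>K. \<forall>y\<in>K. (\<Sum>\<sigma>\<in>E. (cmod (of_real s * \<sigma> x - \<sigma> y))\<^sup>2) = (\<Sum>j<d. (s * Y x j - Y y j)\<^sup>2)) \<and>
    (\<forall>y\<in>K. \<forall>i<d. Re (Tr (b i * y)) = (\<Sum>j<d. g j * c j (b i) * Y y j))"
proof -
  note fl = reduced_basisD(1)[OF rb]
  have bO: "\<And>i. i < d \<Longrightarrow> b i \<in> OK" using fl by (simp add: reduced_flag_def)
  have bK: "\<And>i. i < d \<Longrightarrow> b i \<in> K" using bO OK_D by blast
  have "\<forall>y. \<exists>t :: nat \<Rightarrow> real. \<forall>\<sigma>\<in>E. cnj (\<sigma> y) = (\<Sum>i<d. of_real (t i) * \<sigma> (b i))"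
    using cnj_coordinates[OF rb] by blast
  from choice[OF this] obtain t :: "real \<Rightarrow> nat \<Rightarrow> real"
    where t: "\<And>y \<sigma>. \<sigma> \<in> E \<Longrightarrow> cnj (\<sigma> y) = (\<Sum>i<d. of_real (t y i) * \<sigma> (b i))" by blast
  define Y where "Y y j = g j * (\<Sum>i<d. t y i * c j (b i))" for y j
  note form = real_combination_form[OF rb]
  have "(\<Sum>\<sigma>\<in>E. (cmod (of_real s * \<sigma> x - \<sigma> y))\<^sup>2) = (\<Sum>j<d. (s * Y x j - Y y j)\<^sup>2)" for s x y
  proof -
    let ?u = "\<lambda>i. s * t x i - t y i"
    have "(\<Sum>\<sigma>\<in>E. (cmod (of_real s * \<sigma> x - \<sigma> y))\<^sup>2)
       = (\<Sum>\<sigma>\<in>E. Re ((\<Sum>i<d. of_real (?u i) * \<sigma> (b i)) * cnj (\<Sum>k<d. of_real (?u k) * \<sigma> (b k))))"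
    proof (intro sum.cong refl)
      fix \<sigma> assume s: "\<sigma> \<in> E"
      have "cnj (of_real s * \<sigma> x - \<sigma> y) = (\<Sum>i<d. of_real (?u i) * \<sigma> (b i))"
        by (simp add: t[OF s] sum_distrib_left sum_subtractf algebra_simps)
      then show "(cmod (of_real s * \<sigma> x - \<sigma> y))\<^sup>2
         = Re ((\<Sum>i<d. of_real (?u i) * \<sigma> (b i)) * cnj (\<Sum>k<d. of_real (?u k) * \<sigma> (b k)))"
        unfolding Re_mult_cnj_self by (metis complex_mod_cnj)
    qed
    also have "\<dots> = (\<Sum>j<d. (g j * (\<Sum>i<d. ?u i * c j (b i))) * (g j * (\<Sum>k<d. ?u k * c j (b k))))" by (rule form)
    also have "\<dots> = (\<Sum>j<d. (s * Y x j - Y y j)\<^sup>2)"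
    proof (intro sum.cong refl)
      fix j
      have "g j * (\<Sum>i<d. ?u i * c j (b i)) = s * Y x j - Y y j"
        by (simp add: Y_def left_diff_distrib sum_subtractf right_diff_distrib sum_distrib_left mult_ac)
      then show "(g j * (\<Sum>i<d. ?u i * c j (b i))) * (g j * (\<Sum>k<d. ?u k * c j (b k))) = (s * Y x j - Y y j)\<^sup>2"
        by (simp add: power2_eq_square)
    qed
    finally show ?thesis .
  qed
  moreover have "Re (Tr (b i * y)) = (\<Sum>j<d. g j * c j (b i) * Y y j)" if y: "y \<in> K" and i: "i < d" for y i
  proof -
    let ?s = "\<lambda>k. if k = i then 1 else 0 :: real"
    have single: "(\<Sum>k<d. of_real (?s k) * h k) = h i" for h :: "nat \<Rightarrow> complex"
      using sum_single[of "{..<d}" i "\<lambda>k. of_real (?s k) * h k"] i by simp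
    have single': "(\<Sum>k<d. ?s k * h k) = h i" for h :: "nat \<Rightarrow> real"
      using sum_single[of "{..<d}" i "\<lambda>k. ?s k * h k"] i by simp
    have "Re (Tr (b i * y)) = (\<Sum>\<sigma>\<in>E. Re (\<sigma> (b i) * \<sigma> y))"
      unfolding Tr_def Re_sum using bK[OF i] y by (intro sum.cong refl) (simp add: emb_mult)
    also have "\<dots> = (\<Sum>\<sigma>\<in>E. Re ((\<Sum>k<d. of_real (?s k) * \<sigma> (b k)) * cnj (\<Sum>k<d. of_real (t y k) * \<sigma> (b k))))"
      unfolding single by (intro sum.cong refl) (simp add: t[symmetric])
    also have "\<dots> = (\<Sum>j<d. (g j * (\<Sum>k<d. ?s k * c j (b k))) * (g j * (\<Sum>k<d. t y k * c j (b k))))" by (rule form)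
    also have "\<dots> = (\<Sum>j<d. g j * c j (b i) * Y y j)" unfolding single' Y_def ..
    finally show ?thesis .
  qed
  ultimately show ?thesis by blast
qed

end

section \<open>The bound by the discriminant\<close>

context perron_number
begin

lemma PF_degree_le_discriminant:
  assumes large: "l > 1 + 4 / (1 - \<rho>)"
  shows "real (PF_degree l) \<le> (61 * real d * 2 ^ d / (1 - \<rho>)) ^ d * sqrt \<bar>discriminant K\<bar>"
proof -
  obtain b g c where rb: "reduced_basis (\<lambda>_. 1) 1 b g c"
    using exists_reduced_integral_basis[of "\<lambda>_. 1" 1] by auto
  note fl = reduced_basisD(1)[OF rb]
  have g: "g i > 0" if "i < d" for i using fl that by (auto simp: reduced_flag_def)
  have bO: "\<And>i. i < d \<Longrightarrow> b i \<in> OK" using fl by (simp add: reduced_flag_def)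
  have bK: "\<And>i. i < d \<Longrightarrow> b i \<in> K" using bO OK_D by blast
  \<comment> \<open>With \<open>m = 1\<close> the reduction gives
    \<open>(g i)^2 \<ge> (3 / 4) ^ i\<close>, weakened to \<open>(1 / 4) ^ d\<close>.\<close>
  have g_low: "1 \<le> 2 ^ d * g i" if i: "i < d" for i
  proof (rule power2_le_imp_le)
    have "(1 / 4 :: real) ^ d \<le> (1 / 4) ^ i" using i by (intro power_decreasing) auto
    also have "\<dots> \<le> (3 / 4) ^ i" by (intro power_mono) auto
    also have "\<dots> \<le> (g i)\<^sup>2" using fl i by (auto simp: reduced_flag_def)
    finally have "4 ^ d * (1 / 4 :: real) ^ d \<le> 4 ^ d * (g i)\<^sup>2" by (intro mult_left_mono) auto
    then show "1\<^sup>2 \<le> (2 ^ d * g i)\<^sup>2"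
      by (simp add: power_mult_distrib[symmetric] power_mult[symmetric] power_mult_distrib power_one_over)
         (simp add: power_mult mult.commute[of d 2])
  qed (use g[OF i] in simp)
  obtain Y :: "real \<Rightarrow> nat \<Rightarrow> real"
    where Y_norm: "\<And>s x y. x \<in> K \<Longrightarrow> y \<in> K \<Longrightarrow>
        (\<Sum>\<sigma>\<in>E. (cmod (of_real s * \<sigma> x - \<sigma> y))\<^sup>2) = (\<Sum>j<d. (s * Y x j - Y y j)\<^sup>2)"
      and Y_Tr: "\<And>y i. y \<in> K \<Longrightarrow> i < d \<Longrightarrow> Re (Tr (b i * y)) = (\<Sum>j<d. g j * c j (b i) * Y y j)"
    using dual_coordinates[OF rb] by blast
  have LK: "y \<in> K" if "y \<in> dual_lattice" for y using that by (simp add: dual_lattice_def)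
  have Y_diff: "(\<Sum>j<d. g j * c j (b i) * (Y x j - Y y j)) = Re (Tr (b i * x)) - Re (Tr (b i * y))"
    if "x \<in> K" "y \<in> K" "i < d" for x y i
    using that by (simp add: Y_Tr right_diff_distrib sum_subtractf)
  define R where "R = real d * 2 ^ d"
  have R: "R > 0" using d_pos by (simp add: R_def)
  \<comment> \<open>Nearest-plane rounding in the dual lattice: the coordinates are corrected in the
    order 0, 1, and so on. The \<open>k\<close>-th dual basis vector changes coordinate
    \<open>k\<close> by \<open>1 / g k\<close> and leaves the earlier ones alone, so each ends up
    within \<open>1 / (2 * g k)\<close>, below \<open>2 ^ d\<close>.\<close>
  have approx: "\<exists>y\<in>dual_lattice. \<forall>j<k. \<bar>s * Y x j - Y y j\<bar> \<le> 2 ^ d" if k: "k \<le> d" and x: "x \<in> dual_lattice" for k s x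
    using k
  proof (induction k)
    case 0
    then show ?case using one_dual_lattice by auto
  next
    case (Suc k)
    then have k: "k < d" by simp
    obtain y where y: "y \<in> dual_lattice" "\<And>j. j < k \<Longrightarrow> \<bar>s * Y x j - Y y j\<bar> \<le> 2 ^ d" using Suc by auto
    obtain v where v: "v \<in> dual_lattice" "\<And>i. i < d \<Longrightarrow> Tr (b i * v) = (if i = k then 1 else 0)"
      using dual_basis[OF rb k] by blast
    define n where "n = round (g k * (s * Y x k - Y y k))"
    \<comment> \<open>This is \<open>y + n * v\<close>, written as a difference to match the closure
      property of the dual lattice.\<close>
    define y' where "y' = y - of_int (- n) * v"
    have y': "y' \<in> dual_lattice"
      unfolding y'_def by (intro dual_lattice_diff dual_lattice_OK_mult of_int_in_OK y v)
    have trd: "Re (Tr (b i * y')) - Re (Tr (b i * y)) = (if i = k then of_int n else 0)" if i: "i < d" for i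
    proof -
      have "b i * y' = b i * y - of_int (- n) * (b i * v)" by (simp add: y'_def algebra_simps)
      then have "Tr (b i * y') = Tr (b i * y) - of_int (- n) * Tr (b i * v)"
        using Tr_diff[of "b i * y" "of_int (- n) * (b i * v)"] Tr_of_int_mult[of "b i * v" "- n"]
          K_mult[OF bK[OF i] LK[OF y(1)]] K_mult[OF bK[OF i] LK[OF v(1)]] K_mult[OF of_int_in_K] by metis
      then show ?thesis using v(2)[OF i] by simp
    qed
    define X where "X j = Y y' j - Y y j" for j
    have X_eq: "(\<Sum>j<d. g j * c j (b i) * X j) = (if i = k then of_int n else 0)" if i: "i < d" for i
      unfolding X_def Y_diff[OF LK[OF y'] LK[OF y(1)] i] by (rule trd[OF i])
    have X0: "\<And>i. i < k \<Longrightarrow> (\<Sum>j<d. g j * c j (b i) * X j) = 0" using X_eq k by simp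
    have small: "X j = 0" if "j < k" for j by (rule triangular_solution(1)[OF fl X0 k that])
    have "g k * X k = of_int n"
      using triangular_solution(2)[OF fl X0 k] X_eq[OF k] by simp
    then have "g k * (s * Y x k - Y y' k) = g k * (s * Y x k - Y y k) - of_int n" by (simp add: X_def algebra_simps)
    then have "\<bar>g k * (s * Y x k - Y y' k)\<bar> \<le> 1 / 2" unfolding n_def by (metis of_int_round_abs_le abs_minus_commute)
    then have "g k * \<bar>s * Y x k - Y y' k\<bar> \<le> 1" using g[OF k] by (simp add: abs_mult)
    also have "1 \<le> g k * 2 ^ d" using g_low[OF k] by (simp add: mult.commute)
    finally have "\<bar>s * Y x k - Y y' k\<bar> \<le> 2 ^ d" using g[OF k] by simp
    moreover have "\<bar>s * Y x j - Y y' j\<bar> \<le> 2 ^ d" if "j < k" for j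
      using y(2)[OF that] small[OF that] by (simp add: X_def)
    ultimately show ?case using y' less_Suc_eq by (intro bexI[OF _ y']) auto
  qed
  have cover: "\<exists>y\<in>dual_lattice. (\<Sum>\<sigma>\<in>E. 1 * (cmod (of_real s * \<sigma> x - \<sigma> y))\<^sup>2) \<le> R\<^sup>2" if x: "x \<in> dual_lattice" for x s
  proof -
    obtain y where y: "y \<in> dual_lattice" "\<And>j. j < d \<Longrightarrow> \<bar>s * Y x j - Y y j\<bar> \<le> 2 ^ d"
      using approx[OF order_refl x, of s] by blast
    have "(\<Sum>\<sigma>\<in>E. 1 * (cmod (of_real s * \<sigma> x - \<sigma> y))\<^sup>2) = (\<Sum>j<d. (s * Y x j - Y y j)\<^sup>2)"
      using Y_norm[OF LK[OF x] LK[OF y(1)]] by simp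
    also have "\<dots> \<le> (\<Sum>j<d. (2 ^ d)\<^sup>2)"
    proof (rule sum_mono)
      fix j assume "j \<in> {..<d}"
      then have "\<bar>s * Y x j - Y y j\<bar> \<le> \<bar>2 ^ d\<bar>" using y(2) by simp
      then show "(s * Y x j - Y y j)\<^sup>2 \<le> (2 ^ d)\<^sup>2" by (simp only: abs_le_square_iff)
    qed
    also have "\<dots> = real d * (2 ^ d)\<^sup>2" by simp
    also have "\<dots> \<le> (real d)\<^sup>2 * (2 ^ d)\<^sup>2" using d_pos by (intro mult_right_mono) (auto simp: power2_eq_square)
    also have "\<dots> = R\<^sup>2" by (simp add: R_def power_mult_distrib)
    finally show ?thesis using y(1) by blast
  qed
  define r where "r = 30 * R / (1 - \<rho>)"
  have \<rho>1: "1 - \<rho> > 0" "1 - \<rho> \<le> 1" using \<rho>_nonneg \<rho>_less_1 by auto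
  have r: "r > 0" using R \<rho>1 by (simp add: r_def)
  let ?S = "{x \<in> dual_lattice. (\<Sum>\<sigma>\<in>E. 1 * (cmod (\<sigma> x))\<^sup>2) \<le> r\<^sup>2}"
  have count: "finite ?S \<and> real (card ?S) \<le> (\<Prod>i<d. 1 + 2 * r / (1 / g i))"
  \<comment> \<open>In the dual the coordinates are taken in ascending order: once the earlier ones
    agree, integrality of \<open>Tr (b i * x)\<close> determines the next one modulo
    \<open>1 / g i\<close>.\<close>
  proof (rule card_le_prod_of_coordinates[where Y = "\<lambda>i x. Y x i"])
    fix i x assume i: "i < d" and x: "x \<in> ?S"
    have "(Y x i)\<^sup>2 \<le> (\<Sum>j<d. (Y x j)\<^sup>2)" using i by (intro member_le_sum[of i "{..<d}" "\<lambda>j. (Y x j)\<^sup>2"]) auto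
    also have "\<dots> = (\<Sum>\<sigma>\<in>E. 1 * (cmod (\<sigma> x))\<^sup>2)" using Y_norm[of x x 0] LK x by simp
    also have "\<dots> \<le> r\<^sup>2" using x by simp
    finally show "\<bar>Y x i\<bar> \<le> r" using r by (metis abs_le_square_iff abs_of_pos)
  next
    fix i x y assume i: "i < d" and xy: "x \<in> ?S" "y \<in> ?S" and eq: "\<And>j. j < i \<Longrightarrow> Y x j = Y y j"
    have K: "x \<in> K" "y \<in> K" using xy LK by auto
    have "(\<Sum>j<d. g j * c j (b i) * (Y x j - Y y j)) = g i * c i (b i) * (Y x i - Y y i)"
    proof (rule sum_single)
      fix p assume "p \<in> {..<d}" "p \<noteq> i"
      then consider "p < i" | "i < p" "p < d" by force
      then show "g p * c p (b i) * (Y x p - Y y p) = 0" using eq fl by cases (auto simp: reduced_flag_def)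
    qed (use i in auto)
    also have "\<dots> = g i * (Y x i - Y y i)" using fl i by (simp add: reduced_flag_def)
    finally have e: "g i * (Y x i - Y y i) = Re (Tr (b i * x)) - Re (Tr (b i * y))" using Y_diff[OF K i] by simp
    have "Tr (b i * x) \<in> \<int>" "Tr (b i * y) \<in> \<int>" using xy bO[OF i] by (auto simp: dual_lattice_def)
    then obtain p q :: int where "Tr (b i * x) = of_int p" "Tr (b i * y) = of_int q" by (auto elim!: Ints_cases)
    then have "g i * (Y x i - Y y i) = of_int (p - q)" using e by simp
    then have "Y x i - Y y i = of_int (p - q) * (1 / g i)" using g[OF i] by (simp add: field_simps)
    then show "\<exists>k :: int. Y x i - Y y i = of_int k * (1 / g i)" by blast
  next
    fix x y assume xy: "x \<in> ?S" "y \<in> ?S" and eq: "\<And>j. j < d \<Longrightarrow> Y x j = Y y j"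
    have K: "x \<in> K" "y \<in> K" using xy LK by auto
    have "(\<Sum>\<sigma>\<in>E. (cmod (of_real 1 * \<sigma> x - \<sigma> y))\<^sup>2) = 0" unfolding Y_norm[OF K] using eq by simp
    then have "\<forall>\<sigma>\<in>E. (cmod (of_real 1 * \<sigma> x - \<sigma> y))\<^sup>2 = 0" using finite_E by (subst (asm) sum_nonneg_eq_0_iff) auto
    then have "idE x = idE y" using idE_in_E by auto
    then show "x = y" using K by (simp add: idE_def)
  qed (use g r in auto)
  have "PF_degree l \<le> card {x \<in> dual_lattice. (\<Sum>\<sigma>\<in>E. 1 * (cmod (\<sigma> x))\<^sup>2) \<le> (30 * R / (1 - \<rho>))\<^sup>2}"
  proof (rule PF_degree_le_lattice_points[where \<alpha> = "\<lambda>_. 1", OF finite_E idE_in_E])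
    show "idE x = complex_of_real x" if "x \<in> dual_lattice" for x using LK[OF that] by (simp add: idE_def)
    show "1 \<in> dual_lattice" by (rule one_dual_lattice)
    show "l * x \<in> dual_lattice" if "x \<in> dual_lattice" for x by (rule dual_lattice_OK_mult[OF l_in_OK that])
    show "finite {x \<in> dual_lattice. (\<Sum>\<sigma>\<in>E. 1 * (cmod (\<sigma> x))\<^sup>2) \<le> (30 * R / (1 - \<rho>))\<^sup>2}"
      using count unfolding r_def by blast
    show "\<exists>y\<in>dual_lattice. (\<Sum>\<sigma>\<in>E. 1 * (cmod (of_real s * \<sigma> x - \<sigma> y))\<^sup>2) \<le> R\<^sup>2" if "x \<in> dual_lattice" for x s
      by (rule cover[OF that])
    show "\<sigma> (x - y) = \<sigma> x - \<sigma> y" if "\<sigma> \<in> E" "x \<in> dual_lattice" "y \<in> dual_lattice" for \<sigma> x y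
      using emb_diff[OF that(1)] LK that by simp
    show "\<sigma> (l * x) = \<sigma> l * \<sigma> x" if "\<sigma> \<in> E" "x \<in> dual_lattice" for \<sigma> x
      using emb_mult[OF that(1) l_in_K] LK that by simp
  qed (use dual_lattice_diff emb_contract R \<rho>_nonneg \<rho>_less_1 large in auto)
  then have "real (PF_degree l) \<le> real (card ?S)" unfolding r_def by simp
  also have "\<dots> \<le> (\<Prod>i<d. 1 + 2 * r / (1 / g i))" using count by blast
  also have "\<dots> \<le> (\<Prod>i<d. 61 * real d * 2 ^ d / (1 - \<rho>) * g i)"
  proof (rule prod_mono, intro conjI)
    fix i assume "i \<in> {..<d}"
    then have i: "i < d" by simp
    show "0 \<le> 1 + 2 * r / (1 / g i)" using g[OF i] r by (simp add: add_nonneg_nonneg)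
    have "2 ^ d * 1 \<le> 2 ^ d * real d" using d_pos by (intro mult_left_mono) auto
    then have "2 ^ d \<le> R" by (simp add: R_def mult.commute)
    moreover have "2 ^ d * (1 - \<rho>) \<le> 2 ^ d"
      using mult_left_mono[of "1 - \<rho>" 1 "2 ^ d", unfolded mult_1_right] \<rho>1(2) by simp
    ultimately have "2 ^ d * (1 - \<rho>) \<le> R" by (rule order_trans[rotated])
    then have "2 ^ d \<le> R / (1 - \<rho>)" by (simp only: pos_le_divide_eq[OF \<rho>1(1)])
    \<comment> \<open>The 61 is 1 + 60: \<open>2 ^ d\<close>, which dominates
      \<open>1 / g i\<close>, is at most \<open>R / (1 - \<rho>)\<close>, and \<open>2 * r\<close>
      is 60 times that quantity.\<close>
    then have le: "2 ^ d + 2 * r \<le> 61 * R / (1 - \<rho>)" by (simp add: r_def)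
    have "1 + 2 * r * g i \<le> (2 ^ d + 2 * r) * g i" using g_low[OF i] by (simp add: algebra_simps)
    also have "\<dots> \<le> 61 * R / (1 - \<rho>) * g i" using le g[OF i] by (intro mult_right_mono) auto
    finally show "1 + 2 * r / (1 / g i) \<le> 61 * real d * 2 ^ d / (1 - \<rho>) * g i" by (simp add: R_def mult_ac)
  qed
  also have "\<dots> = (61 * real d * 2 ^ d / (1 - \<rho>)) ^ d * (\<Prod>i<d. g i)" unfolding prod.distrib by simp
  also have "(\<Prod>i<d. g i) = sqrt \<bar>discriminant K\<bar>"
  proof -
    have "(\<Prod>i<d. g i) > 0" using g by (intro prod_pos) auto
    then show ?thesis unfolding abs_discriminant[OF rb] by simp
  qed
  finally show ?thesis .
qed

end

text \<open>After extracting \<open>d\<close>-th roots the right-hand side is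
  \<open>2 ^ d * 8 ^ d * d ^ d * t ^ d\<close> with \<open>t = 1 / (1 - \<rho>)\<close>. Degree at
  least 3 lets \<open>8 ^ d \<ge> 512\<close> absorb both 61 and 63; the factor \<open>2 ^ d\<close>
  of the discriminant bound matches exactly.\<close>

lemma constant_bounds:
  fixes \<rho> :: real
  assumes d: "d \<ge> 3" and \<rho>: "0 \<le> \<rho>" "\<rho> < 1"
  shows "(63 / (1 - \<rho>)) ^ d \<le> 2 ^ (d^2) * (8 * real d / (1 - \<rho>)) ^ (d^2)"
    and "(61 * real d * 2 ^ d / (1 - \<rho>)) ^ d \<le> 2 ^ (d^2) * (8 * real d / (1 - \<rho>)) ^ (d^2)"
proof -
  define t where "t = 1 / (1 - \<rho>)"
  have t: "t \<ge> 1" using \<rho> by (simp add: t_def)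
  have tp: "t \<le> t ^ d" using t d by (intro self_le_power) auto
  have dp: "real d \<le> real d ^ d" using d by (intro self_le_power) auto
  have "2 ^ (d^2) * (8 * real d / (1 - \<rho>)) ^ (d^2) = ((16 * real d * t) ^ d) ^ d"
    unfolding t_def power_mult_distrib[symmetric] power2_eq_square power_mult by (simp add: mult_ac)
  also have "16 * real d * t = 2 * 8 * real d * t" by simp
  also have "(2 * 8 * real d * t) ^ d = 2 ^ d * 8 ^ d * real d ^ d * t ^ d" by (simp only: power_mult_distrib)
  finally have e: "2 ^ (d^2) * (8 * real d / (1 - \<rho>)) ^ (d^2) = (2 ^ d * 8 ^ d * real d ^ d * t ^ d) ^ d" .
  have "(8::real) ^ 3 \<le> 8 ^ d" using d by (intro power_increasing) auto
  then have e8: "(63::real) \<le> 8 ^ d" by simp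
  have "1 * 63 * 1 * t \<le> 2 ^ d * 8 ^ d * real d ^ d * t ^ d"
    using e8 tp t d dp by (intro mult_mono) auto
  then show "(63 / (1 - \<rho>)) ^ d \<le> 2 ^ (d^2) * (8 * real d / (1 - \<rho>)) ^ (d^2)"
    unfolding e using t by (intro power_mono) (use \<rho> in \<open>auto simp: t_def\<close>)
  have "2 ^ d * 61 * real d * t \<le> 2 ^ d * 8 ^ d * real d ^ d * t ^ d"
    using e8 tp t d dp by (intro mult_mono) auto
  then show "(61 * real d * 2 ^ d / (1 - \<rho>)) ^ d \<le> 2 ^ (d^2) * (8 * real d / (1 - \<rho>)) ^ (d^2)"
    unfolding e using t by (intro power_mono) (use \<rho> in \<open>auto simp: t_def mult_ac\<close>)
qed

text \<open>A field with an odd number of pairs of complex embeddings has negative discriminant,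
  which is why the square root is taken of the absolute value.\<close>

theorem theorem1p6:
  fixes l :: real
  assumes "perron l" and "alg_degree l \<ge> 3"
  defines "d \<equiv> alg_degree l" and "\<rho> \<equiv> spectral_ratio l" and "K \<equiv> QQ_adj l"
  shows "real (PF_degree l) \<le> max (2 ^ (d^2) * ((8 * real d / (1 - \<rho>)) ^ (d^2) * tau_min K powr (real d / 2)))
                                   (real (kappa K \<rho>))
       \<and> real (PF_degree l) \<le> max (2 ^ (d^2) * ((8 * real d / (1 - \<rho>)) ^ (d^2) * sqrt \<bar>discriminant K\<bar>))
                                   (real (kappa K \<rho>))"
proof -
  interpret A: algebraic_real l using assms(1) by unfold_locales (simp add: perron_def)
  have Ad: "A.d = d" by (simp add: A.d_def A.f_def d_def alg_degree_def)
  interpret P: perron_number l using assms(1,2) by unfold_locales (simp_all add: Ad d_def)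
  have AK: "A.K = K" by (simp add: A.K_def K_def)
  have P\<rho>: "P.\<rho> = \<rho>" by (simp add: P.\<rho>_def \<rho>_def)
  have \<rho>: "0 \<le> \<rho>" "\<rho> < 1" using P.\<rho>_nonneg P.\<rho>_less_1 P\<rho> by auto
  have d3: "d \<ge> 3" using assms(2) by (simp add: d_def)
  let ?C = "2 ^ (d^2) * (8 * real d / (1 - \<rho>)) ^ (d^2)"
  show ?thesis
  proof (cases "l \<le> 1 + 4 / (1 - \<rho>)")
    case True
    then have "real (PF_degree l) \<le> real (kappa K \<rho>)" using P.PF_degree_le_kappa unfolding P\<rho> AK by simp
    then show ?thesis by (simp add: le_max_iff_disj)
  next
    case False
    then have large: "l > 1 + 4 / (1 - \<rho>)" by simp
    have "real (PF_degree l) \<le> (63 / (1 - \<rho>)) ^ d * tau_min K powr (real d / 2)"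
      using P.PF_degree_le_tau_min large unfolding P\<rho> AK Ad by simp
    also have "\<dots> \<le> ?C * tau_min K powr (real d / 2)"
      by (intro mult_right_mono constant_bounds(1)[OF d3 \<rho>]) auto
    finally have 1: "real (PF_degree l) \<le> ?C * tau_min K powr (real d / 2)" .
    have "real (PF_degree l) \<le> (61 * real d * 2 ^ d / (1 - \<rho>)) ^ d * sqrt \<bar>discriminant K\<bar>"
      using P.PF_degree_le_discriminant large unfolding P\<rho> AK Ad by simp
    also have "\<dots> \<le> ?C * sqrt \<bar>discriminant K\<bar>"
      by (intro mult_right_mono constant_bounds(2)[OF d3 \<rho>]) auto
    finally have 2: "real (PF_degree l) \<le> ?C * sqrt \<bar>discriminant K\<bar>" .
    show ?thesis using 1 2 by (simp add: mult.assoc le_max_iff_disj)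
  qed
qed

end
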